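(* Let $S$ be a compact non-singular real analytic $k$-dimensional submanifold of Euclidean space $\mathbb{E}^n$ and let $\Delta_{S\hookrightarrow\mathbb{E}^n}$ denote its submanifold Schrödinger operator (defined in the context). (1) If $k=1$, $n=3$, so that $S$ is a curve $C$ in $\mathbb{E}^3$, then $$-\Delta_{C\hookrightarrow\mathbb{E}^3}=-\partial_s^2-\frac14|\kappa_{\mathbb{C}}|^2,$$ where $s$ is the arclength of $C$ and $\kappa_{\mathbb{C}}=\kappa(s)\exp\left(\sqrt{-1}\int^s\tau\,ds\right)$ is the complex curvature of $C$, with $\kappa$ and $\tau$ the Frenet–Serret curvature and torsion of $C$. (2) If $k=2$, $n=3$, so that $S$ is a conformal surface in $\mathbb{E}^3$, then $$-\Delta_{S\hookrightarrow\mathbb{E}^3}=-\Delta_S-(H^2-K),$$ where $\Delta_S$ is the Beltrami–Laplace operator of the induced metric on $S$, and $H$ and $K$ are the mean and Gauss curvatures of $S$.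
   Context: Normalization: $H$ is half the trace and $K$ the determinant of the shape operator. The Beltrami–Laplace operator of a metric $g$ is $\Delta=g^{-1/2}\partial_i\,g^{1/2}\,\tilde g^{ij}\partial_j$ in local coordinates, where $g=\det(g_{ij})$ and $(\tilde g^{ij})$ is the inverse matrix of $(g_{ij})$. Tubular coordinates. Let $T_S\subset\mathbb{E}^n$ be a tubular neighborhood of $S$. Locally, let $s=(s^1,\dots,s^k)$ be a coordinate system of $S$, let $X(s)$ be the position vector, and let $e_{k+1}(s),\dots,e_n(s)$ be an orthonormal frame of the normal bundle such that every $\partial e_{\dot\alpha}/\partial s^\alpha$ is tangent to $S$ (for a surface in $\mathbb{E}^3$ this is just a unit normal field; for a curve it is a frame parallel in the normal bundle). Points of $T_S$ are written $Y=X(s)+\sum_{\dot\alpha=k+1}^n q^{\dot\alpha}e_{\dot\alpha}(s)$, giving local coordinates $u=(u^\mu)=(s^1,\dots,s^k,q^{k+1},\dots,q^n)$ on $T_S$. Let $g_{T_S}$ be the determinant of the Euclidean metric in these coordinates, and $\Delta_{T_S}$ the Euclidean Laplacian $\Delta_{\mathbb{E}^n}$ restricted to $T_S$. Anti-self-adjoint connection: $\nabla^{\mathrm{SA}}_\mu:=g_{T_S}^{-1/4}\,\frac{\partial}{\partial u^\mu}\,g_{T_S}^{1/4}=\frac{\partial}{\partial u^\mu}+\frac14\frac{\partial\log g_{T_S}}{\partial u^\mu}$ (composition of operators). These operators commute with one another. Submanifold Schrödinger operator. Write $\Delta_{T_S}$ in the standard form $\sum_{\alpha}a_\alpha(s,q)\,(\nabla^{\mathrm{SA}})^\alpha$,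 with coefficient functions on the left and, in each term, the normal operators $\nabla^{\mathrm{SA}}_{\dot\alpha}$ ($\dot\alpha=k+1,\dots,n$, associated with $q^{\dot\alpha}$) rightmost. Restrict coefficients to $S$, i.e. put $q^{k+1}=\dots=q^n=0$, and then delete every term containing a factor $\nabla^{\mathrm{SA}}_{\dot\alpha}$ (i.e. put $\nabla^{\mathrm{SA}}_{\dot\alpha}=0$). In the remaining expression $\nabla^{\mathrm{SA}}_\alpha$ ($\alpha=1,\dots,k$) becomes $g_S^{-1/4}\frac{\partial}{\partial s^\alpha}g_S^{1/4}$ with $g_S=g_{T_S}|_{q=0}$ the determinant of the induced metric of $S$, so the result is a differential operator on $S$; it is denoted $\Delta_{S\hookrightarrow\mathbb{E}^n}$. *)

theory Defs
  imports "HOL-Analysis.Analysis"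
begin

section \<open>Smooth and real analytic maps between coordinate spaces\<close>

definition partial :: "'d \<Rightarrow> (real^'d \<Rightarrow> 'b::real_normed_vector) \<Rightarrow> real^'d \<Rightarrow> 'b"
  where "partial i f x = frechet_derivative f (at x) (axis i 1)"

text \<open>\<open>C\<^sup>\<infinity>\<close>: all iterated partial derivatives exist and are differentiable. Only used for open \<open>U\<close>.\<close>

definition smooth_on :: "(real^'d) set \<Rightarrow> (real^'d \<Rightarrow> 'b::real_normed_vector) \<Rightarrow> bool"
  where "smooth_on U f \<longleftrightarrow> (\<forall>is. foldr partial is f differentiable_on U)"

text \<open>The monomial \<open>D\<^sup>\<alpha>\<close> in a family of operators. The factors are composed in some
  fixed order of the indices, which is immaterial for the commuting families to which it is applied.\<close>

definition op_monomial :: "('d::finite \<Rightarrow> 'f \<Rightarrow> 'f) \<Rightarrow> ('d \<Rightarrow> nat) \<Rightarrow> 'f \<Rightarrow> 'f"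
  where "op_monomial D \<alpha> = foldr (\<lambda>i. D i ^^ \<alpha> i) (SOME is. distinct is \<and> set is = UNIV)"

text \<open>Real analytic: smooth, and near each point equal to its Taylor series.\<close>

definition real_analytic_on ::
    "(real^'d) set \<Rightarrow> (real^'d \<Rightarrow> 'b::real_normed_vector) \<Rightarrow> bool"
  where "real_analytic_on U f \<longleftrightarrow> smooth_on U f \<and>
    (\<forall>a\<in>U. \<exists>r>0. \<forall>x\<in>ball a r.
      ((\<lambda>\<alpha>. (\<Prod>i\<in>UNIV. (x$i - a$i) ^ \<alpha> i / fact (\<alpha> i)) *\<^sub>R op_monomial partial \<alpha> f a)
        has_sum f x) UNIV)"


section \<open>Submanifolds of Euclidean space and tubular neighbourhoods\<close>

text \<open>A chart is given by its inverse, the position vector \<open>X\<close> as a function of the coordinates.\<close>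

definition analytic_chart ::
    "(real^'n) set \<Rightarrow> (real^'k) set \<Rightarrow> (real^'k \<Rightarrow> real^'n) \<Rightarrow> bool"
  where "analytic_chart S U X \<longleftrightarrow>
    open U \<and> real_analytic_on U X \<and> (\<forall>s\<in>U. inj (frechet_derivative X (at s))) \<and>
    openin (top_of_set S) (X ` U) \<and> (\<exists>X'. homeomorphism U (X ` U) X X')"

text \<open>The dimension of the submanifold is the cardinality of the type \<open>'k\<close>.\<close>

definition analytic_submanifold :: "'k::finite itself \<Rightarrow> (real^'n) set \<Rightarrow> bool"
  where "analytic_submanifold _ S \<longleftrightarrow>
    (\<forall>p\<in>S. \<exists>(U::(real^'k) set) X. analytic_chart S U X \<and> p \<in> X ` U)"

definition normal_disc_bundle ::
    "'k::finite itself \<Rightarrow> (real^'n) set \<Rightarrow> real \<Rightarrow> ((real^'n) \<times> (real^'n)) set"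
  where "normal_disc_bundle _ S \<epsilon> =
    {(p, v). norm v < \<epsilon> \<and> (\<exists>(U::(real^'k) set) X s. analytic_chart S U X \<and> s \<in> U \<and> p = X s \<and>
      (\<forall>\<alpha>. v \<bullet> partial \<alpha> X s = 0))}"

text \<open>\<open>(p, v) \<mapsto> p + v\<close> is a diffeomorphism of the open normal \<open>\<epsilon>\<close>-disc bundle onto the open set
  \<open>T\<close>: its inverse is \<open>y \<mapsto> (\<pi> y, y - \<pi> y)\<close>.\<close>

definition tubular_neighbourhood ::
    "'k::finite itself \<Rightarrow> (real^'n) set \<Rightarrow> real \<Rightarrow> (real^'n) set \<Rightarrow> bool"
  where "tubular_neighbourhood k S \<epsilon> T \<longleftrightarrow> \<epsilon> > 0 \<and> open T \<and>
    T = (\<lambda>(p, v). p + v) ` normal_disc_bundle k S \<epsilon> \<and>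
    (\<exists>\<pi> :: real^'n \<Rightarrow> real^'n. smooth_on T \<pi> \<and>
      (\<forall>(p, v) \<in> normal_disc_bundle k S \<epsilon>. \<pi> (p + v) = p))"

definition adapted_frame ::
    "(real^'k) set \<Rightarrow> (real^'k \<Rightarrow> real^'n) \<Rightarrow> ('m::finite \<Rightarrow> real^'k \<Rightarrow> real^'n) \<Rightarrow> bool"
  where "adapted_frame U X e \<longleftrightarrow> CARD('n) = CARD('k) + CARD('m) \<and>
    (\<forall>i. smooth_on U (e i)) \<and>
    (\<forall>s\<in>U. (\<forall>i j. e i s \<bullet> e j s = (if i = j then 1 else 0)) \<and>
            (\<forall>i \<alpha>. e i s \<bullet> partial \<alpha> X s = 0) \<and>
            (\<forall>i \<alpha>. partial \<alpha> (e i) s \<in> span (range (\<lambda>\<beta>. partial \<beta> X s))))"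

text \<open>Tubular coordinates \<open>u = (s, q)\<close> are vectors indexed by the sum type \<open>'k + 'm\<close>; the
  tangential indices are \<open>Inl \<alpha>\<close> and the normal ones \<open>Inr i\<close>.\<close>

definition tang_part :: "real^('k::finite + 'm::finite) \<Rightarrow> real^'k"
  where "tang_part u = (\<chi> \<alpha>. u $ Inl \<alpha>)"

definition norm_part :: "real^('k::finite + 'm::finite) \<Rightarrow> real^'m"
  where "norm_part u = (\<chi> i. u $ Inr i)"

definition zero_section :: "real^'k \<Rightarrow> real^('k::finite + 'm::finite)"
  where "zero_section s = (\<chi> \<mu>. case \<mu> of Inl \<alpha> \<Rightarrow> s $ \<alpha> | Inr i \<Rightarrow> 0)"

definition tube_map ::
    "(real^'k \<Rightarrow> real^'n) \<Rightarrow> ('m::finite \<Rightarrow> real^'k \<Rightarrow> real^'n) \<Rightarrow> real^('k::finite + 'm::finite) \<Rightarrow> real^'n"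
  where "tube_map X e u =
    X (tang_part u) + (\<Sum>i\<in>UNIV. (norm_part u $ i) *\<^sub>R e i (tang_part u))"

definition tube_domain :: "(real^'k) set \<Rightarrow> real \<Rightarrow> (real^('k::finite + 'm::finite)) set"
  where "tube_domain U \<epsilon> = {u. tang_part u \<in> U \<and> norm (norm_part u) < \<epsilon>}"


section \<open>Metrics, Laplacians and the anti-self-adjoint connection\<close>

definition induced_metric :: "(real^'d \<Rightarrow> real^'n) \<Rightarrow> real^'d \<Rightarrow> real^'d^'d"
  where "induced_metric Y u = (\<chi> i j. partial i Y u \<bullet> partial j Y u)"

definition metric_det :: "(real^'d \<Rightarrow> real^'n) \<Rightarrow> real^'d \<Rightarrow> real"
  where "metric_det Y u = det (induced_metric Y u)"

definition euclidean_laplacian :: "(real^'n \<Rightarrow> complex) \<Rightarrow> real^'n \<Rightarrow> complex"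
  where "euclidean_laplacian F y = (\<Sum>i\<in>UNIV. partial i (partial i F) y)"

definition beltrami_laplace :: "(real^'d \<Rightarrow> real^'d^'d) \<Rightarrow> (real^'d \<Rightarrow> complex) \<Rightarrow> real^'d \<Rightarrow> complex"
  where "beltrami_laplace G f x = (det (G x) powr (-1/2)) *\<^sub>R (\<Sum>i\<in>UNIV. partial i
    (\<lambda>y. (det (G y) powr (1/2)) *\<^sub>R (\<Sum>j\<in>UNIV. (matrix_inv (G y) $ i $ j) *\<^sub>R partial j f y)) x)"

definition sa_connection ::
    "(real^'d \<Rightarrow> real) \<Rightarrow> 'd \<Rightarrow> (real^'d \<Rightarrow> complex) \<Rightarrow> real^'d \<Rightarrow> complex"
  where "sa_connection g \<mu> f u =
    (g u powr (-1/4)) *\<^sub>R partial \<mu> (\<lambda>v. (g v powr (1/4)) *\<^sub>R f v) u"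


section \<open>The submanifold Schroedinger operator\<close>

text \<open>\<open>a\<close> gives the coefficients of the Euclidean Laplacian, on the coordinate patch of the tubular
  neighbourhood, with respect to the monomials in the anti-self-adjoint connection, the normal
  operators standing to the right. A multi-index is a pair of a tangential and a normal one.
  The coefficients are only determined on the coordinate domain.\<close>

definition standard_form ::
    "(real^'k) set \<Rightarrow> real \<Rightarrow> (real^'k \<Rightarrow> real^'n) \<Rightarrow>
     ('m::finite \<Rightarrow> real^'k \<Rightarrow> real^'n) \<Rightarrow>
     (('k \<Rightarrow> nat) \<times> ('m \<Rightarrow> nat) \<Rightarrow> real^('k::finite + 'm::finite) \<Rightarrow> real) \<Rightarrow> bool"
  where "standard_form U \<epsilon> X e a \<longleftrightarrow>
    (let Y = tube_map X e; \<Omega> = tube_domain U \<epsilon>; D = sa_connection (metric_det Y) in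
      finite {p. a p \<noteq> (\<lambda>_. 0)} \<and>
      (\<forall>F. smooth_on (Y ` \<Omega>) F \<longrightarrow> (\<forall>u\<in>\<Omega>. euclidean_laplacian F (Y u) =
        (\<Sum>(\<beta>, \<gamma>) \<in> {p. a p \<noteq> (\<lambda>_. 0)}. a (\<beta>, \<gamma>) u *\<^sub>R
          op_monomial (\<lambda>\<alpha>. D (Inl \<alpha>)) \<beta> (op_monomial (\<lambda>i. D (Inr i)) \<gamma> (F \<circ> Y)) u))))"

text \<open>The operator in the coordinates given by \<open>X\<close>, acting on functions on \<open>U\<close>: only the terms
  with normal multi-index 0 survive, with their coefficients taken at \<open>q = 0\<close>.\<close>

definition submanifold_schroedinger ::
    "(real^'k) set \<Rightarrow> real \<Rightarrow> (real^'k \<Rightarrow> real^'n) \<Rightarrow>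
     ('m::finite \<Rightarrow> real^'k \<Rightarrow> real^'n) \<Rightarrow> (real^'k \<Rightarrow> complex) \<Rightarrow> real^'k \<Rightarrow> complex"
  where "submanifold_schroedinger U \<epsilon> X e f s =
    (let a = (SOME a. standard_form U \<epsilon> X e a) in
      \<Sum>\<beta> \<in> {\<beta>. a (\<beta>, \<lambda>_. 0) \<noteq> (\<lambda>_. 0)}. a (\<beta>, \<lambda>_. 0) (zero_section s) *\<^sub>R
        op_monomial (sa_connection (metric_det X)) \<beta> f s)"


section \<open>Curves: Frenet--Serret apparatus and complex curvature\<close>

text \<open>\<open>\<partial>\<^sub>s\<close> for the arclength \<open>s\<close>, in an arbitrary coordinate \<open>t\<close> of the curve:
  \<open>ds = |\<partial>X/\<partial>t| dt\<close>.\<close>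

definition arclength_deriv ::
    "(real^1 \<Rightarrow> real^3) \<Rightarrow> (real^1 \<Rightarrow> 'b::real_normed_vector) \<Rightarrow> real^1 \<Rightarrow> 'b"
  where "arclength_deriv X f t = partial 1 f t /\<^sub>R norm (partial 1 X t)"

definition frenet_tangent :: "(real^1 \<Rightarrow> real^3) \<Rightarrow> real^1 \<Rightarrow> real^3"
  where "frenet_tangent X = arclength_deriv X X"

definition frenet_curvature :: "(real^1 \<Rightarrow> real^3) \<Rightarrow> real^1 \<Rightarrow> real"
  where "frenet_curvature X t = norm (arclength_deriv X (frenet_tangent X) t)"

text \<open>At an inflection point (\<open>\<kappa> = 0\<close>) the principal normal, and hence the torsion, is 0 by
  convention.\<close>

definition frenet_normal :: "(real^1 \<Rightarrow> real^3) \<Rightarrow> real^1 \<Rightarrow> real^3"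
  where "frenet_normal X t = arclength_deriv X (frenet_tangent X) t /\<^sub>R frenet_curvature X t"

definition frenet_binormal :: "(real^1 \<Rightarrow> real^3) \<Rightarrow> real^1 \<Rightarrow> real^3"
  where "frenet_binormal X t = cross3 (frenet_tangent X t) (frenet_normal X t)"

definition frenet_torsion :: "(real^1 \<Rightarrow> real^3) \<Rightarrow> real^1 \<Rightarrow> real"
  where "frenet_torsion X t = - (arclength_deriv X (frenet_binormal X) t \<bullet> frenet_normal X t)"

text \<open>\<open>t0\<close> is the base point of the indefinite integral of the torsion along the curve.\<close>

definition complex_curvature :: "(real^1 \<Rightarrow> real^3) \<Rightarrow> real^1 \<Rightarrow> real^1 \<Rightarrow> complex"
  where "complex_curvature X t0 t = of_real (frenet_curvature X t) *
    exp (\<i> * of_real (LBINT r = ereal (t0 $ 1) .. ereal (t $ 1).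
      frenet_torsion X (vec r) * norm (partial 1 X (vec r))))"


section \<open>Surfaces: shape operator, mean and Gauss curvature\<close>

text \<open>Matrix of the shape operator \<open>v \<mapsto> - d\<nu>(v)\<close> in the basis \<open>\<partial>X/\<partial>s\<^sup>\<alpha>\<close> of the tangent plane.\<close>

definition shape_operator ::
    "(real^2 \<Rightarrow> real^3) \<Rightarrow> (real^2 \<Rightarrow> real^3) \<Rightarrow> real^2 \<Rightarrow> real^2^2"
  where "shape_operator X \<nu> s =
    (THE A. \<forall>\<beta>. - partial \<beta> \<nu> s = (\<Sum>\<alpha>\<in>UNIV. (A $ \<alpha> $ \<beta>) *\<^sub>R partial \<alpha> X s))"

definition mean_curvature ::
    "(real^2 \<Rightarrow> real^3) \<Rightarrow> (real^2 \<Rightarrow> real^3) \<Rightarrow> real^2 \<Rightarrow> real"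
  where "mean_curvature X \<nu> s = trace (shape_operator X \<nu> s) / 2"

definition gauss_curvature ::
    "(real^2 \<Rightarrow> real^3) \<Rightarrow> (real^2 \<Rightarrow> real^3) \<Rightarrow> real^2 \<Rightarrow> real"
  where "gauss_curvature X \<nu> s = det (shape_operator X \<nu> s)"

end

theory Submission
  imports Defs
begin

text \<open>Extend \<open>f\<close> from \<open>S\<close> to the function \<open>\<phi>(s, q) = g\<^sub>T(s, q)\<^sup>-\<^sup>1\<^sup>/\<^sup>4 g\<^sub>S(s)\<^sup>1\<^sup>/\<^sup>4 f(s)\<close> on the tube. It is annihilated by
  the normal anti-self-adjoint derivatives, while the tangential ones act on it as those of \<open>S\<close> act
  on \<open>f\<close>. Hence, whatever standard form is chosen, the submanifold operator applied to \<open>f\<close> is the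
  restriction to \<open>S\<close> of the Euclidean Laplacian of \<open>\<phi>\<close>. In tubular coordinates this Laplacian is
  the Beltrami--Laplace operator of \<open>S\<close> plus, for each normal direction with Weingarten matrix \<open>A\<close>,
  \<open>\<partial>\<^sub>q\<^sup>2 \<phi> - tr A \<partial>\<^sub>q \<phi>\<close> at \<open>q = 0\<close>. On a normal line \<open>g\<^sub>T = g\<^sub>S det(1 - q A)\<^sup>2\<close>, so
  \<open>\<phi> = f (1 - q tr A + q\<^sup>2 det A)\<^sup>-\<^sup>1\<^sup>/\<^sup>2\<close> for a surface, which contributes \<open>(tr A)\<^sup>2/4 - det A = H\<^sup>2 - K\<close>.
  For a curve the quadratic term is absent, and the two normal directions contribute \<open>\<kappa>\<^sup>2/4\<close>.
  A standard form exists because the connection is conjugate, by \<open>g\<^sub>T\<^sup>1\<^sup>/\<^sup>4\<close>, to the coordinate derivatives.\<close>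

section \<open>Calculus of smooth functions\<close>

text \<open>A standard form constrains its coefficients only through functions that are smooth on
  the image of the tube. Testing it on the extension therefore needs that extension as a smooth
  function of the ambient point, so tubular coordinates must be shown to have a smooth inverse; no
  uniqueness of the coefficients enters. Most identities hold only on the open coordinate domain and
  are carried through iterated operators by congruence there. The term \<open>- tr A\<close> in
  first order has its origin in the second derivatives of the position vector: contracted with the
  inverse metric, their component along a normal \<open>e i\<close> is the trace of the Weingarten
  matrix. The factor 1/4 is a balance of two terms: with \<tau> the trace and \<kappa> the quadratic
  coefficient, (1 - \<tau> q + \<kappa> q^2)^(-1/2) has first derivative \<tau>/2 and second
  derivative 3\<tau>^2/4 - \<kappa> at q = 0, and 3\<tau>^2/4 - \<kappa> - \<tau> * \<tau>/2 =
  \<tau>^2/4 - \<kappa>. At q = 0 the inverse metric is the identity on the normal directions, so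
  each normal line can be treated by itself.\<close>

lemma partial_eqI: "(f has_derivative f') (at x) \<Longrightarrow> partial i f x = f' (axis i 1)"
  unfolding partial_def using frechet_derivative_at by metis

text \<open>The Frechet derivative is a choice among the valid derivatives at the point. Functions
  that agree near the point have the same valid ones, so the choices coincide, even where there is
  no derivative at all.\<close>

lemma partial_cong:
  assumes "open U" "x \<in> U" "\<And>y. y \<in> U \<Longrightarrow> f y = g y"
  shows "partial i f x = partial i g x"
proof -
  have "(f has_derivative D) (at x) \<longleftrightarrow> (g has_derivative D) (at x)" for D
    using has_derivative_transform_within_open[of f D x UNIV U g]
      has_derivative_transform_within_open[of g D x UNIV U f] assms by auto
  then show ?thesis by (simp add: partial_def frechet_derivative_def)
qed

lemma differentiable_on_cong_open:
  assumes "f differentiable_on U" "\<And>y. y \<in> U \<Longrightarrow> f y = g y"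
  shows "g differentiable_on U"
  unfolding differentiable_on_def
proof
  fix x assume "x \<in> U"
  then obtain D where "(f has_derivative D) (at x within U)"
    using assms(1) unfolding differentiable_on_def differentiable_def by blast
  from has_derivative_transform[OF \<open>x \<in> U\<close> _ this, of g] assms(2)
  show "g differentiable at x within U" unfolding differentiable_def by auto
qed

lemma vec_axis_sum: "(v :: real^'d) = (\<Sum>i\<in>UNIV. v $ i *\<^sub>R axis i 1)"
  by (simp add: vec_eq_iff sum_component axis_def if_distrib cong: if_cong)

lemma has_derivative_partial:
  fixes f :: "real^'d \<Rightarrow> 'b::real_normed_vector"
  assumes "f differentiable at x"
  shows "(f has_derivative (\<lambda>v. \<Sum>i\<in>UNIV. v $ i *\<^sub>R partial i f x)) (at x)"
proof -
  let ?D = "frechet_derivative f (at x)"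
  have D: "(f has_derivative ?D) (at x)"
    using assms frechet_derivative_works by blast
  then have "linear ?D" by (rule has_derivative_linear)
  then have "?D v = (\<Sum>i\<in>UNIV. v $ i *\<^sub>R ?D (axis i 1))" for v
    by (subst vec_axis_sum) (simp add: linear_sum linear_scale)
  then have "?D = (\<lambda>v. \<Sum>i\<in>UNIV. v $ i *\<^sub>R partial i f x)"
    unfolding partial_def by blast
  with D show ?thesis by simp
qed

lemma has_vector_derivative_line:
  fixes f :: "real^'d \<Rightarrow> 'b::real_normed_vector"
  assumes "f differentiable at (x + t *\<^sub>R axis i 1)"
  shows "((\<lambda>t. f (x + t *\<^sub>R axis i 1)) has_vector_derivative partial i f (x + t *\<^sub>R axis i 1)) (at t)"
proof -
  let ?p = "\<lambda>t. x + t *\<^sub>R axis i (1::real)"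
  have "((\<lambda>t. f (?p t)) has_derivative
      (\<lambda>h. \<Sum>j\<in>UNIV. (h *\<^sub>R axis i (1::real)) $ j *\<^sub>R partial j f (?p t))) (at t)"
    by (rule has_derivative_compose[where f="?p" and f'="\<lambda>h. h *\<^sub>R axis i 1", OF _ has_derivative_partial[OF assms]])
       (auto intro!: derivative_eq_intros)
  moreover have "(\<Sum>j\<in>UNIV. (h *\<^sub>R axis i (1::real)) $ j *\<^sub>R partial j f (?p t)) = h *\<^sub>R partial i f (?p t)" for h
  proof -
    have "(\<Sum>j\<in>UNIV. (h *\<^sub>R axis i (1::real)) $ j *\<^sub>R partial j f (?p t))
       = (\<Sum>j\<in>UNIV. if j = i then h *\<^sub>R partial j f (?p t) else 0)"
      by (rule sum.cong) (auto simp: axis_def)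
    then show ?thesis by simp
  qed
  ultimately show ?thesis by (simp add: has_vector_derivative_def)
qed

text \<open>A class graded by order gives induction on the number of derivatives, which
  \<open>smooth_on\<close> does not offer directly. Order 0 already asks for differentiability, so
  \<open>Ck_on n\<close> provides partial derivatives up to order n + 1.\<close>

primrec Ck_on :: "nat \<Rightarrow> (real^'d) set \<Rightarrow> (real^'d \<Rightarrow> 'b::real_normed_vector) \<Rightarrow> bool" where
  "Ck_on 0 U f \<longleftrightarrow> f differentiable_on U"
| "Ck_on (Suc n) U f \<longleftrightarrow> f differentiable_on U \<and> (\<forall>i. Ck_on n U (partial i f))"

lemma Ck_on_diff: "Ck_on n U f \<Longrightarrow> f differentiable_on U"
  by (cases n) auto

lemma Ck_on_at: "Ck_on n U f \<Longrightarrow> open U \<Longrightarrow> x \<in> U \<Longrightarrow> f differentiable at x"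
  using Ck_on_diff differentiable_on_eq_differentiable_at by blast

lemma Ck_on_iff: "Ck_on n U f \<longleftrightarrow> (\<forall>is. length is \<le> n \<longrightarrow> foldr partial is f differentiable_on U)"
proof (induction n arbitrary: f)
  case (Suc n)
  show ?case
  proof
    assume C: "Ck_on (Suc n) U f"
    show "\<forall>is. length is \<le> Suc n \<longrightarrow> foldr partial is f differentiable_on U"
    proof (intro allI impI)
      fix "is" :: "'a list" assume "length is \<le> Suc n"
      then show "foldr partial is f differentiable_on U"
        \<comment> \<open>\<open>foldr\<close> applies the last index of the list first, so the list
          is split at its end.\<close>
        using C Suc.IH by (cases "is" rule: rev_cases) auto
    qed
  next
    assume A: "\<forall>is. length is \<le> Suc n \<longrightarrow> foldr partial is f differentiable_on U"
    have "foldr partial is (partial i f) differentiable_on U" if "length is \<le> n" for "is" i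
      using A[rule_format, of "is @ [i]"] that by simp
    moreover have "f differentiable_on U" using A[rule_format, of "[]"] by simp
    ultimately show "Ck_on (Suc n) U f" using Suc.IH by simp
  qed
qed auto

lemma smooth_on_iff_Ck: "smooth_on U f \<longleftrightarrow> (\<forall>n. Ck_on n U f)"
  unfolding smooth_on_def Ck_on_iff by auto

lemma smooth_on_partial: "smooth_on U f \<Longrightarrow> smooth_on U (partial i f)"
  unfolding smooth_on_iff_Ck by (metis Ck_on.simps(2))

lemma smooth_on_at: "smooth_on U f \<Longrightarrow> open U \<Longrightarrow> x \<in> U \<Longrightarrow> f differentiable at x"
  using smooth_on_iff_Ck Ck_on_at by blast

lemma Ck_on_cong:
  assumes "open U" "\<And>x. x \<in> U \<Longrightarrow> f x = g x" "Ck_on n U f"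
  shows "Ck_on n U g"
  using assms(2,3)
proof (induction n arbitrary: f g)
  case 0 then show ?case using differentiable_on_cong_open by auto
next
  case (Suc n)
  have "Ck_on n U (partial i g)" for i
    by (rule Suc.IH[of "partial i f"]) (use Suc.prems partial_cong[OF assms(1), of _ f g] in auto)
  with Suc.prems show ?case using differentiable_on_cong_open[of f U g] by auto
qed

lemma smooth_on_cong:
  "open U \<Longrightarrow> (\<And>x. x \<in> U \<Longrightarrow> f x = g x) \<Longrightarrow> smooth_on U f \<Longrightarrow> smooth_on U g"
  using Ck_on_cong smooth_on_iff_Ck by metis

text \<open>A formula for a partial derivative is available only on \<open>U\<close>. The formula is
  therefore supplied as a separate function \<open>g\<close>, whose class passes to the actual
  derivative by congruence on the open set.\<close>

lemma Ck_on_SucI: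
  assumes "open U" "f differentiable_on U"
    "\<And>i. Ck_on n U (g i)" "\<And>i x. x \<in> U \<Longrightarrow> partial i f x = g i x"
  shows "Ck_on (Suc n) U f"
proof -
  have "Ck_on n U (partial i f)" for i
    using Ck_on_cong[OF assms(1) _ assms(3)[of i]] assms(4) by metis
  with assms(2) show ?thesis by simp
qed

lemma Ck_on_const: "open U \<Longrightarrow> Ck_on n U (\<lambda>x. c)"
proof (induction n arbitrary: c)
  case (Suc n)
  show ?case
    by (rule Ck_on_SucI[where g="\<lambda>i x. 0"]) (use Suc in \<open>auto intro!: partial_eqI[THEN trans] derivative_eq_intros\<close>)
qed simp

section \<open>Differentiation rules and closure of the classes under them\<close>

lemma has_derivative_with_partials: "f differentiable at x \<Longrightarrow> \<exists>D. (f has_derivative D) (at x) \<and> (\<forall>i. D (axis i 1) = partial i f x)"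
  unfolding partial_def using frechet_derivative_works by blast

lemma partial_add:
  assumes "f differentiable at x" "g differentiable at x"
  shows "partial i (\<lambda>x. f x + g x) x = partial i f x + partial i g x"
proof -
  obtain D where D: "(f has_derivative D) (at x)" "\<forall>i. D (axis i 1) = partial i f x"
    using has_derivative_with_partials[OF assms(1)] by blast
  obtain E where E: "(g has_derivative E) (at x)" "\<forall>i. E (axis i 1) = partial i g x"
    using has_derivative_with_partials[OF assms(2)] by blast
  show ?thesis using partial_eqI[OF has_derivative_add[OF D(1) E(1)]] D(2) E(2) by simp
qed

lemma partial_bounded_bilinear:
  assumes "bounded_bilinear h" "f differentiable at x" "g differentiable at x"
  shows "partial i (\<lambda>x. h (f x) (g x)) x = h (f x) (partial i g x) + h (partial i f x) (g x)"
proof -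
  obtain D where D: "(f has_derivative D) (at x)" "\<forall>i. D (axis i 1) = partial i f x"
    using has_derivative_with_partials[OF assms(2)] by blast
  obtain E where E: "(g has_derivative E) (at x)" "\<forall>i. E (axis i 1) = partial i g x"
    using has_derivative_with_partials[OF assms(3)] by blast
  show ?thesis
    using partial_eqI[OF bounded_bilinear.FDERIV[OF assms(1) D(1) E(1)]] D(2) E(2) by simp
qed

lemma partial_bounded_linear:
  assumes "bounded_linear h" "f differentiable at x"
  shows "partial i (\<lambda>x. h (f x)) x = h (partial i f x)"
proof -
  obtain D where D: "(f has_derivative D) (at x)" "\<forall>i. D (axis i 1) = partial i f x"
    using has_derivative_with_partials[OF assms(2)] by blast
  show ?thesis using partial_eqI[OF bounded_linear.has_derivative[OF assms(1) D(1)]] D(2) by simp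
qed

lemma differentiable_on_bounded_linear:
  "bounded_linear h \<Longrightarrow> f differentiable_on U \<Longrightarrow> (\<lambda>x. h (f x)) differentiable_on U"
  unfolding differentiable_on_def differentiable_def
  by (fast intro: bounded_linear.has_derivative)

lemma Ck_on_bounded_linear:
  assumes "open U" "bounded_linear h"
  shows "Ck_on n U f \<Longrightarrow> Ck_on n U (\<lambda>x. h (f x))"
proof (induction n arbitrary: f)
  case 0 then show ?case
    using assms(2) by (simp add: differentiable_on_bounded_linear)
next
  case (Suc n)
  have "partial i (\<lambda>x. h (f x)) x = h (partial i f x)" if "x \<in> U" for i x
    using Ck_on_at[OF Suc.prems assms(1) that] assms(2) by (rule partial_bounded_linear[rotated])
  then show ?case
    by (intro Ck_on_SucI[where g="\<lambda>i x. h (partial i f x)"])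
      (use Suc assms in \<open>auto intro: differentiable_on_bounded_linear\<close>)
qed

lemma Ck_on_add:
  assumes "open U"
  shows "Ck_on n U f \<Longrightarrow> Ck_on n U g \<Longrightarrow> Ck_on n U (\<lambda>x. f x + g x)"
proof (induction n arbitrary: f g)
  case 0 then show ?case by (simp add: differentiable_on_add)
next
  case (Suc n)
  have "partial i (\<lambda>x. f x + g x) x = partial i f x + partial i g x" if "x \<in> U" for i x
    using Ck_on_at[OF Suc.prems(1) assms that] Ck_on_at[OF Suc.prems(2) assms that] by (rule partial_add)
  then show ?case
    by (intro Ck_on_SucI[where g="\<lambda>i x. partial i f x + partial i g x"])
      (use Suc assms in \<open>auto intro!: differentiable_on_add\<close>)
qed

lemma Ck_on_sum:
  assumes "open U" "\<And>a. a \<in> A \<Longrightarrow> Ck_on n U (f a)"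
  shows "Ck_on n U (\<lambda>x. \<Sum>a\<in>A. f a x)"
  using assms(2)
  by (induction A rule: infinite_finite_induct) (auto intro: Ck_on_const Ck_on_add assms(1))

lemma Ck_on_mono: "Ck_on (Suc n) U f \<Longrightarrow> Ck_on n U f"
  by (induction n arbitrary: f) auto

lemma differentiable_on_bounded_bilinear:
  "bounded_bilinear h \<Longrightarrow> f differentiable_on U \<Longrightarrow> g differentiable_on U
    \<Longrightarrow> (\<lambda>x. h (f x) (g x)) differentiable_on U"
  unfolding differentiable_on_def differentiable_def
  by (fast intro: bounded_bilinear.FDERIV)

text \<open>One induction by the Leibniz rule serves scaling, products and inner products. In each
  term the undifferentiated factor is used one order below its own, hence
  \<open>Ck_on_mono\<close>.\<close>

lemma Ck_on_bounded_bilinear: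
  assumes "open U" "bounded_bilinear h"
  shows "Ck_on n U f \<Longrightarrow> Ck_on n U g \<Longrightarrow> Ck_on n U (\<lambda>x. h (f x) (g x))"
proof (induction n arbitrary: f g)
  case 0 then show ?case
    using differentiable_on_bounded_bilinear[OF assms(2)] by simp
next
  case (Suc n)
  have d: "(\<lambda>x. h (f x) (g x)) differentiable_on U"
    using Suc.prems by (intro differentiable_on_bounded_bilinear[OF assms(2)]) auto
  have "partial i (\<lambda>x. h (f x) (g x)) x = h (f x) (partial i g x) + h (partial i f x) (g x)" if "x \<in> U" for i x
    using assms(2) Ck_on_at[OF Suc.prems(1) assms(1) that] Ck_on_at[OF Suc.prems(2) assms(1) that]
    by (rule partial_bounded_bilinear)
  moreover have "Ck_on n U (\<lambda>x. h (f x) (partial i g x) + h (partial i f x) (g x))" for i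
    using Suc Ck_on_mono[OF Suc.prems(1)] Ck_on_mono[OF Suc.prems(2)] assms(1) by (auto intro: Ck_on_add)
  ultimately show ?case
    using assms(1) d by (intro Ck_on_SucI[where g="\<lambda>i x. h (f x) (partial i g x) + h (partial i f x) (g x)"])
qed

lemmas Ck_on_scaleR = Ck_on_bounded_bilinear[OF _ bounded_bilinear_scaleR]
lemmas Ck_on_mult = Ck_on_bounded_bilinear[OF _ bounded_bilinear_mult]
lemmas Ck_on_inner = Ck_on_bounded_bilinear[OF _ bounded_bilinear_inner]

lemma Ck_on_prod:
  fixes f :: "'a \<Rightarrow> real^'d \<Rightarrow> real"
  assumes "open U" "\<And>a. a \<in> A \<Longrightarrow> Ck_on n U (f a)"
  shows "Ck_on n U (\<lambda>x. \<Prod>a\<in>A. f a x)"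
  using assms(2)
  by (induction A rule: infinite_finite_induct) (auto intro: Ck_on_const Ck_on_mult assms(1))

lemma partial_compose:
  fixes g :: "real^'d \<Rightarrow> real^'n"
  assumes "f differentiable at (g x)" "g differentiable at x"
  shows "partial i (\<lambda>x. f (g x)) x = (\<Sum>j\<in>UNIV. partial i g x $ j *\<^sub>R partial j f (g x))"
proof -
  obtain D where D: "(g has_derivative D) (at x)" "\<forall>i. D (axis i 1) = partial i g x"
    using has_derivative_with_partials[OF assms(2)] by blast
  show ?thesis
    using partial_eqI[OF has_derivative_compose[OF D(1) has_derivative_partial[OF assms(1)]]] D(2) by simp
qed

text \<open>The chain rule expresses the partial derivatives of the composition by those of
  \<open>g\<close> and by partial derivatives of \<open>f\<close> composed with the same
  \<open>g\<close>; so the induction varies \<open>f\<close> and keeps \<open>g\<close>.\<close>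

lemma Ck_on_compose:
  fixes g :: "real^'d \<Rightarrow> real^'n"
  assumes "open U" "open V" "g ` U \<subseteq> V"
  shows "Ck_on n V f \<Longrightarrow> Ck_on n U g \<Longrightarrow> Ck_on n U (\<lambda>x. f (g x))"
proof (induction n arbitrary: f)
  case 0
  then show ?case
    using assms(3) differentiable_on_subset by (auto intro!: differentiable_on_compose[of g])
next
  case (Suc n)
  show ?case
  proof (rule Ck_on_SucI[where g="\<lambda>i x. \<Sum>j\<in>UNIV. partial i g x $ j *\<^sub>R partial j f (g x)"])
    show "(\<lambda>x. f (g x)) differentiable_on U"
      using Suc.prems assms(3) differentiable_on_subset by (auto intro!: differentiable_on_compose[of g])
    show "Ck_on n U (\<lambda>x. \<Sum>j\<in>UNIV. partial i g x $ j *\<^sub>R partial j f (g x))" for i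
      using Suc assms(1) Ck_on_mono[OF Suc.prems(2)]
      by (auto intro!: Ck_on_sum Ck_on_scaleR Ck_on_bounded_linear[OF _ bounded_linear_vec_nth])
    show "partial i (\<lambda>x. f (g x)) x = (\<Sum>j\<in>UNIV. partial i g x $ j *\<^sub>R partial j f (g x))"
      if "x \<in> U" for i x
      using that Ck_on_at[OF Suc.prems(1) assms(2)] Ck_on_at[OF Suc.prems(2) assms(1)] assms(3)
      by (auto intro!: partial_compose)
  qed fact
qed

lemma Ck_on_linear:
  fixes h :: "real^'d \<Rightarrow> 'b::real_normed_vector"
  assumes "open U" "bounded_linear h"
  shows "Ck_on n U h"
proof (cases n)
  case 0 then show ?thesis
    using assms bounded_linear_imp_differentiable_on by auto
next
  case (Suc m)
  have "Ck_on (Suc m) U h"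
    by (rule Ck_on_SucI[where g="\<lambda>i x. h (axis i 1)"])
      (use assms in \<open>auto intro!: Ck_on_const partial_eqI bounded_linear_imp_differentiable_on
          bounded_linear_imp_has_derivative\<close>)
  with Suc show ?thesis by simp
qed

lemma partial_powr:
  fixes f :: "real^'d \<Rightarrow> real"
  assumes "f differentiable at x" "f x > 0"
  shows "partial i (\<lambda>x. f x powr a) x = a * f x powr (a - 1) * partial i f x"
proof -
  obtain D where D: "(f has_derivative D) (at x)" "\<forall>i. D (axis i 1) = partial i f x"
    using has_derivative_with_partials[OF assms(1)] by blast
  have "((\<lambda>x. f x powr a) has_derivative (\<lambda>h. f x powr a * (a * D h / f x))) (at x)"
    using has_derivative_powr[OF D(1), of "\<lambda>_. a" "\<lambda>_. 0"] assms(2) by (simp add: mult.commute)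
  from partial_eqI[OF this, of i] show ?thesis
    using D(2) assms(2) by (simp add: powr_diff field_simps)
qed

text \<open>Each differentiation lowers the exponent by one, so the induction runs over all
  exponents at once.\<close>

lemma Ck_on_powr:
  fixes f :: "real^'d \<Rightarrow> real"
  assumes "open U" "\<And>x. x \<in> U \<Longrightarrow> f x > 0"
  shows "Ck_on n U f \<Longrightarrow> Ck_on n U (\<lambda>x. f x powr a)"
proof -
  have D: "(\<lambda>x. f x powr a) differentiable_on U" if C: "Ck_on n U f" for n a
  proof -
    have "(\<lambda>x. f x powr a) differentiable at x" if "x \<in> U" for x
      using has_derivative_powr[OF has_derivative_partial[OF Ck_on_at[OF C assms(1) that]]
        has_derivative_const assms(2)[OF that]] unfolding differentiable_def by blast
    then show ?thesis using assms(1) differentiable_on_eq_differentiable_at by blast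
  qed
  show "Ck_on n U f \<Longrightarrow> Ck_on n U (\<lambda>x. f x powr a)"
  proof (induction n arbitrary: a)
  case 0
  show ?case using D[OF 0] by simp
next
  case (Suc n)
  show ?case
  proof (rule Ck_on_SucI[where g="\<lambda>i x. a * f x powr (a - 1) * partial i f x"])
    show "(\<lambda>x. f x powr a) differentiable_on U"
      using D[OF Suc.prems] .
    show "Ck_on n U (\<lambda>x. a * f x powr (a - 1) * partial i f x)" for i
      using Suc assms(1) Ck_on_mono[OF Suc.prems] by (auto intro!: Ck_on_mult Ck_on_const)
    show "partial i (\<lambda>x. f x powr a) x = a * f x powr (a - 1) * partial i f x" if "x \<in> U" for i x
      using that Ck_on_at[OF Suc.prems assms(1)] assms(2) by (auto intro!: partial_powr)
  qed fact
qed
qed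

lemma Ck_on_det:
  fixes M :: "real^'d \<Rightarrow> real^'m^'m"
  assumes "open U" "\<And>i j. Ck_on n U (\<lambda>x. M x $ i $ j)"
  shows "Ck_on n U (\<lambda>x. det (M x))"
  unfolding det_def using assms
  by (auto intro!: Ck_on_sum Ck_on_mult Ck_on_const Ck_on_prod)

lemma Ck_on_vec:
  fixes f :: "real^'d \<Rightarrow> real^'n"
  assumes "open U" "\<And>i. Ck_on n U (\<lambda>x. f x $ i)"
  shows "Ck_on n U f"
proof -
  have "Ck_on n U (\<lambda>x. \<Sum>i\<in>UNIV. f x $ i *\<^sub>R axis i (1::real))"
    using assms by (auto intro!: Ck_on_sum Ck_on_scaleR Ck_on_const)
  moreover have "(\<lambda>x. \<Sum>i\<in>UNIV. f x $ i *\<^sub>R axis i (1::real)) = f"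
    by (rule ext, rule vec_axis_sum[symmetric])
  ultimately show ?thesis by (rule back_subst)
qed

text \<open>The second difference over a square of side r does not depend on the order of the two
  directions. Two applications of the mean value theorem turn it into r^2 times a mixed derivative
  at a nearby point, in either order. The second partial derivatives are differentiable, hence
  continuous, and the square shrinks to x.\<close>

lemma partial_symmetric_real:
  fixes f :: "real^'d \<Rightarrow> real"
  assumes U: "open U" and x: "x \<in> U" and C: "Ck_on 2 U f"
  shows "partial i (partial j f) x = partial j (partial i f) x"
proof -
  have C1: "Ck_on 1 U (partial i f)" for i
    using C by (simp add: numeral_2_eq_2)
  have key: "\<exists>z\<in>ball x d. (f (x + r *\<^sub>R axis i 1 + r *\<^sub>R axis j 1) - f (x + r *\<^sub>R axis i 1)
      - (f (x + r *\<^sub>R axis j 1) - f x)) = r * r * partial j (partial i f) z"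
    if d: "ball x d \<subseteq> U" "r > 0" "2 * r < d" for d r i j
  proof -
    have in_ball: "x + s *\<^sub>R axis i 1 + t *\<^sub>R axis j 1 \<in> ball x d" if "0 \<le> s" "s \<le> r" "0 \<le> t" "t \<le> r" for s t
    proof -
      have "norm (s *\<^sub>R axis i (1::real) + t *\<^sub>R axis j 1) \<le> s + t"
        by (rule norm_triangle_le) (use that in \<open>simp add: norm_axis_1\<close>)
      moreover have "dist x (x + s *\<^sub>R axis i 1 + t *\<^sub>R axis j 1) = norm (s *\<^sub>R axis i (1::real) + t *\<^sub>R axis j 1)"
        by (metis add.assoc dist_commute dist_norm add_diff_cancel_left')
      ultimately show ?thesis using that d by auto
    qed
    define g where "g s = f (x + r *\<^sub>R axis j 1 + s *\<^sub>R axis i 1) - f (x + s *\<^sub>R axis i 1)" for s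
    have inb: "x + t *\<^sub>R axis j 1 + s *\<^sub>R axis i 1 \<in> U" "x + s *\<^sub>R axis i 1 + t *\<^sub>R axis j 1 \<in> U"
      if "0 \<le> s" "s \<le> r" "0 \<le> t" "t \<le> r" for s t
      using in_ball[OF that] d(1) by (auto simp: add.commute add.left_commute add.assoc)
    have "(g has_real_derivative (partial i f (x + r *\<^sub>R axis j 1 + s *\<^sub>R axis i 1) - partial i f (x + s *\<^sub>R axis i 1))) (at s)"
      if "0 \<le> s" "s \<le> r" for s
      unfolding g_def has_real_derivative_iff_has_vector_derivative
      using inb(1)[of s r] inb(1)[of s 0] that d(2) Ck_on_at[OF C U]
      by (intro has_vector_derivative_diff has_vector_derivative_line) auto
    from MVT2[OF d(2) this] obtain s where s: "0 < s" "s < r"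
      "g r - g 0 = r * (partial i f (x + r *\<^sub>R axis j 1 + s *\<^sub>R axis i 1) - partial i f (x + s *\<^sub>R axis i 1))"
      by auto
    define h where "h t = partial i f (x + s *\<^sub>R axis i 1 + t *\<^sub>R axis j 1)" for t
    have "(h has_real_derivative (partial j (partial i f) (x + s *\<^sub>R axis i 1 + t *\<^sub>R axis j 1))) (at t)"
      if "0 \<le> t" "t \<le> r" for t
      unfolding h_def has_real_derivative_iff_has_vector_derivative
      using inb(2)[of s t] that s Ck_on_at[OF C1 U]
      by (intro has_vector_derivative_line) auto
    from MVT2[OF d(2) this] obtain t where t: "0 < t" "t < r"
      "h r - h 0 = r * partial j (partial i f) (x + s *\<^sub>R axis i 1 + t *\<^sub>R axis j 1)"
      by auto
    show ?thesis
    proof (rule bexI[of _ "x + s *\<^sub>R axis i 1 + t *\<^sub>R axis j 1"])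
      show "x + s *\<^sub>R axis i 1 + t *\<^sub>R axis j 1 \<in> ball x d" using in_ball s t by auto
    qed (use s(3) t(3) in \<open>simp add: g_def h_def algebra_simps\<close>)
  qed
  have cont: "continuous (at x) (partial j (partial i f))" for i j
    using C Ck_on_at[of 0 U "partial j (partial i f)" x] U x
    by (auto simp: numeral_2_eq_2 intro!: differentiable_imp_continuous_within)
  show ?thesis
  proof (rule ccontr)
    assume ne: "partial i (partial j f) x \<noteq> partial j (partial i f) x"
    define \<epsilon> where "\<epsilon> = \<bar>partial i (partial j f) x - partial j (partial i f) x\<bar> / 2"
    have "\<epsilon> > 0" using ne by (simp add: \<epsilon>_def)
    obtain d1 where d1: "d1 > 0" "\<And>z. dist z x < d1 \<Longrightarrow> dist (partial i (partial j f) z) (partial i (partial j f) x) < \<epsilon>"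
      using cont[of i j] \<open>\<epsilon> > 0\<close> unfolding continuous_at_eps_delta dist_norm by blast
    obtain d2 where d2: "d2 > 0" "\<And>z. dist z x < d2 \<Longrightarrow> dist (partial j (partial i f) z) (partial j (partial i f) x) < \<epsilon>"
      using cont[of j i] \<open>\<epsilon> > 0\<close> unfolding continuous_at_eps_delta dist_norm by blast
    obtain d3 where d3: "d3 > 0" "ball x d3 \<subseteq> U" using U x openE by blast
    define d where "d = min d1 (min d2 d3)"
    \<comment> \<open>Points of the square are at most 2 r from x, so this side keeps the square
      inside the ball of radius d.\<close>
    define r where "r = d / 4"
    have dr: "ball x d \<subseteq> U" "r > 0" "2 * r < d" using d1 d2 d3 by (auto simp: d_def r_def)
    obtain z where z: "z \<in> ball x d" "(f (x + r *\<^sub>R axis i 1 + r *\<^sub>R axis j 1) - f (x + r *\<^sub>R axis i 1)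
      - (f (x + r *\<^sub>R axis j 1) - f x)) = r * r * partial j (partial i f) z"
      using key[OF dr, of i j] by blast
    obtain w where w: "w \<in> ball x d" "(f (x + r *\<^sub>R axis j 1 + r *\<^sub>R axis i 1) - f (x + r *\<^sub>R axis j 1)
      - (f (x + r *\<^sub>R axis i 1) - f x)) = r * r * partial i (partial j f) w"
      using key[OF dr, of j i] by blast
    have "r * r * partial i (partial j f) w = r * r * partial j (partial i f) z"
      using z(2) w(2) by (simp only: add.assoc add.commute[of "r *\<^sub>R axis j 1"])
    then have eq: "partial i (partial j f) w = partial j (partial i f) z"
      using dr(2) by (simp only: mult_cancel_left mult_eq_0_iff) auto
    have lt: "dist (partial i (partial j f) w) (partial i (partial j f) x) < \<epsilon>"
      "dist (partial j (partial i f) z) (partial j (partial i f) x) < \<epsilon>"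
      using d1(2)[of w] d2(2)[of z] z(1) w(1) by (auto simp: d_def dist_commute)
    have "dist (partial i (partial j f) x) (partial j (partial i f) x) < 2 * \<epsilon>"
      by (rule dist_triangle_half_r[of "partial i (partial j f) w"])
        (use lt(1) lt(2)[folded eq] in simp_all)
    then show False by (simp add: \<epsilon>_def dist_real_def)
  qed
qed

text \<open>The mean value argument is for real values, so it is applied to each component along a
  basis vector.\<close>

lemma partial_symmetric:
  fixes f :: "real^'d \<Rightarrow> 'b::euclidean_space"
  assumes U: "open U" and x: "x \<in> U" and C: "smooth_on U f"
  shows "partial i (partial j f) x = partial j (partial i f) x"
proof (rule euclidean_eqI)
  fix b :: 'b
  have lin: "bounded_linear (\<lambda>y::'b. y \<bullet> b)" by (rule bounded_linear_inner_left)
  have comp: "partial i (partial j f) x \<bullet> b = partial i (partial j (\<lambda>x. f x \<bullet> b)) x" for i j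
  proof -
    have "partial i (partial j (\<lambda>x. f x \<bullet> b)) x = partial i (\<lambda>x. partial j f x \<bullet> b) x"
      by (rule partial_cong[OF U x]) (use partial_bounded_linear[OF lin] smooth_on_at[OF C U] in blast)
    also have "\<dots> = partial i (partial j f) x \<bullet> b"
      using partial_bounded_linear[OF lin] smooth_on_at[OF smooth_on_partial[OF C] U x] by blast
    finally show ?thesis by simp
  qed
  have "Ck_on 2 U (\<lambda>x. f x \<bullet> b)"
    using C smooth_on_iff_Ck by (blast intro: Ck_on_bounded_linear[OF U lin])
  from partial_symmetric_real[OF U x this, of i j]
  show "partial i (partial j f) x \<bullet> b = partial j (partial i f) x \<bullet> b"
    unfolding comp .
qed

section \<open>Curvilinear coordinates\<close>

lemma smooth_on_sum: "open U \<Longrightarrow> (\<And>a. a \<in> A \<Longrightarrow> smooth_on U (f a)) \<Longrightarrow> smooth_on U (\<lambda>x. \<Sum>a\<in>A. f a x)"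
  unfolding smooth_on_iff_Ck by (auto intro: Ck_on_sum)

lemma smooth_on_scaleR:
  "open U \<Longrightarrow> smooth_on U f \<Longrightarrow> smooth_on U g \<Longrightarrow> smooth_on U (\<lambda>x. f x *\<^sub>R g x)"
  unfolding smooth_on_iff_Ck by (auto intro: Ck_on_scaleR)

lemma smooth_on_inner:
  "open U \<Longrightarrow> smooth_on U f \<Longrightarrow> smooth_on U g \<Longrightarrow> smooth_on U (\<lambda>x. f x \<bullet> g x)"
  unfolding smooth_on_iff_Ck by (auto intro: Ck_on_inner)

lemma smooth_on_mult:
  fixes f g :: "real^'d \<Rightarrow> real"
  shows "open U \<Longrightarrow> smooth_on U f \<Longrightarrow> smooth_on U g \<Longrightarrow> smooth_on U (\<lambda>x. f x * g x)"
  unfolding smooth_on_iff_Ck by (auto intro: Ck_on_mult)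

lemma smooth_on_add: "open U \<Longrightarrow> smooth_on U f \<Longrightarrow> smooth_on U g \<Longrightarrow> smooth_on U (\<lambda>x. f x + g x)"
  unfolding smooth_on_iff_Ck by (auto intro: Ck_on_add)

lemma smooth_on_const: "open U \<Longrightarrow> smooth_on U (\<lambda>x. c)"
  unfolding smooth_on_iff_Ck by (auto intro: Ck_on_const)

lemma smooth_on_bounded_linear: "open U \<Longrightarrow> bounded_linear h \<Longrightarrow> smooth_on U f \<Longrightarrow> smooth_on U (\<lambda>x. h (f x))"
  unfolding smooth_on_iff_Ck by (auto intro: Ck_on_bounded_linear)

lemma smooth_on_linear: "open U \<Longrightarrow> bounded_linear h \<Longrightarrow> smooth_on U h"
  unfolding smooth_on_iff_Ck by (auto intro: Ck_on_linear)

lemma smooth_on_compose: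
  fixes g :: "real^'d \<Rightarrow> real^'n"
  shows "open U \<Longrightarrow> open V \<Longrightarrow> g ` U \<subseteq> V \<Longrightarrow> smooth_on V f \<Longrightarrow> smooth_on U g \<Longrightarrow> smooth_on U (\<lambda>x. f (g x))"
  unfolding smooth_on_iff_Ck by (auto intro: Ck_on_compose)

lemma smooth_on_powr:
  fixes f :: "real^'d \<Rightarrow> real"
  shows "open U \<Longrightarrow> (\<And>x. x \<in> U \<Longrightarrow> f x > 0) \<Longrightarrow> smooth_on U f \<Longrightarrow> smooth_on U (\<lambda>x. f x powr a)"
  unfolding smooth_on_iff_Ck by (auto intro: Ck_on_powr)

lemma smooth_on_det:
  fixes M :: "real^'d \<Rightarrow> real^'m^'m"
  shows "open U \<Longrightarrow> (\<And>i j. smooth_on U (\<lambda>x. M x $ i $ j)) \<Longrightarrow> smooth_on U (\<lambda>x. det (M x))"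
  unfolding smooth_on_iff_Ck by (auto intro: Ck_on_det)

lemma smooth_on_metric:
  "open U \<Longrightarrow> smooth_on U Y \<Longrightarrow> smooth_on U (\<lambda>u. induced_metric Y u $ i $ j)"
  by (simp add: induced_metric_def smooth_on_inner smooth_on_partial)

lemma smooth_on_metric_det: "open U \<Longrightarrow> smooth_on U Y \<Longrightarrow> smooth_on U (metric_det Y)"
  unfolding metric_det_def[abs_def] by (intro smooth_on_det smooth_on_metric)

section \<open>Reciprocal frames and smooth inverses of coordinate maps\<close>

lemma sum_swap3:
  "(\<Sum>a\<in>A. \<Sum>b\<in>B. \<Sum>c\<in>C. f a b c) = (\<Sum>b\<in>B. \<Sum>c\<in>C. \<Sum>a\<in>A. f a b c)"
  by (rule trans[OF sum.swap sum.cong[OF refl sum.swap]])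

text \<open>The vectors (\<Sum>\<nu>. C \<mu> \<nu> v \<nu>) form the reciprocal frame when C
  inverts the Gram matrix, and their inner products with w are its components. Both sides are linear
  in w and agree on the frame vectors, hence on their span.\<close>

lemma frame_expansion:
  fixes v :: "'d::finite \<Rightarrow> 'b::euclidean_space" and C :: "real^'d^'d"
  assumes C: "C ** (\<chi> i j. v i \<bullet> v j) = mat 1" and w: "w \<in> span (range v)"
  shows "w = (\<Sum>\<mu>\<in>UNIV. \<Sum>\<nu>\<in>UNIV. (C $ \<mu> $ \<nu> * (v \<nu> \<bullet> w)) *\<^sub>R v \<mu>)"
proof -
  define B where "B w = (\<Sum>\<mu>\<in>UNIV. \<Sum>\<nu>\<in>UNIV. (C $ \<mu> $ \<nu> * (v \<nu> \<bullet> w)) *\<^sub>R v \<mu>)" for w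
  have lin: "linear B"
    unfolding B_def
    by (rule linearI)
      (simp_all add: inner_add_right distrib_left scaleR_left_distrib sum.distrib scaleR_sum_right mult.left_commute)
  have "B (v l) = v l" for l
  proof -
    have "(\<Sum>\<nu>\<in>UNIV. C $ \<mu> $ \<nu> * (v \<nu> \<bullet> v l)) = (if \<mu> = l then 1 else 0)" for \<mu>
      using arg_cong[OF C, of "\<lambda>M. M $ \<mu> $ l"] by (simp add: matrix_matrix_mult_def mat_def)
    then have "B (v l) = (\<Sum>\<mu>\<in>UNIV. (if \<mu> = l then 1 else 0) *\<^sub>R v \<mu>)"
      unfolding B_def by (simp add: scaleR_sum_left[symmetric])
    also have "\<dots> = v l"
      by (simp add: if_distrib[of "\<lambda>z. z *\<^sub>R _"] cong: if_cong)
    finally show ?thesis .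
  qed
  then have "B x = id x" if "x \<in> range v" for x using that by auto
  then have "B w = id w"
    by (rule linear_eq_on[OF lin linear_id w])
  then show ?thesis unfolding B_def by simp
qed

locale coordinate_map =
  fixes \<Omega> :: "(real^'d) set" and Y :: "real^'d \<Rightarrow> real^'n"
  assumes card_eq: "CARD('d) = CARD('n)"
    and open_dom: "open \<Omega>"
    and smooth: "smooth_on \<Omega> Y"
    and inj: "inj_on Y \<Omega>"
    and indep: "\<And>u w. u \<in> \<Omega> \<Longrightarrow> (\<Sum>\<mu>\<in>UNIV. w $ \<mu> *\<^sub>R partial \<mu> Y u) = 0 \<Longrightarrow> w = 0"
begin

lemma partials_span: 
  assumes u: "u \<in> \<Omega>" shows "w \<in> span (range (\<lambda>\<mu>. partial \<mu> Y u))"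
proof -
  define f where "f w = (\<Sum>\<mu>\<in>UNIV. w $ \<mu> *\<^sub>R partial \<mu> Y u)" for w :: "real^'d"
  have lin: "linear f" unfolding f_def
    by (rule linearI) (simp_all add: scaleR_left_distrib sum.distrib scaleR_sum_right)
  have "inj f" using indep[OF u] linear_injective_0[OF lin] unfolding f_def by blast
  have "dim (range f) = dim (UNIV :: (real^'d) set)"
    using dim_image_eq[OF lin] \<open>inj f\<close> by (metis inj_on_subset subset_UNIV)
  then have "dim (range f) = DIM(real^'n)" using card_eq by simp
  then have "span (range f) = UNIV" using dim_eq_full by blast
  then have "range f = UNIV" using linear_subspace_image[OF lin subspace_UNIV] span_eq_iff by blast
  then obtain x where "w = f x" by blast
  then show ?thesis unfolding f_def by (simp only:) (intro span_sum span_scale span_base rangeI)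
qed

text \<open>The metric is M^T M for the Jacobian M, so its determinant is the square of a nonzero
  number. The two index types differ, and a bijection between them is chosen to make M a square
  matrix.\<close>

lemma metric_det_pos:
  assumes u: "u \<in> \<Omega>" shows "metric_det Y u > 0"
proof -
  obtain b :: "'d \<Rightarrow> 'n" where b: "bij b"
    using card_eq finite_same_card_bij[of "UNIV::'d set" "UNIV::'n set"] by auto
  define M :: "real^'d^'d" where "M = (\<chi> i \<mu>. partial \<mu> Y u $ b i)"
  have "(transpose M ** M) $ \<mu> $ \<nu> = induced_metric Y u $ \<mu> $ \<nu>" for \<mu> \<nu>
  proof -
    have "(\<Sum>k\<in>UNIV. partial \<mu> Y u $ b k * partial \<nu> Y u $ b k) = partial \<mu> Y u \<bullet> partial \<nu> Y u"
      unfolding inner_vec_def inner_real_def using b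
      by (rule sum.reindex_bij_betw)
    then show ?thesis
      by (simp add: M_def transpose_def matrix_matrix_mult_def induced_metric_def)
  qed
  then have eq: "transpose M ** M = induced_metric Y u" by (simp add: vec_eq_iff)
  have "x = 0" if "M *v x = 0" for x
  proof (rule indep[OF u])
    have "(\<Sum>\<mu>\<in>UNIV. x $ \<mu> *\<^sub>R partial \<mu> Y u) $ b i = (M *v x) $ i" for i
      by (simp add: M_def matrix_vector_mult_def mult.commute)
    then have z: "(\<Sum>\<mu>\<in>UNIV. x $ \<mu> *\<^sub>R partial \<mu> Y u) $ b i = 0" for i
      by (simp only: that zero_index)
    show "(\<Sum>\<mu>\<in>UNIV. x $ \<mu> *\<^sub>R partial \<mu> Y u) = 0"
      unfolding vec_eq_iff zero_index
    proof
      fix k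
      obtain i where "k = b i" using surjD[OF bij_is_surj[OF b]] by blast
      then show "(\<Sum>\<mu>\<in>UNIV. x $ \<mu> *\<^sub>R partial \<mu> Y u) $ k = 0" using z by (simp only:)
    qed
  qed
  then have "\<exists>B. B ** M = mat 1" using matrix_left_invertible_ker by blast
  then have "det M \<noteq> 0"
    using invertible_left_inverse invertible_det_nz by blast
  then show ?thesis
    unfolding metric_det_def eq[symmetric] by (simp add: det_mul zero_less_mult_iff linorder_neq_iff disj_commute)
qed

lemma matrix_inv_metric:
  assumes "u \<in> \<Omega>"
  shows "matrix_inv (induced_metric Y u) ** induced_metric Y u = mat 1"
    "induced_metric Y u ** matrix_inv (induced_metric Y u) = mat 1"
proof -
  have "invertible (induced_metric Y u)"
    using metric_det_pos[OF assms] invertible_det_nz[of "induced_metric Y u"] unfolding metric_det_def by auto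
  from someI_ex[OF this[unfolded invertible_def]]
  show "matrix_inv (induced_metric Y u) ** induced_metric Y u = mat 1"
    "induced_metric Y u ** matrix_inv (induced_metric Y u) = mat 1"
    unfolding matrix_inv_def by auto
qed

text \<open>By Cramer's rule an entry of the inverse is a quotient of determinants whose entries are
  smooth, and the denominator is the positive metric determinant.\<close>

lemma smooth_on_matrix_inv_metric:
  "smooth_on \<Omega> (\<lambda>u. matrix_inv (induced_metric Y u) $ i $ j)"
proof -
  let ?G = "induced_metric Y"
  let ?N = "\<lambda>u. det (\<chi> k l. if l = i then axis j 1 $ k else ?G u $ k $ l)"
  have eq: "?N u * metric_det Y u powr (-1) = matrix_inv (?G u) $ i $ j" if u: "u \<in> \<Omega>" for u
  proof -
    have d: "det (?G u) \<noteq> 0" using metric_det_pos[OF u] by (simp add: metric_det_def)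
    have "?G u *v (matrix_inv (?G u) *v axis j 1) = axis j 1"
      using matrix_inv_metric(2)[OF u] by (simp add: matrix_vector_mul_assoc)
    from cramer[OF d, THEN iffD1, OF this]
    have "(matrix_inv (?G u) *v axis j 1) $ i = ?N u / det (?G u)" by simp
    moreover have "(matrix_inv (?G u) *v axis j 1) $ i = matrix_inv (?G u) $ i $ j"
      by (simp add: matrix_vector_mul_component inner_axis)
    ultimately show ?thesis
      using metric_det_pos[OF u] by (simp add: metric_det_def powr_minus divide_inverse)
  qed
  have "smooth_on \<Omega> (\<lambda>u. (\<chi> k l. if l = i then axis j 1 $ k else ?G u $ k $ l) $ k $ l)" for k l
    using smooth_on_metric[OF open_dom smooth] by (cases "l = i") (auto intro: smooth_on_const[OF open_dom])
  then have "smooth_on \<Omega> (\<lambda>u. ?N u * metric_det Y u powr (-1))"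
    by (intro smooth_on_mult open_dom smooth_on_powr smooth_on_metric_det smooth metric_det_pos smooth_on_det)
  from smooth_on_cong[OF open_dom eq this] show ?thesis .
qed

lemma continuous: "continuous_on \<Omega> Y"
  using smooth Ck_on_diff differentiable_imp_continuous_on unfolding smooth_on_iff_Ck by blast

text \<open>Invariance of domain: a continuous injection between spaces of equal dimension is open.
  This yields continuity of the inverse before anything is known about its derivative.\<close>

lemma open_image:
  assumes "open W" "W \<subseteq> \<Omega>"
  shows "open (Y ` W)"
  using assms card_eq continuous_on_subset[OF continuous] inj_on_subset[OF inj]
  by (intro invariance_of_domain_gen) auto

lemma continuous_on_inv: "continuous_on (Y ` \<Omega>) (inv_into \<Omega> Y)"
proof (rule continuous_on_inverse_open_map[OF _ refl])
  show "continuous_on \<Omega> Y" by (rule continuous)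
  show "openin (top_of_set (Y ` \<Omega>)) (Y ` W)" if "openin (top_of_set \<Omega>) W" for W
  proof -
    have W: "open W" "W \<subseteq> \<Omega>" using that openin_open_eq[OF open_dom] by auto
    have "Y ` W \<subseteq> Y ` \<Omega>" using W(2) by (rule image_mono)
    moreover have "open (Y ` W)" "open (Y ` \<Omega>)"
      using open_image[OF W] open_image[OF open_dom subset_refl] by auto
    ultimately show ?thesis by (simp add: openin_open_eq)
  qed
  show "inv_into \<Omega> Y (Y x) = x" if "x \<in> \<Omega>" for x by (rule inv_into_f_f[OF inj that])
qed

text \<open>The candidate derivative sends w to its components in the frame of partial derivatives,
  computed with the reciprocal frame. It is a left inverse of the derivative of \<open>Y\<close>,
  and together with continuity of the inverse map this suffices.\<close>

lemma has_derivative_inv: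
  assumes u: "u \<in> \<Omega>"
  shows "(inv_into \<Omega> Y has_derivative
    (\<lambda>w. \<chi> \<mu>. \<Sum>\<nu>\<in>UNIV. matrix_inv (induced_metric Y u) $ \<mu> $ \<nu> * (partial \<nu> Y u \<bullet> w))) (at (Y u))"
    (is "(_ has_derivative ?g) _")
proof (rule has_derivative_inverse_basic)
  let ?C = "matrix_inv (induced_metric Y u)"
  let ?f = "\<lambda>w. \<Sum>\<mu>\<in>UNIV. w $ \<mu> *\<^sub>R partial \<mu> Y u"
  show "(Y has_derivative ?f) (at (inv_into \<Omega> Y (Y u)))"
    using has_derivative_partial[OF smooth_on_at[OF smooth open_dom u]] inj u by simp
  show "bounded_linear ?g"
    unfolding linear_conv_bounded_linear[symmetric]
    by (rule linearI) (simp_all add: vec_eq_iff inner_add_right distrib_left sum.distrib sum_distrib_left mult.left_commute)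
  show "?g \<circ> ?f = id"
  proof
    fix w
    have "(?g (?f w)) $ \<mu> = w $ \<mu>" for \<mu>
    proof -
      have "(?g (?f w)) $ \<mu> = (\<Sum>\<nu>\<in>UNIV. \<Sum>l\<in>UNIV. w $ l * (?C $ \<mu> $ \<nu> * (partial \<nu> Y u \<bullet> partial l Y u)))"
        by (simp add: inner_sum_right sum_distrib_left algebra_simps)
      also have "\<dots> = (\<Sum>l\<in>UNIV. w $ l * (?C ** induced_metric Y u) $ \<mu> $ l)"
        by (subst sum.swap) (simp add: sum_distrib_left matrix_matrix_mult_def induced_metric_def)
      also have "\<dots> = w $ \<mu>"
        by (simp add: matrix_inv_metric(1)[OF u] mat_def if_distrib cong: if_cong)
      finally show ?thesis .
    qed
    then show "(?g \<circ> ?f) w = id w" by (simp add: vec_eq_iff)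
  qed
  show "open (Y ` \<Omega>)" by (rule open_image[OF open_dom subset_refl])
  then show "continuous (at (Y u)) (inv_into \<Omega> Y)"
    using continuous_on_inv u continuous_on_eq_continuous_at by blast
qed (use u in \<open>auto intro: f_inv_into_f\<close>)

text \<open>Bootstrapping: the partial derivatives of the inverse are smooth functions of the
  coordinates, evaluated at the inverse itself. So each order of differentiability of the inverse
  yields the next.\<close>

lemma smooth_on_inv: "smooth_on (Y ` \<Omega>) (inv_into \<Omega> Y)"
  unfolding smooth_on_iff_Ck
proof
  let ?Z = "inv_into \<Omega> Y"
  let ?h = "\<lambda>i u. \<chi> \<mu>. \<Sum>\<nu>\<in>UNIV. matrix_inv (induced_metric Y u) $ \<mu> $ \<nu> * (partial \<nu> Y u $ i)"
  have op: "open (Y ` \<Omega>)" by (rule open_image[OF open_dom subset_refl])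
  have diff: "?Z differentiable_on Y ` \<Omega>"
    using has_derivative_inv op differentiable_on_eq_differentiable_at[OF op] by (auto simp: differentiable_def)
  have p: "partial i ?Z y = ?h i (?Z y)" if "y \<in> Y ` \<Omega>" for i y
    using that inj by (auto simp: partial_eqI[OF has_derivative_inv] inner_axis)
  fix n show "Ck_on n (Y ` \<Omega>) ?Z"
  proof (induction n)
    case (Suc n)
    have "Ck_on n \<Omega> (?h i)" for i
      using smooth_on_matrix_inv_metric smooth_on_bounded_linear[OF open_dom bounded_linear_vec_nth smooth_on_partial[OF smooth]]
      by (intro Ck_on_vec) (auto simp: smooth_on_iff_Ck open_dom intro!: Ck_on_sum Ck_on_mult)
    moreover have "?Z ` Y ` \<Omega> \<subseteq> \<Omega>" using inj by simp
    ultimately have "Ck_on n (Y ` \<Omega>) (\<lambda>y. ?h i (?Z y))" for i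
      using Ck_on_compose[OF op open_dom _ _ Suc] by blast
    then show ?case by (rule Ck_on_SucI[OF op diff _ p])
  qed (use diff in simp)
qed

section \<open>The Laplacian in curvilinear coordinates\<close>

lemma partial_partial_compose:
  assumes F: "smooth_on (Y ` \<Omega>) F" and u: "u \<in> \<Omega>"
  shows "partial \<nu> (partial \<mu> (\<lambda>u. F (Y u))) u =
    (\<Sum>j\<in>UNIV. partial \<nu> (partial \<mu> Y) u $ j *\<^sub>R partial j F (Y u)) +
    (\<Sum>j\<in>UNIV. \<Sum>i\<in>UNIV. (partial \<mu> Y u $ j * partial \<nu> Y u $ i) *\<^sub>R partial i (partial j F) (Y u))"
proof -
  have op: "open (Y ` \<Omega>)" by (rule open_image[OF open_dom subset_refl])
  note dY = smooth_on_at[OF smooth open_dom]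
  have dF: "partial j F differentiable at (Y u)" if "u \<in> \<Omega>" for j u
    using smooth_on_at[OF smooth_on_partial[OF F] op] that by blast
  have sc: "smooth_on \<Omega> (\<lambda>u. partial \<mu> Y u $ j)" for j
    by (rule smooth_on_bounded_linear[OF open_dom bounded_linear_vec_nth smooth_on_partial[OF smooth]])
  have sF: "smooth_on \<Omega> (\<lambda>u. partial j F (Y u))" for j
    by (rule smooth_on_compose[OF open_dom op subset_refl smooth_on_partial[OF F] smooth])
  have "partial \<nu> (partial \<mu> (\<lambda>u. F (Y u))) u
      = partial \<nu> (\<lambda>u. \<Sum>j\<in>UNIV. partial \<mu> Y u $ j *\<^sub>R partial j F (Y u)) u"
    using smooth_on_at[OF F op] dY
    by (intro partial_cong[OF open_dom u] partial_compose) auto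
  also have "\<dots> = (\<Sum>j\<in>UNIV. partial \<nu> (\<lambda>u. partial \<mu> Y u $ j *\<^sub>R partial j F (Y u)) u)"
  proof -
    have d: "((\<lambda>u. partial \<mu> Y u $ j *\<^sub>R partial j F (Y u)) has_derivative
        frechet_derivative (\<lambda>u. partial \<mu> Y u $ j *\<^sub>R partial j F (Y u)) (at u)) (at u)" for j
      using smooth_on_at[OF smooth_on_scaleR[OF open_dom sc sF] open_dom u] frechet_derivative_works by blast
    have "((\<lambda>u. \<Sum>j\<in>UNIV. partial \<mu> Y u $ j *\<^sub>R partial j F (Y u)) has_derivative
      (\<lambda>v. \<Sum>j\<in>UNIV. frechet_derivative (\<lambda>u. partial \<mu> Y u $ j *\<^sub>R partial j F (Y u)) (at u) v)) (at u)"
      by (intro has_derivative_sum d)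
    from partial_eqI[OF this] show ?thesis by (simp add: partial_def)
  qed
  also have "\<dots> = (\<Sum>j\<in>UNIV. partial \<mu> Y u $ j *\<^sub>R (\<Sum>i\<in>UNIV. partial \<nu> Y u $ i *\<^sub>R partial i (partial j F) (Y u))
      + partial \<nu> (partial \<mu> Y) u $ j *\<^sub>R partial j F (Y u))"
    using partial_bounded_bilinear[OF bounded_bilinear_scaleR smooth_on_at[OF sc open_dom u] smooth_on_at[OF sF open_dom u]]
      partial_compose[OF dF[OF u] dY[OF u]]
      partial_bounded_linear[OF bounded_linear_vec_nth smooth_on_at[OF smooth_on_partial[OF smooth] open_dom u]]
    by simp
  finally show ?thesis
    by (simp add: sum.distrib scaleR_sum_right add.commute)
qed

text \<open>Contracting the second-order chain rule with the inverse metric turns the second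
  derivatives of F into the Laplacian and leaves the derivative of F along the contracted second
  derivatives of \<open>Y\<close>. The vector \<open>b\<close> expresses the latter in the
  coordinate frame; its entries are contracted Christoffel symbols.\<close>

lemma laplacian_coordinates:
  fixes C :: "real^'d^'d"
  assumes F: "smooth_on (Y ` \<Omega>) F" and u: "u \<in> \<Omega>"
    and C: "C ** induced_metric Y u = mat 1"
    and b: "(\<Sum>\<mu>\<in>UNIV. \<Sum>\<nu>\<in>UNIV. C $ \<mu> $ \<nu> *\<^sub>R partial \<nu> (partial \<mu> Y) u) = (\<Sum>\<mu>\<in>UNIV. b $ \<mu> *\<^sub>R partial \<mu> Y u)"
  shows "euclidean_laplacian F (Y u) =
    (\<Sum>\<mu>\<in>UNIV. \<Sum>\<nu>\<in>UNIV. C $ \<mu> $ \<nu> *\<^sub>R partial \<nu> (partial \<mu> (\<lambda>u. F (Y u))) u)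
    - (\<Sum>\<mu>\<in>UNIV. b $ \<mu> *\<^sub>R partial \<mu> (\<lambda>u. F (Y u)) u)"
proof -
  have op: "open (Y ` \<Omega>)" by (rule open_image[OF open_dom subset_refl])
  \<comment> \<open>Completeness of the frame: component j of the expansion of the i-th unit
    vector.\<close>
  have id: "(\<Sum>\<mu>\<in>UNIV. \<Sum>\<nu>\<in>UNIV. C $ \<mu> $ \<nu> * (partial \<mu> Y u $ j * partial \<nu> Y u $ i)) = (if i = j then 1 else 0)" for i j
  proof -
    have "axis i 1 = (\<Sum>\<mu>\<in>UNIV. \<Sum>\<nu>\<in>UNIV. (C $ \<mu> $ \<nu> * (partial \<nu> Y u \<bullet> axis i 1)) *\<^sub>R partial \<mu> Y u)"
      by (rule frame_expansion[OF C[unfolded induced_metric_def] partials_span[OF u]])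
    from arg_cong[OF this, of "\<lambda>w. w $ j"]
    have "axis i (1::real) $ j = (\<Sum>\<mu>\<in>UNIV. \<Sum>\<nu>\<in>UNIV. C $ \<mu> $ \<nu> * (partial \<mu> Y u $ j * partial \<nu> Y u $ i))"
      by (simp add: inner_axis sum_component algebra_simps)
    then show ?thesis by (simp add: axis_def eq_commute[of i j])
  qed
  let ?p = "\<lambda>\<mu>. partial \<mu> Y u" and ?F2 = "\<lambda>i j. partial i (partial j F) (Y u)"
  have "(\<Sum>\<mu>\<in>UNIV. \<Sum>\<nu>\<in>UNIV. C $ \<mu> $ \<nu> *\<^sub>R (\<Sum>j\<in>UNIV. \<Sum>i\<in>UNIV. (?p \<mu> $ j * ?p \<nu> $ i) *\<^sub>R ?F2 i j))
     = (\<Sum>\<mu>\<in>UNIV. \<Sum>\<nu>\<in>UNIV. \<Sum>j\<in>UNIV. \<Sum>i\<in>UNIV. (C $ \<mu> $ \<nu> * (?p \<mu> $ j * ?p \<nu> $ i)) *\<^sub>R ?F2 i j)"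
    by (simp add: scaleR_sum_right)
  also have "\<dots> = (\<Sum>j\<in>UNIV. \<Sum>i\<in>UNIV. \<Sum>\<mu>\<in>UNIV. \<Sum>\<nu>\<in>UNIV. (C $ \<mu> $ \<nu> * (?p \<mu> $ j * ?p \<nu> $ i)) *\<^sub>R ?F2 i j)"
    by (rule trans[OF sum.cong[OF refl sum_swap3] sum_swap3])
  also have "\<dots> = (\<Sum>j\<in>UNIV. \<Sum>i\<in>UNIV. (if i = j then 1 else 0) *\<^sub>R ?F2 i j)"
    by (simp add: id scaleR_sum_left[symmetric])
  also have "\<dots> = euclidean_laplacian F (Y u)"
    by (simp add: euclidean_laplacian_def if_distrib[of "\<lambda>z. z *\<^sub>R _"] cong: if_cong)
  finally have lap: "(\<Sum>\<mu>\<in>UNIV. \<Sum>\<nu>\<in>UNIV. C $ \<mu> $ \<nu> *\<^sub>R (\<Sum>j\<in>UNIV. \<Sum>i\<in>UNIV. (?p \<mu> $ j * ?p \<nu> $ i) *\<^sub>R ?F2 i j))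
    = euclidean_laplacian F (Y u)" .
  define L where "L w = (\<Sum>j\<in>UNIV. w $ j *\<^sub>R partial j F (Y u))" for w
  have lin: "linear L"
    unfolding L_def by (rule linearI) (simp_all add: scaleR_left_distrib sum.distrib scaleR_sum_right)
  have "(\<Sum>\<mu>\<in>UNIV. \<Sum>\<nu>\<in>UNIV. C $ \<mu> $ \<nu> *\<^sub>R L (partial \<nu> (partial \<mu> Y) u))
     = L (\<Sum>\<mu>\<in>UNIV. \<Sum>\<nu>\<in>UNIV. C $ \<mu> $ \<nu> *\<^sub>R partial \<nu> (partial \<mu> Y) u)"
    by (simp add: linear_sum[OF lin] linear_scale[OF lin])
  also have "\<dots> = (\<Sum>\<mu>\<in>UNIV. b $ \<mu> *\<^sub>R L (?p \<mu>))"
    unfolding b by (simp add: linear_sum[OF lin] linear_scale[OF lin])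
  also have "\<dots> = (\<Sum>\<mu>\<in>UNIV. b $ \<mu> *\<^sub>R partial \<mu> (\<lambda>u. F (Y u)) u)"
    unfolding L_def using u
    by (simp add: partial_compose smooth_on_at[OF F op] smooth_on_at[OF smooth open_dom])
  finally have "(\<Sum>\<mu>\<in>UNIV. \<Sum>\<nu>\<in>UNIV. C $ \<mu> $ \<nu> *\<^sub>R L (partial \<nu> (partial \<mu> Y) u)) =
    (\<Sum>\<mu>\<in>UNIV. b $ \<mu> *\<^sub>R partial \<mu> (\<lambda>u. F (Y u)) u)" .
  with lap show ?thesis
    by (simp add: partial_partial_compose[OF F u] L_def scaleR_right_distrib sum.distrib)
qed

end

section \<open>The anti-self-adjoint connection\<close>

lemma partial_scaleR:
  assumes "f differentiable at x" "h differentiable at x"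
  shows "partial i (\<lambda>x. f x *\<^sub>R h x) x = f x *\<^sub>R partial i h x + partial i f x *\<^sub>R h x"
  using partial_bounded_bilinear[OF bounded_bilinear_scaleR assms] .

context
  fixes \<Omega> :: "(real^'d) set" and g :: "real^'d \<Rightarrow> real"
  assumes op: "open \<Omega>" and sg: "smooth_on \<Omega> g" and pos: "\<And>u. u \<in> \<Omega> \<Longrightarrow> g u > 0"
begin

lemma sa_connection_cong:
  assumes "u \<in> \<Omega>" "\<And>v. v \<in> \<Omega> \<Longrightarrow> \<phi> v = \<psi> v"
  shows "sa_connection g \<mu> \<phi> u = sa_connection g \<mu> \<psi> u"
  unfolding sa_connection_def
  using partial_cong[OF op assms(1), of "\<lambda>v. (g v powr (1/4)) *\<^sub>R \<phi> v" "\<lambda>v. (g v powr (1/4)) *\<^sub>R \<psi> v"] assms(2)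
  by simp

text \<open>The factors g^(1/4) and g^(-1/4) cancel, so on functions written as g^(-1/4) \<psi> the
  connection is the plain derivative of \<psi>. Iterates, commutation and the action on lifted
  functions all reduce to this.\<close>

lemma sa_connection_conjugate:
  assumes "u \<in> \<Omega>" "\<And>v. v \<in> \<Omega> \<Longrightarrow> \<phi> v = (g v powr (-1/4)) *\<^sub>R \<psi> v"
  shows "sa_connection g \<mu> \<phi> u = (g u powr (-1/4)) *\<^sub>R partial \<mu> \<psi> u"
proof -
  have "(g v powr (1/4)) *\<^sub>R \<phi> v = \<psi> v" if "v \<in> \<Omega>" for v
    using pos[OF that] assms(2)[OF that] powr_add[of "g v" "1/4" "-1/4"] by simp
  then have "partial \<mu> (\<lambda>v. (g v powr (1/4)) *\<^sub>R \<phi> v) u = partial \<mu> \<psi> u"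
    by (rule partial_cong[OF op assms(1)])
  then show ?thesis unfolding sa_connection_def by (rule arg_cong)
qed

lemma smooth_on_sa_connection:
  assumes "smooth_on \<Omega> \<phi>"
  shows "smooth_on \<Omega> (sa_connection g \<mu> \<phi>)"
  unfolding sa_connection_def[abs_def]
  by (intro smooth_on_scaleR smooth_on_powr smooth_on_partial op pos sg assms)

lemma sa_connection_zero:
  assumes "u \<in> \<Omega>" "\<And>v. v \<in> \<Omega> \<Longrightarrow> \<phi> v = 0"
  shows "sa_connection g \<mu> \<phi> u = 0"
proof -
  have "partial \<mu> (\<lambda>_. 0 :: complex) u = 0" by (rule partial_eqI) auto
  then show ?thesis using sa_connection_conjugate[OF assms(1), of \<phi> "\<lambda>_. 0"] assms(2) by simp
qed

lemma sa_connection_twice: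
  assumes u: "u \<in> \<Omega>"
  shows "sa_connection g \<nu> (sa_connection g \<mu> \<phi>) u =
    (g u powr (-1/4)) *\<^sub>R partial \<nu> (partial \<mu> (\<lambda>v. (g v powr (1/4)) *\<^sub>R \<phi> v)) u"
  by (rule sa_connection_conjugate[OF u]) (simp add: sa_connection_def)

lemma sa_connection_commute:
  assumes "smooth_on \<Omega> \<phi>" "u \<in> \<Omega>"
  shows "sa_connection g \<nu> (sa_connection g \<mu> \<phi>) u = sa_connection g \<mu> (sa_connection g \<nu> \<phi>) u"
proof -
  have "smooth_on \<Omega> (\<lambda>v. (g v powr (1/4)) *\<^sub>R \<phi> v)"
    by (intro smooth_on_scaleR smooth_on_powr op pos sg assms)
  from partial_symmetric[OF op assms(2) this] show ?thesis
    by (simp add: sa_connection_twice[OF assms(2)])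
qed

text \<open>Write \<phi> = \<sigma> \<psi> with \<psi> = \<rho> \<phi>. The Leibniz rule for
  \<sigma> \<psi> gives derivatives of \<psi>, and \<sigma> times such a derivative is the
  connection applied to \<phi>. Replacing coordinate derivatives by the connection thus costs only
  terms of lower order, which keeps the standard form of order two.\<close>

lemma partial_via_sa_connection:
  fixes \<phi> :: "real^'d \<Rightarrow> complex"
  defines "\<sigma> \<equiv> \<lambda>v. g v powr (-1/4)" and "\<rho> \<equiv> \<lambda>v. g v powr (1/4)"
  assumes \<phi>: "smooth_on \<Omega> \<phi>" and u: "u \<in> \<Omega>"
  shows "partial \<mu> \<phi> u = (\<rho> u * partial \<mu> \<sigma> u) *\<^sub>R \<phi> u + sa_connection g \<mu> \<phi> u"
    and "partial \<nu> (partial \<mu> \<phi>) u = (\<rho> u * partial \<nu> (partial \<mu> \<sigma>) u) *\<^sub>R \<phi> u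
      + (\<rho> u * partial \<mu> \<sigma> u) *\<^sub>R sa_connection g \<nu> \<phi> u + (\<rho> u * partial \<nu> \<sigma> u) *\<^sub>R sa_connection g \<mu> \<phi> u
      + sa_connection g \<nu> (sa_connection g \<mu> \<phi>) u"
proof -
  define \<psi> where "\<psi> v = \<rho> v *\<^sub>R \<phi> v" for v
  have s\<sigma>: "smooth_on \<Omega> \<sigma>" unfolding \<sigma>_def by (intro smooth_on_powr op pos sg)
  have s\<rho>: "smooth_on \<Omega> \<rho>" unfolding \<rho>_def by (intro smooth_on_powr op pos sg)
  have s\<psi>: "smooth_on \<Omega> \<psi>" unfolding \<psi>_def by (intro smooth_on_scaleR op s\<rho> \<phi>)
  have \<rho>\<sigma>: "\<rho> v * \<sigma> v = 1" if "v \<in> \<Omega>" for v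
    using pos[OF that] powr_add[of "g v" "1/4" "-1/4"] by (simp add: \<rho>_def \<sigma>_def)
  have \<phi>\<psi>: "\<phi> v = \<sigma> v *\<^sub>R \<psi> v" if "v \<in> \<Omega>" for v
    using \<rho>\<sigma>[OF that] by (simp add: \<psi>_def mult.commute)
  have D: "sa_connection g \<mu> \<phi> u = \<sigma> u *\<^sub>R partial \<mu> \<psi> u" for \<mu>
    by (simp add: sa_connection_def \<sigma>_def \<psi>_def[abs_def] \<rho>_def)
  have DD: "sa_connection g \<nu> (sa_connection g \<mu> \<phi>) u = \<sigma> u *\<^sub>R partial \<nu> (partial \<mu> \<psi>) u"
    by (simp add: sa_connection_twice[OF u] \<sigma>_def \<psi>_def[abs_def] \<rho>_def)
  have p: "partial \<mu> \<phi> v = \<sigma> v *\<^sub>R partial \<mu> \<psi> v + partial \<mu> \<sigma> v *\<^sub>R \<psi> v" if "v \<in> \<Omega>" for v \<mu>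
    using partial_cong[OF op that, of \<phi> "\<lambda>v. \<sigma> v *\<^sub>R \<psi> v"] \<phi>\<psi>
      partial_scaleR[OF smooth_on_at[OF s\<sigma> op that] smooth_on_at[OF s\<psi> op that]] by metis
  have unconj: "partial \<mu> \<psi> u = \<rho> u *\<^sub>R sa_connection g \<mu> \<phi> u" for \<mu>
    by (simp add: D \<rho>\<sigma>[OF u])
  show "partial \<mu> \<phi> u = (\<rho> u * partial \<mu> \<sigma> u) *\<^sub>R \<phi> u + sa_connection g \<mu> \<phi> u"
    using p[OF u] by (simp add: D \<psi>_def mult.commute)
  have "partial \<nu> (partial \<mu> \<phi>) u = partial \<nu> (\<lambda>v. \<sigma> v *\<^sub>R partial \<mu> \<psi> v + partial \<mu> \<sigma> v *\<^sub>R \<psi> v) u"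
    by (rule partial_cong[OF op u p])
  also have "\<dots> = (\<sigma> u *\<^sub>R partial \<nu> (partial \<mu> \<psi>) u + partial \<nu> \<sigma> u *\<^sub>R partial \<mu> \<psi> u)
      + (partial \<mu> \<sigma> u *\<^sub>R partial \<nu> \<psi> u + partial \<nu> (partial \<mu> \<sigma>) u *\<^sub>R \<psi> u)"
    unfolding partial_add[OF smooth_on_at[OF smooth_on_scaleR[OF op s\<sigma> smooth_on_partial[OF s\<psi>]] op u]
        smooth_on_at[OF smooth_on_scaleR[OF op smooth_on_partial[OF s\<sigma>] s\<psi>] op u]]
      partial_scaleR[OF smooth_on_at[OF s\<sigma> op u] smooth_on_at[OF smooth_on_partial[OF s\<psi>] op u]]
      partial_scaleR[OF smooth_on_at[OF smooth_on_partial[OF s\<sigma>] op u] smooth_on_at[OF s\<psi> op u]] ..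
  also have "\<dots> = (\<rho> u * partial \<nu> (partial \<mu> \<sigma>) u) *\<^sub>R \<phi> u
      + (\<rho> u * partial \<mu> \<sigma> u) *\<^sub>R sa_connection g \<nu> \<phi> u + (\<rho> u * partial \<nu> \<sigma> u) *\<^sub>R sa_connection g \<mu> \<phi> u
      + sa_connection g \<nu> (sa_connection g \<mu> \<phi>) u"
    unfolding DD unconj by (simp add: \<psi>_def mult.commute)
  finally show "partial \<nu> (partial \<mu> \<phi>) u = (\<rho> u * partial \<nu> (partial \<mu> \<sigma>) u) *\<^sub>R \<phi> u
      + (\<rho> u * partial \<mu> \<sigma> u) *\<^sub>R sa_connection g \<nu> \<phi> u + (\<rho> u * partial \<nu> \<sigma> u) *\<^sub>R sa_connection g \<mu> \<phi> u
      + sa_connection g \<nu> (sa_connection g \<mu> \<phi>) u" .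
qed

end

section \<open>Existence of the standard form\<close>

definition unit_index :: "'d \<Rightarrow> 'd \<Rightarrow> nat"
  where "unit_index \<mu> x = (if x = \<mu> then 1 else 0)"

lemma foldr_index_zero:
  "(\<And>x. x \<in> set xs \<Longrightarrow> m x = 0) \<Longrightarrow> foldr (\<lambda>x. D x ^^ m x) xs \<phi> = \<phi>"
  by (induction xs) auto

lemma foldr_index_one:
  assumes "distinct xs"
  shows "foldr (\<lambda>x. D x ^^ unit_index \<mu> x) xs \<phi> = (if \<mu> \<in> set xs then D \<mu> \<phi> else \<phi>)"
  using assms by (induction xs) (auto simp: unit_index_def)

text \<open>Which of the two operators acts first depends on the enumeration of the index type,
  which is an unspecified choice. The result is left open between both orders and settled later by
  commutation.\<close>

lemma foldr_index_two:
  assumes "distinct xs" "\<mu> \<in> set xs" "\<nu> \<in> set xs"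
  shows "foldr (\<lambda>x. D x ^^ (unit_index \<mu> x + unit_index \<nu> x)) xs \<phi> \<in> {D \<mu> (D \<nu> \<phi>), D \<nu> (D \<mu> \<phi>)}"
  using assms
proof (induction xs)
  case (Cons y xs)
  let ?f = "\<lambda>x. D x ^^ (unit_index \<mu> x + unit_index \<nu> x)"
  have one: "foldr ?f xs \<phi> = foldr (\<lambda>x. D x ^^ unit_index \<nu> x) xs \<phi>" if "\<mu> \<notin> set xs"
    using that by (intro foldr_cong) (auto simp: unit_index_def)
  have one': "foldr ?f xs \<phi> = foldr (\<lambda>x. D x ^^ unit_index \<mu> x) xs \<phi>" if "\<nu> \<notin> set xs"
    using that by (intro foldr_cong) (auto simp: unit_index_def)
  consider "y = \<mu>" "y = \<nu>" | "y = \<mu>" "y \<noteq> \<nu>" | "y \<noteq> \<mu>" "y = \<nu>" | "y \<noteq> \<mu>" "y \<noteq> \<nu>" by blast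
  then show ?case
  proof cases
    case 1
    then have "\<mu> \<notin> set xs" "\<nu> \<notin> set xs" using Cons.prems by auto
    then have "foldr ?f xs \<phi> = \<phi>" by (intro foldr_index_zero) (auto simp: unit_index_def)
    with 1 show ?thesis by (simp add: unit_index_def numeral_2_eq_2)
  next
    case 2
    then have "\<mu> \<notin> set xs" "\<nu> \<in> set xs" using Cons.prems by auto
    then have "foldr ?f xs \<phi> = D \<nu> \<phi>" using one foldr_index_one[of xs \<nu> D] Cons.prems by simp
    with 2 show ?thesis by (simp add: unit_index_def)
  next
    case 3
    then have "\<nu> \<notin> set xs" "\<mu> \<in> set xs" using Cons.prems by auto
    then have "foldr ?f xs \<phi> = D \<mu> \<phi>" using one' foldr_index_one[of xs \<mu> D] Cons.prems by simp
    with 3 show ?thesis by (simp add: unit_index_def)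
  next
    case 4
    with Cons show ?thesis by (auto simp: unit_index_def)
  qed
qed simp

definition split_index :: "('k + 'm \<Rightarrow> nat) \<Rightarrow> ('k \<Rightarrow> nat) \<times> ('m \<Rightarrow> nat)"
  where "split_index m = (m \<circ> Inl, m \<circ> Inr)"

lemma some_enumeration:
  defines "xs \<equiv> SOME is :: 'a::finite list. distinct is \<and> set is = UNIV"
  shows "distinct xs" "set xs = UNIV"
proof -
  obtain l :: "'a list" where "set l = UNIV" "distinct l"
    using finite_distinct_list[OF finite_class.finite_UNIV] by blast
  then have "distinct l \<and> set l = UNIV" by simp
  from someI[of "\<lambda>is. distinct is \<and> set is = UNIV", OF this]
  show "distinct xs" "set xs = UNIV" unfolding xs_def by auto
qed

text \<open>Concatenating the two chosen enumerations, tangential indices first, enumerates the sum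
  type. Since \<open>foldr\<close> lets the end of the list act first, the normal operators come out
  rightmost.\<close>

lemma op_monomial_split:
  obtains xs :: "('k::finite + 'm::finite) list" where "distinct xs" "set xs = UNIV"
    "\<And>D m \<phi>. op_monomial (\<lambda>\<alpha>. D (Inl \<alpha>)) (fst (split_index m)) (op_monomial (\<lambda>i. D (Inr i)) (snd (split_index m)) \<phi>)
      = foldr (\<lambda>x. D x ^^ m x) xs \<phi>"
proof -
  define ks where "ks = (SOME is :: 'k list. distinct is \<and> set is = UNIV)"
  define ms where "ms = (SOME is :: 'm list. distinct is \<and> set is = UNIV)"
  have ks: "distinct ks" "set ks = UNIV" unfolding ks_def by (rule some_enumeration)+
  have ms: "distinct ms" "set ms = UNIV" unfolding ms_def by (rule some_enumeration)+
  show ?thesis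
  proof (rule that)
  show "distinct (map Inl ks @ map Inr ms)"
    using ks ms by (auto simp: distinct_map)
  show "set (map Inl ks @ map Inr ms) = UNIV"
    using UNIV_Plus_UNIV by (simp add: ks ms Plus_def)
  show "op_monomial (\<lambda>\<alpha>. D (Inl \<alpha>)) (fst (split_index m)) (op_monomial (\<lambda>i. D (Inr i)) (snd (split_index m)) \<phi>)
      = foldr (\<lambda>x. D x ^^ m x) (map Inl ks @ map Inr ms) \<phi>" for D m \<phi>
    by (simp add: op_monomial_def split_index_def ks_def[symmetric] ms_def[symmetric] foldr_map o_def)
  qed
qed

text \<open>\<open>submanifold_schroedinger\<close> picks its coefficients by a choice operator, so
  nothing can be said about it until some standard form is exhibited. The Laplacian in tubular
  coordinates is rewritten from coordinate derivatives to the connection and its terms are sorted by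
  multi-index.\<close>

lemma standard_form_exists:
  fixes X :: "real^'k \<Rightarrow> real^'n" and e :: "'m::finite \<Rightarrow> real^'k \<Rightarrow> real^'n"
  assumes "coordinate_map (tube_domain U \<epsilon>) (tube_map X e)"
  shows "\<exists>a. standard_form U \<epsilon> X e a"
proof -
  let ?\<Omega> = "tube_domain U \<epsilon> :: (real^('k + 'm)) set" and ?Y = "tube_map X e"
  interpret coordinate_map ?\<Omega> ?Y by fact
  let ?g = "metric_det ?Y"
  let ?D = "sa_connection ?g"
  note smg = smooth_on_metric_det[OF open_dom smooth]
  define C where "C u = matrix_inv (induced_metric ?Y u)" for u
  define V where "V u = (\<Sum>\<mu>\<in>UNIV. \<Sum>\<nu>\<in>UNIV. C u $ \<mu> $ \<nu> *\<^sub>R partial \<nu> (partial \<mu> ?Y) u)" for u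
  define b where "b u = (\<chi> \<mu>. \<Sum>\<nu>\<in>UNIV. C u $ \<mu> $ \<nu> * (partial \<nu> ?Y u \<bullet> V u))" for u
  define \<sigma> where "\<sigma> v = ?g v powr (-1/4)" for v
  define \<rho> where "\<rho> v = ?g v powr (1/4)" for v
  \<comment> \<open>\<open>B\<close> and \<open>E\<close> collect the first-order and zeroth-order
    terms: those left by the Leibniz rule applied to \<phi> = \<sigma> \<psi>, and those carried by
    the contracted Christoffel symbols \<open>b\<close>.\<close>
  define B where "B \<mu> u = (\<Sum>\<nu>\<in>UNIV. (C u $ \<nu> $ \<mu> + C u $ \<mu> $ \<nu>) * (\<rho> u * partial \<nu> \<sigma> u)) - b u $ \<mu>" for \<mu> u
  define E where "E u = (\<Sum>\<mu>\<in>UNIV. \<Sum>\<nu>\<in>UNIV. C u $ \<mu> $ \<nu> * (\<rho> u * partial \<nu> (partial \<mu> \<sigma>) u))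
     - (\<Sum>\<mu>\<in>UNIV. b u $ \<mu> * (\<rho> u * partial \<mu> \<sigma> u))" for u
  have lap: "euclidean_laplacian F (?Y u) =
      (\<Sum>\<mu>\<in>UNIV. \<Sum>\<nu>\<in>UNIV. C u $ \<mu> $ \<nu> *\<^sub>R ?D \<nu> (?D \<mu> (F \<circ> ?Y)) u)
      + (\<Sum>\<mu>\<in>UNIV. B \<mu> u *\<^sub>R ?D \<mu> (F \<circ> ?Y) u) + E u *\<^sub>R (F \<circ> ?Y) u"
    if F: "smooth_on (?Y ` ?\<Omega>) F" and u: "u \<in> ?\<Omega>" for F u
  proof -
    let ?\<phi> = "F \<circ> ?Y"
    have s\<phi>: "smooth_on ?\<Omega> ?\<phi>"
      unfolding o_def by (rule smooth_on_compose[OF open_dom open_image[OF open_dom subset_refl] subset_refl F smooth])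
    have CI: "C u ** induced_metric ?Y u = mat 1"
      unfolding C_def by (rule matrix_inv_metric(1)[OF u])
    have "V u = (\<Sum>\<mu>\<in>UNIV. b u $ \<mu> *\<^sub>R partial \<mu> ?Y u)"
      using frame_expansion[OF CI[unfolded induced_metric_def] partials_span[OF u], of "V u"]
      by (simp add: b_def scaleR_sum_left)
    from laplacian_coordinates[OF F u CI this[unfolded V_def]]
    have "euclidean_laplacian F (?Y u) =
      (\<Sum>\<mu>\<in>UNIV. \<Sum>\<nu>\<in>UNIV. C u $ \<mu> $ \<nu> *\<^sub>R partial \<nu> (partial \<mu> ?\<phi>) u) - (\<Sum>\<mu>\<in>UNIV. b u $ \<mu> *\<^sub>R partial \<mu> ?\<phi> u)"
      by (simp add: o_def)
    also have "\<dots> = (\<Sum>\<mu>\<in>UNIV. \<Sum>\<nu>\<in>UNIV. C u $ \<mu> $ \<nu> *\<^sub>R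
        ((\<rho> u * partial \<nu> (partial \<mu> \<sigma>) u) *\<^sub>R ?\<phi> u
        + (\<rho> u * partial \<mu> \<sigma> u) *\<^sub>R ?D \<nu> ?\<phi> u + (\<rho> u * partial \<nu> \<sigma> u) *\<^sub>R ?D \<mu> ?\<phi> u
        + ?D \<nu> (?D \<mu> ?\<phi>) u))
      - (\<Sum>\<mu>\<in>UNIV. b u $ \<mu> *\<^sub>R ((\<rho> u * partial \<mu> \<sigma> u) *\<^sub>R ?\<phi> u + ?D \<mu> ?\<phi> u))"
      using partial_via_sa_connection[OF open_dom smg metric_det_pos s\<phi> u]
      unfolding \<sigma>_def[abs_def] \<rho>_def[abs_def] by (simp only:)
    also have "\<dots> = (\<Sum>\<mu>\<in>UNIV. \<Sum>\<nu>\<in>UNIV. C u $ \<mu> $ \<nu> *\<^sub>R ?D \<nu> (?D \<mu> ?\<phi>) u)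
      + ((\<Sum>\<mu>\<in>UNIV. \<Sum>\<nu>\<in>UNIV. (C u $ \<mu> $ \<nu> * (\<rho> u * partial \<mu> \<sigma> u)) *\<^sub>R ?D \<nu> ?\<phi> u)
      + (\<Sum>\<mu>\<in>UNIV. \<Sum>\<nu>\<in>UNIV. (C u $ \<mu> $ \<nu> * (\<rho> u * partial \<nu> \<sigma> u)) *\<^sub>R ?D \<mu> ?\<phi> u)
      - (\<Sum>\<mu>\<in>UNIV. b u $ \<mu> *\<^sub>R ?D \<mu> ?\<phi> u)) + E u *\<^sub>R ?\<phi> u"
      unfolding E_def
      by (simp add: scaleR_right_distrib sum.distrib scaleR_diff_left scaleR_sum_left)
    also have "(\<Sum>\<mu>\<in>UNIV. \<Sum>\<nu>\<in>UNIV. (C u $ \<mu> $ \<nu> * (\<rho> u * partial \<mu> \<sigma> u)) *\<^sub>R ?D \<nu> ?\<phi> u)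
      + (\<Sum>\<mu>\<in>UNIV. \<Sum>\<nu>\<in>UNIV. (C u $ \<mu> $ \<nu> * (\<rho> u * partial \<nu> \<sigma> u)) *\<^sub>R ?D \<mu> ?\<phi> u)
      - (\<Sum>\<mu>\<in>UNIV. b u $ \<mu> *\<^sub>R ?D \<mu> ?\<phi> u) = (\<Sum>\<mu>\<in>UNIV. B \<mu> u *\<^sub>R ?D \<mu> ?\<phi> u)"
      unfolding B_def
      by (subst sum.swap)
        (simp add: scaleR_left_distrib distrib_right sum.distrib scaleR_diff_left scaleR_sum_left sum_subtractf)
    finally show ?thesis .
  qed
  obtain xs :: "('k + 'm) list" where xs: "distinct xs" "set xs = UNIV"
    "\<And>D m \<phi>. op_monomial (\<lambda>\<alpha>. D (Inl \<alpha>)) (fst (split_index m)) (op_monomial (\<lambda>i. D (Inr i)) (snd (split_index m)) (\<phi> :: real^('k+'m) \<Rightarrow> complex))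
      = foldr (\<lambda>x. D x ^^ m x) xs \<phi>"
    using op_monomial_split by blast
  define i0 :: "('k \<Rightarrow> nat) \<times> ('m \<Rightarrow> nat)" where "i0 = split_index (\<lambda>_. 0)"
  define i1 :: "'k + 'm \<Rightarrow> ('k \<Rightarrow> nat) \<times> ('m \<Rightarrow> nat)" where "i1 \<mu> = split_index (unit_index \<mu>)" for \<mu>
  define i2 :: "('k + 'm) \<times> ('k + 'm) \<Rightarrow> ('k \<Rightarrow> nat) \<times> ('m \<Rightarrow> nat)"
    where "i2 = (\<lambda>(\<mu>, \<nu>). split_index (\<lambda>x. unit_index \<mu> x + unit_index \<nu> x))"
  define P where "P = insert i0 (range i1 \<union> range i2)"
  have fin: "finite P" by (simp add: P_def)
  \<comment> \<open>The pairs (\<mu>, \<nu>) and (\<nu>, \<mu>) give the same multi-index, so the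
    coefficient of a multi-index is the sum over all its preimages.\<close>
  define a where "a p u = (\<Sum>q\<in>UNIV. if p = i2 q then C u $ fst q $ snd q else 0)
      + (\<Sum>\<mu>\<in>UNIV. if p = i1 \<mu> then B \<mu> u else 0) + (if p = i0 then E u else 0)" for p u
  have supp: "{p. a p \<noteq> (\<lambda>_. 0)} \<subseteq> P"
  proof
    fix p assume p: "p \<in> {p. a p \<noteq> (\<lambda>_. 0)}"
    show "p \<in> P"
    proof (rule ccontr)
      assume "p \<notin> P"
      then have "p \<noteq> i0" "\<And>\<mu>. p \<noteq> i1 \<mu>" "\<And>q. p \<noteq> i2 q" by (auto simp: P_def)
      then have "a p = (\<lambda>_. 0)" by (simp add: a_def fun_eq_iff)
      with p show False by simp
    qed
  qed
  have "standard_form U \<epsilon> X e a"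
    unfolding standard_form_def Let_def
  proof (intro conjI allI impI ballI)
    show "finite {p. a p \<noteq> (\<lambda>_. 0)}" using supp fin finite_subset by blast
    fix F :: "real^'n \<Rightarrow> complex" and u assume F: "smooth_on (?Y ` ?\<Omega>) F" and u: "u \<in> ?\<Omega>"
    let ?\<phi> = "F \<circ> ?Y"
    define T where "T p = op_monomial (\<lambda>\<alpha>. ?D (Inl \<alpha>)) (fst p) (op_monomial (\<lambda>i. ?D (Inr i)) (snd p) ?\<phi>) u" for p
    have s\<phi>: "smooth_on ?\<Omega> ?\<phi>"
      unfolding o_def by (rule smooth_on_compose[OF open_dom open_image[OF open_dom subset_refl] subset_refl F smooth])
    have T0: "T i0 = ?\<phi> u" unfolding T_def i0_def xs(3) by (subst foldr_index_zero) simp_all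
    have T1: "T (i1 \<mu>) = ?D \<mu> ?\<phi> u" for \<mu>
      unfolding T_def i1_def xs(3) by (simp add: foldr_index_one[OF xs(1)] xs(2))
    have T2: "T (i2 q) = ?D (snd q) (?D (fst q) ?\<phi>) u" for q
    proof -
      obtain \<mu> \<nu> where q: "q = (\<mu>, \<nu>)" by fastforce
      have "?D \<mu> (?D \<nu> ?\<phi>) u = ?D \<nu> (?D \<mu> ?\<phi>) u"
        by (rule sa_connection_commute[OF open_dom smg metric_det_pos s\<phi> u])
      moreover have "foldr (\<lambda>x. ?D x ^^ (unit_index \<mu> x + unit_index \<nu> x)) xs ?\<phi>
          \<in> {?D \<mu> (?D \<nu> ?\<phi>), ?D \<nu> (?D \<mu> ?\<phi>)}"
        by (rule foldr_index_two[OF xs(1)]) (simp_all add: xs(2))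
      ultimately have "foldr (\<lambda>x. ?D x ^^ (unit_index \<mu> x + unit_index \<nu> x)) xs ?\<phi> u = ?D \<nu> (?D \<mu> ?\<phi>) u"
        by (elim insertE emptyE) (simp_all only:)
      then show ?thesis unfolding T_def i2_def q prod.case xs(3) fst_conv snd_conv .
    qed
    have pick: "(\<Sum>p\<in>P. (\<Sum>q\<in>UNIV. if p = i q then c q else 0) *\<^sub>R T p) = (\<Sum>q\<in>UNIV. c q *\<^sub>R T (i q))"
      if "range i \<subseteq> P" for i :: "'z::finite \<Rightarrow> _" and c :: "'z \<Rightarrow> real"
    proof -
      have "(\<Sum>p\<in>P. (\<Sum>q\<in>UNIV. if p = i q then c q else 0) *\<^sub>R T p)
        = (\<Sum>q\<in>UNIV. \<Sum>p\<in>P. if p = i q then c q *\<^sub>R T p else 0)"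
        unfolding scaleR_sum_left by (subst sum.swap) (intro sum.cong refl, auto)
      also have "\<dots> = (\<Sum>q\<in>UNIV. c q *\<^sub>R T (i q))"
        using fin that by (intro sum.cong refl) (auto simp: sum.delta)
      finally show ?thesis .
    qed
    have "(\<Sum>(\<beta>, \<gamma>)\<in>{p. a p \<noteq> (\<lambda>_. 0)}. a (\<beta>, \<gamma>) u *\<^sub>R
          op_monomial (\<lambda>\<alpha>. ?D (Inl \<alpha>)) \<beta> (op_monomial (\<lambda>i. ?D (Inr i)) \<gamma> ?\<phi>) u)
       = (\<Sum>p\<in>{p. a p \<noteq> (\<lambda>_. 0)}. a p u *\<^sub>R T p)"
      by (simp add: T_def case_prod_unfold)
    also have "\<dots> = (\<Sum>p\<in>P. a p u *\<^sub>R T p)"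
      by (rule sum.mono_neutral_left[OF fin supp]) auto
    also have "\<dots> = (\<Sum>q\<in>UNIV. (C u $ fst q $ snd q) *\<^sub>R T (i2 q)) + (\<Sum>\<mu>\<in>UNIV. B \<mu> u *\<^sub>R T (i1 \<mu>)) + E u *\<^sub>R T i0"
    proof -
      have "(\<Sum>p\<in>P. (if p = i0 then E u else 0) *\<^sub>R T p) = E u *\<^sub>R T i0"
        using pick[of "\<lambda>_::unit. i0" "\<lambda>_. E u"] by (simp add: P_def)
      moreover have "(\<Sum>p\<in>P. (\<Sum>q\<in>UNIV. if p = i2 q then C u $ fst q $ snd q else 0) *\<^sub>R T p)
          = (\<Sum>q\<in>UNIV. (C u $ fst q $ snd q) *\<^sub>R T (i2 q))"
        by (rule pick) (auto simp: P_def)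
      moreover have "(\<Sum>p\<in>P. (\<Sum>\<mu>\<in>UNIV. if p = i1 \<mu> then B \<mu> u else 0) *\<^sub>R T p) = (\<Sum>\<mu>\<in>UNIV. B \<mu> u *\<^sub>R T (i1 \<mu>))"
        by (rule pick) (auto simp: P_def)
      ultimately show ?thesis unfolding a_def scaleR_left_distrib sum.distrib by simp
    qed
    also have "\<dots> = euclidean_laplacian F (?Y u)"
      unfolding lap[OF F u] T0 T1 T2
      by (simp add: sum.cartesian_product UNIV_Times_UNIV case_prod_unfold)
    finally show "euclidean_laplacian F (?Y u) = (\<Sum>(\<beta>, \<gamma>)\<in>{p. a p \<noteq> (\<lambda>_. 0)}. a (\<beta>, \<gamma>) u *\<^sub>R
          op_monomial (\<lambda>\<alpha>. ?D (Inl \<alpha>)) \<beta> (op_monomial (\<lambda>i. ?D (Inr i)) \<gamma> ?\<phi>) u)" ..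
  qed
  then show ?thesis by blast
qed


section \<open>The submanifold Schroedinger operator in coordinates\<close>

lemma bounded_linear_tang_part: "bounded_linear (tang_part :: real^('k::finite + 'm::finite) \<Rightarrow> real^'k)"
  unfolding linear_conv_bounded_linear[symmetric]
  by (rule linearI) (simp_all add: tang_part_def vec_eq_iff)

lemma partial_tang_part:
  fixes h :: "real^'k \<Rightarrow> 'b::real_normed_vector" and u :: "real^('k::finite + 'm::finite)"
  assumes "h differentiable at (tang_part u)"
  shows "partial (Inl \<alpha>) (\<lambda>v. h (tang_part v)) u = partial \<alpha> h (tang_part u)"
    "partial (Inr i) (\<lambda>v. h (tang_part v)) u = 0"
proof -
  have "partial \<mu> (\<lambda>v. h (tang_part v)) u = (\<Sum>j\<in>UNIV. tang_part (axis \<mu> 1) $ j *\<^sub>R partial j h (tang_part u))"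
    for \<mu> :: "'k + 'm"
    by (rule partial_eqI[OF has_derivative_compose[OF bounded_linear_imp_has_derivative[OF bounded_linear_tang_part]
            has_derivative_partial[OF assms]]])
  then show "partial (Inl \<alpha>) (\<lambda>v. h (tang_part v)) u = partial \<alpha> h (tang_part u)"
    "partial (Inr i) (\<lambda>v. h (tang_part v)) u = 0"
    by (simp_all add: tang_part_def axis_def if_distrib[of "\<lambda>z. z *\<^sub>R _"] cong: if_cong)
qed

lemma tang_part_zero_section [simp]: "tang_part (zero_section s) = s"
  by (simp add: tang_part_def zero_section_def vec_eq_iff)

lemma norm_part_zero_section [simp]: "norm_part (zero_section s) = 0"
  by (simp add: norm_part_def zero_section_def vec_eq_iff)

text \<open>That g_T restricts to g_S is an assumption here, because it rests on the block form of
  the metric; it is discharged in \<open>tube_coordinates_tube\<close>.\<close>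

locale tube_coordinates = coordinate_map "tube_domain U \<epsilon>" "tube_map X e"
  for U :: "(real^'k) set" and \<epsilon> :: real and X :: "real^'k \<Rightarrow> real^'n"
    and e :: "'m::finite \<Rightarrow> real^'k \<Rightarrow> real^'n" +
  assumes open_U: "open U" and \<epsilon>_pos: "\<epsilon> > 0" and smooth_X: "smooth_on U X"
    and metric_det_zero_section:
      "s \<in> U \<Longrightarrow> metric_det (tube_map X e) (zero_section s :: real^('k + 'm)) = metric_det X s"
begin

abbreviation "\<Omega> \<equiv> tube_domain U \<epsilon> :: (real^('k + 'm)) set"
abbreviation "gT \<equiv> metric_det (tube_map X e)"
abbreviation "gS \<equiv> metric_det X"

text \<open>The function on the tube that restricts to \<open>f\<close> and is parallel in the normal directions.\<close>

definition lift :: "(real^'k \<Rightarrow> complex) \<Rightarrow> real^('k + 'm) \<Rightarrow> complex"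
  where "lift f u = (gT u powr (-1/4) * gS (tang_part u) powr (1/4)) *\<^sub>R f (tang_part u)"

lemma zero_section_mem: "s \<in> U \<Longrightarrow> zero_section s \<in> \<Omega>"
  using \<epsilon>_pos by (simp add: tube_domain_def)

lemma gS_pos: "s \<in> U \<Longrightarrow> gS s > 0"
  using metric_det_pos[OF zero_section_mem] metric_det_zero_section by metis

lemma smooth_gT: "smooth_on \<Omega> gT"
  by (rule smooth_on_metric_det[OF open_dom smooth])

lemma smooth_gS: "smooth_on U gS"
  by (rule smooth_on_metric_det[OF open_U smooth_X])

lemma tang_part_mem: "u \<in> \<Omega> \<Longrightarrow> tang_part u \<in> U"
  by (simp add: tube_domain_def)

lemma lift_zero_section: "s \<in> U \<Longrightarrow> lift f (zero_section s) = f s"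
  using gS_pos[of s] powr_add[of "gS s" "-1/4" "1/4"] by (simp add: lift_def metric_det_zero_section)

lemma smooth_lift:
  assumes "smooth_on U f" shows "smooth_on \<Omega> (lift f)"
proof -
  have t: "tang_part ` \<Omega> \<subseteq> U" using tang_part_mem by blast
  have st: "smooth_on \<Omega> (tang_part :: real^('k + 'm) \<Rightarrow> real^'k)"
    by (rule smooth_on_linear[OF open_dom bounded_linear_tang_part])
  have "smooth_on \<Omega> (\<lambda>u. gS (tang_part u) powr (1/4))"
    by (rule smooth_on_compose[OF open_dom open_U t _ st, of "\<lambda>s. gS s powr (1/4)"])
      (intro smooth_on_powr open_U gS_pos smooth_gS)
  moreover have "smooth_on \<Omega> (\<lambda>u. f (tang_part u))"
    by (rule smooth_on_compose[OF open_dom open_U t assms st])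
  moreover have "smooth_on \<Omega> (\<lambda>u. gT u powr (-1/4))"
    by (intro smooth_on_powr open_dom metric_det_pos smooth_gT)
  ultimately show ?thesis
    unfolding lift_def[abs_def] by (intro smooth_on_scaleR smooth_on_mult open_dom)
qed

text \<open>Up to the factor g_T^(-1/4), a lift is a function \<open>h\<close> of the base point
  alone, so conjugation leaves plain derivatives of \<open>h\<close>. The function \<xi> need only
  agree with the lift on \<Omega>, because iterates of the connection are known only there.\<close>

lemma sa_connection_lift:
  assumes f: "smooth_on U f" and \<xi>: "\<And>u. u \<in> \<Omega> \<Longrightarrow> \<xi> u = lift f u" and u: "u \<in> \<Omega>"
  shows "sa_connection gT (Inl \<alpha>) \<xi> u = lift (sa_connection gS \<alpha> f) u"
    and "sa_connection gT (Inr i) \<xi> u = 0"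
proof -
  define h where "h s = (gS s powr (1/4)) *\<^sub>R f s" for s
  have sh: "smooth_on U h" unfolding h_def
    by (intro smooth_on_scaleR smooth_on_powr open_U gS_pos smooth_gS f)
  have dh: "h differentiable at (tang_part u)"
    by (rule smooth_on_at[OF sh open_U tang_part_mem[OF u]])
  have D: "sa_connection gT \<mu> \<xi> u = (gT u powr (-1/4)) *\<^sub>R partial \<mu> (\<lambda>v. h (tang_part v)) u" for \<mu>
    by (rule sa_connection_conjugate[OF open_dom smooth_gT metric_det_pos u])
      (simp_all add: \<xi> lift_def h_def)
  show "sa_connection gT (Inr i) \<xi> u = 0"
    by (simp add: D partial_tang_part(2)[OF dh])
  have "gS (tang_part u) powr (1/4) * gS (tang_part u) powr (-1/4) = 1"
    using gS_pos[OF tang_part_mem[OF u]] powr_add[of "gS (tang_part u)" "1/4" "-1/4"] by simp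
  moreover have "sa_connection gS \<alpha> f (tang_part u) = (gS (tang_part u) powr (-1/4)) *\<^sub>R partial \<alpha> h (tang_part u)"
    by (simp add: sa_connection_def h_def[abs_def])
  ultimately show "sa_connection gT (Inl \<alpha>) \<xi> u = lift (sa_connection gS \<alpha> f) u"
    by (simp add: D partial_tang_part(1)[OF dh] lift_def mult.assoc)
qed

text \<open>The connection of the tube on a lift is the lift of the connection of S, so it can be
  iterated. Smoothness of the function on U is carried along in the inductions, since the next
  application requires it.\<close>

lemma op_monomial_lift:
  assumes f: "smooth_on U f"
  shows "\<And>u. u \<in> \<Omega> \<Longrightarrow> op_monomial (\<lambda>\<alpha>. sa_connection gT (Inl \<alpha>)) \<beta> (lift f) u
    = lift (op_monomial (sa_connection gS) \<beta> f) u"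
proof -
  have pow: "(\<forall>u\<in>\<Omega>. (sa_connection gT (Inl \<alpha>) ^^ n) \<xi> u = lift ((sa_connection gS \<alpha> ^^ n) f) u)
      \<and> smooth_on U ((sa_connection gS \<alpha> ^^ n) f)"
    if "\<forall>u\<in>\<Omega>. \<xi> u = lift f u" "smooth_on U f" for \<alpha> n \<xi> f
  proof (induction n)
    case (Suc n)
    then show ?case
      using sa_connection_lift(1)[of "(sa_connection gS \<alpha> ^^ n) f" "(sa_connection gT (Inl \<alpha>) ^^ n) \<xi>"]
        smooth_on_sa_connection[OF open_U smooth_gS gS_pos] by simp
  qed (use that in simp)
  have "(\<forall>u\<in>\<Omega>. foldr (\<lambda>\<alpha>. sa_connection gT (Inl \<alpha>) ^^ \<beta> \<alpha>) xs (lift f) u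
      = lift (foldr (\<lambda>\<alpha>. sa_connection gS \<alpha> ^^ \<beta> \<alpha>) xs f) u)
      \<and> smooth_on U (foldr (\<lambda>\<alpha>. sa_connection gS \<alpha> ^^ \<beta> \<alpha>) xs f)" for xs
  proof (induction xs)
    case (Cons x xs)
    show ?case unfolding foldr.simps o_apply using Cons.IH by (intro pow) blast+
  qed (use f in simp)
  then show "\<And>u. u \<in> \<Omega> \<Longrightarrow> op_monomial (\<lambda>\<alpha>. sa_connection gT (Inl \<alpha>)) \<beta> (lift f) u
    = lift (op_monomial (sa_connection gS) \<beta> f) u"
    unfolding op_monomial_def by blast
qed

lemma foldr_sa_connection_zero:
  assumes "\<And>u. u \<in> \<Omega> \<Longrightarrow> \<xi> u = 0" "u \<in> \<Omega>"
  shows "foldr (\<lambda>i. sa_connection gT (d i) ^^ m i) xs \<xi> u = 0"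
proof -
  have pow: "\<forall>u\<in>\<Omega>. (sa_connection gT \<mu> ^^ n) \<xi> u = 0" if "\<forall>u\<in>\<Omega>. \<xi> u = 0" for \<mu> n \<xi>
    by (induction n) (use that sa_connection_zero[OF open_dom smooth_gT metric_det_pos] in auto)
  have "\<forall>u\<in>\<Omega>. foldr (\<lambda>i. sa_connection gT (d i) ^^ m i) xs \<xi> u = 0"
  proof (induction xs)
    case (Cons x xs)
    then show ?case using pow by simp
  qed (use assms(1) in simp)
  with assms(2) show ?thesis by blast
qed

text \<open>The nonzero exponent nearest the end of the list belongs to the operator that meets the
  lift first and annihilates it; everything applied afterwards preserves zero.\<close>

lemma normal_monomial_lift:
  assumes f: "smooth_on U f" and \<gamma>: "\<gamma> \<noteq> (\<lambda>_. 0)" and u: "u \<in> \<Omega>"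
  shows "op_monomial (\<lambda>i. sa_connection gT (Inr i)) \<gamma> (lift f) u = 0"
proof -
  let ?F = "\<lambda>xs. foldr (\<lambda>i. sa_connection gT (Inr i) ^^ \<gamma> i) xs (lift f)"
  have zero: "\<forall>u\<in>\<Omega>. ?F xs u = 0" if "\<exists>i\<in>set xs. \<gamma> i \<noteq> 0" for xs
    using that
  proof (induction xs)
    case (Cons x xs)
    show ?case
    proof (cases "\<exists>i\<in>set xs. \<gamma> i \<noteq> 0")
      case True
      with Cons.IH have "\<And>u. u \<in> \<Omega> \<Longrightarrow> ?F xs u = 0" by blast
      from foldr_sa_connection_zero[OF this, where d=Inr and m=\<gamma> and xs="[x]"] show ?thesis by simp
    next
      case False
      then have F: "?F xs = lift f" by (intro foldr_index_zero) auto
      \<comment> \<open>The power is split at its innermost factor, the one that acts on the lift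
        itself.\<close>
      obtain n where n: "\<gamma> x = Suc n" using Cons.prems False by (cases "\<gamma> x") auto
      have "sa_connection gT (Inr x) (lift f) u = 0" if "u \<in> \<Omega>" for u
        by (rule sa_connection_lift(2)[OF f refl that])
      from foldr_sa_connection_zero[OF this, where d=Inr and m="\<lambda>_. n" and xs="[x]"] show ?thesis
        by (simp add: F n funpow_Suc_right del: funpow.simps)
    qed
  qed simp
  obtain i where "\<gamma> i \<noteq> 0" using \<gamma> by auto
  then show ?thesis using zero some_enumeration(2) u unfolding op_monomial_def by auto
qed

lemma foldr_sa_connection_cong:
  assumes "\<And>u. u \<in> \<Omega> \<Longrightarrow> \<xi> u = \<zeta> u" "u \<in> \<Omega>"
  shows "foldr (\<lambda>i. sa_connection gT (d i) ^^ m i) xs \<xi> u = foldr (\<lambda>i. sa_connection gT (d i) ^^ m i) xs \<zeta> u"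
proof -
  have pow: "\<forall>u\<in>\<Omega>. (sa_connection gT \<mu> ^^ n) \<xi> u = (sa_connection gT \<mu> ^^ n) \<zeta> u"
    if "\<forall>u\<in>\<Omega>. \<xi> u = \<zeta> u" for \<mu> n \<xi> \<zeta>
  proof (induction n)
    case (Suc n)
    show ?case
      unfolding funpow.simps o_apply
    proof
      fix u assume u: "u \<in> \<Omega>"
      show "sa_connection gT \<mu> ((sa_connection gT \<mu> ^^ n) \<xi>) u = sa_connection gT \<mu> ((sa_connection gT \<mu> ^^ n) \<zeta>) u"
        using Suc.IH u by (intro sa_connection_cong[OF open_dom smooth_gT metric_det_pos]) blast+
    qed
  qed (use that in simp)
  have "\<forall>u\<in>\<Omega>. foldr (\<lambda>i. sa_connection gT (d i) ^^ m i) xs \<xi> u = foldr (\<lambda>i. sa_connection gT (d i) ^^ m i) xs \<zeta> u"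
  proof (induction xs)
    case (Cons x xs)
    show ?case unfolding foldr.simps o_apply by (rule pow[OF Cons.IH])
  qed (use assms(1) in simp)
  with assms(2) show ?thesis by blast
qed

text \<open>Evaluate the chosen standard form on F at a point of the zero section: terms with a
  normal factor vanish and the others become the terms defining the operator on S. The argument uses
  only that the choice is some standard form.\<close>

lemma submanifold_schroedinger_eq_laplacian:
  assumes f: "smooth_on U f" and s: "s \<in> U"
    and F: "smooth_on (tube_map X e ` \<Omega>) F" and FY: "\<And>u. u \<in> \<Omega> \<Longrightarrow> F (tube_map X e u) = lift f u"
  shows "submanifold_schroedinger U \<epsilon> X e f s = euclidean_laplacian F (tube_map X e (zero_section s))"
proof -
  define a where "a = (SOME a. standard_form U \<epsilon> X e a)"
  have "standard_form U \<epsilon> X e a"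
    unfolding a_def by (rule someI_ex[OF standard_form_exists]) unfold_locales
  define u :: "real^('k + 'm)" where "u = zero_section s"
  have u: "u \<in> \<Omega>" unfolding u_def by (rule zero_section_mem[OF s])
  let ?S = "{p. a p \<noteq> (\<lambda>_. 0)}" and ?N = "\<lambda>_::'m. 0::nat"
  define T where "T \<beta> \<gamma> = op_monomial (\<lambda>\<alpha>. sa_connection gT (Inl \<alpha>)) \<beta>
    (op_monomial (\<lambda>i. sa_connection gT (Inr i)) \<gamma> (F \<circ> tube_map X e)) u" for \<beta> \<gamma>
  have fin: "finite ?S" and lap: "euclidean_laplacian F (tube_map X e u) = (\<Sum>(\<beta>, \<gamma>)\<in>?S. a (\<beta>, \<gamma>) u *\<^sub>R T \<beta> \<gamma>)"
    using \<open>standard_form U \<epsilon> X e a\<close> F u unfolding standard_form_def Let_def T_def by blast+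
  have T_lift: "T \<beta> \<gamma> = op_monomial (\<lambda>\<alpha>. sa_connection gT (Inl \<alpha>)) \<beta>
    (op_monomial (\<lambda>i. sa_connection gT (Inr i)) \<gamma> (lift f)) u" for \<beta> \<gamma>
    unfolding T_def op_monomial_def
    by (intro foldr_sa_connection_cong u) (use FY in simp)
  have T0: "T \<beta> ?N = op_monomial (sa_connection gS) \<beta> f s" for \<beta>
  proof -
    have "op_monomial (\<lambda>i. sa_connection gT (Inr i)) ?N (lift f) = lift f"
      unfolding op_monomial_def by (rule foldr_index_zero) simp
    then show ?thesis
      unfolding T_lift using op_monomial_lift[OF f u] by (simp add: u_def lift_zero_section[OF s])
  qed
  have T1: "T \<beta> \<gamma> = 0" if "\<gamma> \<noteq> ?N" for \<beta> \<gamma>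
    unfolding T_lift unfolding op_monomial_def[of "\<lambda>\<alpha>. sa_connection gT (Inl \<alpha>)"]
    by (rule foldr_sa_connection_zero[OF normal_monomial_lift[OF f that] u])
  have "euclidean_laplacian F (tube_map X e u) = (\<Sum>p\<in>?S. a p u *\<^sub>R T (fst p) (snd p))"
    unfolding lap by (simp add: case_prod_unfold)
  also have "\<dots> = (\<Sum>p\<in>(\<lambda>\<beta>. (\<beta>, ?N)) ` {\<beta>. a (\<beta>, ?N) \<noteq> (\<lambda>_. 0)}. a p u *\<^sub>R T (fst p) (snd p))"
  proof (rule sum.mono_neutral_right[OF fin])
    show "\<forall>p\<in>?S - (\<lambda>\<beta>. (\<beta>, ?N)) ` {\<beta>. a (\<beta>, ?N) \<noteq> (\<lambda>_. 0)}. a p u *\<^sub>R T (fst p) (snd p) = 0"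
    proof
      fix p assume p: "p \<in> ?S - (\<lambda>\<beta>. (\<beta>, ?N)) ` {\<beta>. a (\<beta>, ?N) \<noteq> (\<lambda>_. 0)}"
      have "snd p \<noteq> ?N"
      proof
        assume "snd p = ?N"
        then have "p = (fst p, ?N)" by (simp add: prod_eq_iff)
        with p show False by (metis (no_types, lifting) DiffD1 DiffD2 image_eqI mem_Collect_eq)
      qed
      then show "a p u *\<^sub>R T (fst p) (snd p) = 0" by (simp add: T1)
    qed
  qed auto
  also have "\<dots> = (\<Sum>\<beta>\<in>{\<beta>. a (\<beta>, ?N) \<noteq> (\<lambda>_. 0)}. a (\<beta>, ?N) u *\<^sub>R T \<beta> ?N)"
    by (subst sum.reindex) (auto simp: inj_on_def)
  finally show ?thesis
    unfolding submanifold_schroedinger_def Let_def a_def[symmetric] T0 u_def by simp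
qed

text \<open>The lift is a function of tubular coordinates, while the Laplacian acts on functions of
  the ambient point. It is transported by the inverse of the tube map, whose smoothness was
  established by \<open>smooth_on_inv\<close>.\<close>

lemma submanifold_schroedinger_coordinates:
  fixes C :: "real^('k + 'm)^('k + 'm)" and s :: "real^'k"
  defines "u \<equiv> zero_section s :: real^('k + 'm)"
  assumes f: "smooth_on U f" and s: "s \<in> U"
    and C: "C ** induced_metric (tube_map X e) u = mat 1"
    and b: "(\<Sum>\<mu>\<in>UNIV. \<Sum>\<nu>\<in>UNIV. C $ \<mu> $ \<nu> *\<^sub>R partial \<nu> (partial \<mu> (tube_map X e)) u)
      = (\<Sum>\<mu>\<in>UNIV. b $ \<mu> *\<^sub>R partial \<mu> (tube_map X e) u)"
  shows "submanifold_schroedinger U \<epsilon> X e f s =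
    (\<Sum>\<mu>\<in>UNIV. \<Sum>\<nu>\<in>UNIV. C $ \<mu> $ \<nu> *\<^sub>R partial \<nu> (partial \<mu> (lift f)) u)
    - (\<Sum>\<mu>\<in>UNIV. b $ \<mu> *\<^sub>R partial \<mu> (lift f) u)"
proof -
  let ?Y = "tube_map X e"
  define F where "F y = lift f (inv_into \<Omega> ?Y y)" for y
  have u: "u \<in> \<Omega>" unfolding u_def by (rule zero_section_mem[OF s])
  have FY: "F (?Y v) = lift f v" if "v \<in> \<Omega>" for v
    using inj that by (simp add: F_def)
  have F: "smooth_on (?Y ` \<Omega>) F"
    unfolding F_def
  proof (rule smooth_on_compose[OF open_image[OF open_dom subset_refl] open_dom _ smooth_lift[OF f] smooth_on_inv])
    show "inv_into \<Omega> ?Y ` ?Y ` \<Omega> \<subseteq> \<Omega>" using inj by simp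
  qed
  have p: "partial \<mu> (\<lambda>u. F (?Y u)) v = partial \<mu> (lift f) v" if "v \<in> \<Omega>" for \<mu> v
    by (rule partial_cong[OF open_dom that FY])
  have pp: "partial \<nu> (partial \<mu> (\<lambda>u. F (?Y u))) u = partial \<nu> (partial \<mu> (lift f)) u" for \<mu> \<nu>
    by (rule partial_cong[OF open_dom u p])
  have "submanifold_schroedinger U \<epsilon> X e f s = euclidean_laplacian F (?Y u)"
    unfolding u_def by (rule submanifold_schroedinger_eq_laplacian[OF f s F FY])
  also note laplacian_coordinates[OF F u C b]
  finally show ?thesis by (simp only: p[OF u] pp)
qed

end

section \<open>Tubular coordinates\<close>

lemma sum_UNIV_Plus:
  "(\<Sum>\<mu>\<in>(UNIV :: ('k::finite + 'm::finite) set). h \<mu>) = (\<Sum>\<alpha>\<in>UNIV. h (Inl \<alpha>)) + (\<Sum>i\<in>UNIV. h (Inr i))"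
  using sum.Plus[of "UNIV :: 'k set" "UNIV :: 'm set" h] by (simp add: o_def UNIV_Plus_UNIV)

lemma partial_sum:
  assumes "\<And>a. a \<in> A \<Longrightarrow> f a differentiable at x"
  shows "partial i (\<lambda>x. \<Sum>a\<in>A. f a x) x = (\<Sum>a\<in>A. partial i (f a) x)"
proof -
  have "((\<lambda>x. \<Sum>a\<in>A. f a x) has_derivative (\<lambda>v. \<Sum>a\<in>A. frechet_derivative (f a) (at x) v)) (at x)"
    using assms frechet_derivative_works by (intro has_derivative_sum) blast
  from partial_eqI[OF this] show ?thesis by (simp add: partial_def)
qed

lemma bounded_linear_norm_part: "bounded_linear (\<lambda>v :: real^('k::finite + 'm::finite). norm_part v $ i)"
  unfolding linear_conv_bounded_linear[symmetric]
  by (rule linearI) (simp_all add: norm_part_def)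

lemma continuous_on_norm_part: "continuous_on UNIV (norm_part :: real^('k::finite + 'm::finite) \<Rightarrow> real^'m)"
proof -
  have "linear (norm_part :: real^('k::finite + 'm::finite) \<Rightarrow> real^'m)"
    by (rule linearI) (simp_all add: norm_part_def vec_eq_iff)
  then show ?thesis by (rule linear_continuous_on_compose[OF continuous_on_id])
qed

lemma open_tube_domain:
  assumes "open U" shows "open (tube_domain U \<epsilon> :: (real^('k::finite + 'm::finite)) set)"
proof -
  have "open ((tang_part :: real^('k + 'm) \<Rightarrow> real^'k) -` U)"
    by (rule open_vimage[OF assms linear_continuous_on[OF bounded_linear_tang_part]])
  moreover have "open {u :: real^('k + 'm). norm (norm_part u) < \<epsilon>}"
    by (intro open_Collect_less continuous_on_norm continuous_on_norm_part continuous_on_const)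
  moreover have "tube_domain U \<epsilon> = (tang_part :: real^('k + 'm) \<Rightarrow> real^'k) -` U \<inter> {u. norm (norm_part u) < \<epsilon>}"
    by (auto simp: tube_domain_def)
  ultimately show ?thesis by (simp add: open_Int)
qed

locale framed_patch =
  fixes U :: "(real^'k) set" and X :: "real^'k \<Rightarrow> real^'n" and e :: "'m::finite \<Rightarrow> real^'k \<Rightarrow> real^'n"
  assumes open_U: "open U" and smooth_X: "smooth_on U X"
    and inj_X: "inj_on X U"
    and inj_deriv: "\<And>s. s \<in> U \<Longrightarrow> inj (frechet_derivative X (at s))"
    and frame: "adapted_frame U X e"
begin

lemma smooth_e: "smooth_on U (e i)"
  using frame by (simp add: adapted_frame_def)

lemma orthonormal: "s \<in> U \<Longrightarrow> e i s \<bullet> e j s = (if i = j then 1 else 0)"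
  using frame by (simp add: adapted_frame_def)

lemma normal: "s \<in> U \<Longrightarrow> e i s \<bullet> partial \<alpha> X s = 0"
  using frame by (simp add: adapted_frame_def)

lemma tangent_deriv: "s \<in> U \<Longrightarrow> partial \<alpha> (e i) s \<in> span (range (\<lambda>\<beta>. partial \<beta> X s))"
  using frame by (simp add: adapted_frame_def)

lemma card_eq: "CARD('k + 'm) = CARD('n)"
  using frame by (simp add: adapted_frame_def)

lemma partials_independent:
  assumes "s \<in> U" "(\<Sum>\<alpha>\<in>UNIV. w $ \<alpha> *\<^sub>R partial \<alpha> X s) = 0" shows "w = 0"
proof -
  have D: "(X has_derivative (\<lambda>v. \<Sum>i\<in>UNIV. v $ i *\<^sub>R partial i X s)) (at s)"
    by (rule has_derivative_partial[OF smooth_on_at[OF smooth_X open_U assms(1)]])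
  then have "frechet_derivative X (at s) = (\<lambda>v. \<Sum>i\<in>UNIV. v $ i *\<^sub>R partial i X s)"
    by (rule frechet_derivative_at[symmetric])
  with inj_deriv[OF assms(1)] have inj: "inj (\<lambda>v. \<Sum>i\<in>UNIV. v $ i *\<^sub>R partial i X s)" by simp
  show ?thesis
    by (rule injD[OF inj]) (simp add: assms(2))
qed

lemma smooth_tube_map:
  "smooth_on (tube_domain U \<epsilon>) (tube_map X e :: real^('k + 'm) \<Rightarrow> real^'n)"
proof -
  let ?\<Omega> = "tube_domain U \<epsilon> :: (real^('k + 'm)) set"
  have op: "open ?\<Omega>" by (rule open_tube_domain[OF open_U])
  have sub: "tang_part ` ?\<Omega> \<subseteq> U" by (auto simp: tube_domain_def)
  have t: "smooth_on ?\<Omega> (tang_part :: real^('k + 'm) \<Rightarrow> real^'k)"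
    by (rule smooth_on_linear[OF op bounded_linear_tang_part])
  have n: "smooth_on ?\<Omega> (\<lambda>u. norm_part u $ i)" for i
    by (rule smooth_on_linear[OF op bounded_linear_norm_part])
  show ?thesis
    unfolding tube_map_def[abs_def]
    by (intro smooth_on_add smooth_on_sum smooth_on_scaleR op n
        smooth_on_compose[OF op open_U sub smooth_X t] smooth_on_compose[OF op open_U sub smooth_e t])
qed

lemma partial_tube_map:
  fixes u :: "real^('k + 'm)"
  assumes u: "tang_part u \<in> U"
  shows "partial (Inl \<alpha>) (tube_map X e) u =
      partial \<alpha> X (tang_part u) + (\<Sum>i\<in>UNIV. norm_part u $ i *\<^sub>R partial \<alpha> (e i) (tang_part u))"
    and "partial (Inr j) (tube_map X e) u = e j (tang_part u)"
proof -
  let ?s = "tang_part u"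
  have dt: "(\<lambda>v. h (tang_part v)) differentiable at u" if "smooth_on U h" for h :: "real^'k \<Rightarrow> real^'n"
    using has_derivative_compose[OF bounded_linear_imp_has_derivative[OF bounded_linear_tang_part]
        has_derivative_partial[OF smooth_on_at[OF that open_U u]]]
    unfolding differentiable_def by blast
  have dn: "(\<lambda>v. norm_part v $ i) differentiable at u" for i
    using bounded_linear_imp_has_derivative[OF bounded_linear_norm_part] unfolding differentiable_def by blast
  have pn: "partial \<mu> (\<lambda>v. norm_part v $ i) u = norm_part (axis \<mu> 1) $ i" for i \<mu>
    by (rule partial_eqI[OF bounded_linear_imp_has_derivative[OF bounded_linear_norm_part]])
  have ds: "(\<lambda>v. norm_part v $ i *\<^sub>R e i (tang_part v)) differentiable at u" for i
    by (rule differentiable_scaleR[OF dn dt[OF smooth_e]])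
  have "partial \<mu> (tube_map X e) u = partial \<mu> (\<lambda>v. X (tang_part v)) u
      + (\<Sum>i\<in>UNIV. partial \<mu> (\<lambda>v. norm_part v $ i *\<^sub>R e i (tang_part v)) u)" for \<mu>
    unfolding tube_map_def[abs_def]
    by (subst partial_add[OF dt[OF smooth_X] differentiable_sum]) (simp_all add: ds partial_sum)
  also have "\<dots> \<mu> = partial \<mu> (\<lambda>v. X (tang_part v)) u
      + (\<Sum>i\<in>UNIV. norm_part u $ i *\<^sub>R partial \<mu> (\<lambda>v. e i (tang_part v)) u + norm_part (axis \<mu> 1) $ i *\<^sub>R e i ?s)" for \<mu>
    unfolding partial_scaleR[OF dn dt[OF smooth_e]] pn ..
  finally have D: "partial \<mu> (tube_map X e) u = partial \<mu> (\<lambda>v. X (tang_part v)) u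
      + (\<Sum>i\<in>UNIV. norm_part u $ i *\<^sub>R partial \<mu> (\<lambda>v. e i (tang_part v)) u + norm_part (axis \<mu> 1) $ i *\<^sub>R e i ?s)" for \<mu> .
  note pt = partial_tang_part[OF smooth_on_at[OF smooth_X open_U u]] partial_tang_part[OF smooth_on_at[OF smooth_e open_U u]]
  show "partial (Inl \<alpha>) (tube_map X e) u =
      partial \<alpha> X ?s + (\<Sum>i\<in>UNIV. norm_part u $ i *\<^sub>R partial \<alpha> (e i) ?s)"
    unfolding D by (simp add: pt norm_part_def axis_def)
  show "partial (Inr j) (tube_map X e) u = e j ?s"
    unfolding D
    by (simp add: pt norm_part_def axis_def if_distrib[of "\<lambda>z. z *\<^sub>R _"] cong: if_cong)
qed

text \<open>Orthonormality makes the normal coordinates isometric, so the bound \<epsilon> on them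
  in \<open>tube_domain\<close> matches the radius of the normal disc bundle.\<close>

lemma norm_frame_sum:
  assumes "s \<in> U" shows "norm (\<Sum>i\<in>UNIV. q $ i *\<^sub>R e i s) = norm q"
proof -
  have "(\<Sum>i\<in>UNIV. q $ i *\<^sub>R e i s) \<bullet> (\<Sum>i\<in>UNIV. q $ i *\<^sub>R e i s) = (\<Sum>i\<in>UNIV. q $ i * q $ i)"
    by (simp add: inner_sum_left inner_sum_right orthonormal[OF assms] if_distrib cong: if_cong)
  also have "\<dots> = q \<bullet> q" by (simp add: inner_vec_def)
  finally have "(\<Sum>i\<in>UNIV. q $ i *\<^sub>R e i s) \<bullet> (\<Sum>i\<in>UNIV. q $ i *\<^sub>R e i s) = q \<bullet> q" .
  then show ?thesis by (simp add: norm_eq_sqrt_inner)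
qed

text \<open>The projection of the tubular neighbourhood recovers the base point, and hence its derivative
  the tangential part of a vector; this is what makes the tubular coordinates a diffeomorphism.\<close>

lemma coordinate_map_tube:
  assumes tub: "tubular_neighbourhood TYPE('k) S \<epsilon> T" and chart: "analytic_chart S U X"
  shows "coordinate_map (tube_domain U \<epsilon>) (tube_map X e)"
proof
  let ?\<Omega> = "tube_domain U \<epsilon> :: (real^('k + 'm)) set" and ?Y = "tube_map X e"
  obtain \<pi> where opT: "open T" and T: "T = (\<lambda>(p, v). p + v) ` normal_disc_bundle TYPE('k) S \<epsilon>"
    and s\<pi>: "smooth_on T (\<pi> :: real^'n \<Rightarrow> real^'n)"
    and \<pi>: "\<And>p v. (p, v) \<in> normal_disc_bundle TYPE('k) S \<epsilon> \<Longrightarrow> \<pi> (p + v) = p"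
    using tub unfolding tubular_neighbourhood_def by fast
  have mem: "(X (tang_part u), \<Sum>i\<in>UNIV. norm_part u $ i *\<^sub>R e i (tang_part u)) \<in> normal_disc_bundle TYPE('k) S \<epsilon>"
    if "u \<in> ?\<Omega>" for u
  proof -
    have u: "tang_part u \<in> U" "norm (norm_part u) < \<epsilon>" using that by (auto simp: tube_domain_def)
    have "(\<Sum>i\<in>UNIV. norm_part u $ i *\<^sub>R e i (tang_part u)) \<bullet> partial \<alpha> X (tang_part u) = 0" for \<alpha>
      by (simp add: inner_sum_left normal[OF u(1)])
    then show ?thesis
      unfolding normal_disc_bundle_def using u chart norm_frame_sum[OF u(1)] by auto
  qed
  have Y: "?Y u \<in> T" "\<pi> (?Y u) = X (tang_part u)" if "u \<in> ?\<Omega>" for u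
    using imageI[OF mem[OF that], of "\<lambda>(p, v). p + v"] \<pi>[OF mem[OF that]] unfolding T tube_map_def by simp_all
  show "CARD('k + 'm) = CARD('n)" by (rule card_eq)
  show op: "open ?\<Omega>" by (rule open_tube_domain[OF open_U])
  show sm: "smooth_on ?\<Omega> ?Y" by (rule smooth_tube_map)
  show "inj_on ?Y ?\<Omega>"
  proof
    fix u v assume u: "u \<in> ?\<Omega>" and v: "v \<in> ?\<Omega>" and eq: "?Y u = ?Y v"
    have uv: "tang_part u \<in> U" "tang_part v \<in> U" using u v by (auto simp: tube_domain_def)
    have t: "tang_part u = tang_part v"
      using Y(2)[OF u] Y(2)[OF v] eq inj_onD[OF inj_X _ uv] by simp
    have "e j (tang_part u) \<bullet> (\<Sum>i\<in>UNIV. norm_part w $ i *\<^sub>R e i (tang_part u)) = norm_part w $ j" for w :: "real^('k+'m)" and j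
      by (simp add: inner_sum_right orthonormal[OF uv(1)] if_distrib cong: if_cong)
    moreover have "(\<Sum>i\<in>UNIV. norm_part u $ i *\<^sub>R e i (tang_part u)) = (\<Sum>i\<in>UNIV. norm_part v $ i *\<^sub>R e i (tang_part u))"
      using eq by (simp add: tube_map_def t)
    ultimately have n: "norm_part u $ j = norm_part v $ j" for j by (metis (no_types))
    have "u $ \<mu> = v $ \<mu>" for \<mu>
      using arg_cong[OF t, of "\<lambda>w. w $ projl \<mu>"] n[of "projr \<mu>"]
      by (cases \<mu>) (simp_all add: tang_part_def norm_part_def)
    then show "u = v" by (simp add: vec_eq_iff)
  qed
  fix u w assume u: "u \<in> ?\<Omega>" and w: "(\<Sum>\<mu>\<in>UNIV. w $ \<mu> *\<^sub>R partial \<mu> ?Y u) = 0"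
  let ?s = "tang_part u"
  have s: "?s \<in> U" using u by (simp add: tube_domain_def)
  obtain D where D: "(\<pi> has_derivative D) (at (?Y u))"
    using smooth_on_at[OF s\<pi> opT Y(1)[OF u]] unfolding differentiable_def by blast
  have "((\<lambda>v. \<pi> (?Y v)) has_derivative (\<lambda>v. D (\<Sum>\<mu>\<in>UNIV. v $ \<mu> *\<^sub>R partial \<mu> ?Y u))) (at u)"
    by (rule has_derivative_compose[OF has_derivative_partial[OF smooth_on_at[OF sm op u]] D])
  then have "((\<lambda>v. X (tang_part v)) has_derivative (\<lambda>v. D (\<Sum>\<mu>\<in>UNIV. v $ \<mu> *\<^sub>R partial \<mu> ?Y u))) (at u)"
    by (rule has_derivative_transform_within_open[OF _ op u Y(2)])
  moreover have "((\<lambda>v. X (tang_part v)) has_derivative (\<lambda>v. \<Sum>\<alpha>\<in>UNIV. tang_part v $ \<alpha> *\<^sub>R partial \<alpha> X ?s)) (at u)"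
    by (rule has_derivative_compose[OF bounded_linear_imp_has_derivative[OF bounded_linear_tang_part]
          has_derivative_partial[OF smooth_on_at[OF smooth_X open_U s]]])
  ultimately have "(\<lambda>v. D (\<Sum>\<mu>\<in>UNIV. v $ \<mu> *\<^sub>R partial \<mu> ?Y u)) = (\<lambda>v. \<Sum>\<alpha>\<in>UNIV. tang_part v $ \<alpha> *\<^sub>R partial \<alpha> X ?s)"
    by (rule has_derivative_unique)
  from fun_cong[OF this, of w] have "(\<Sum>\<alpha>\<in>UNIV. tang_part w $ \<alpha> *\<^sub>R partial \<alpha> X ?s) = 0"
    unfolding w using linear_0[OF has_derivative_linear[OF D]] by simp
  then have "tang_part w = 0" by (rule partials_independent[OF s])
  then have wl: "w $ Inl \<alpha> = 0" for \<alpha> by (simp add: tang_part_def vec_eq_iff)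
  have w0: "(\<Sum>i\<in>UNIV. w $ Inr i *\<^sub>R e i ?s) = 0"
    using w unfolding sum_UNIV_Plus by (simp add: wl partial_tube_map(2)[OF s])
  have "e j ?s \<bullet> (\<Sum>i\<in>UNIV. w $ Inr i *\<^sub>R e i ?s) = 0" for j unfolding w0 by simp
  then have wr: "w $ Inr j = 0" for j
    by (simp add: inner_sum_right orthonormal[OF s] if_distrib cong: if_cong)
  have "w $ \<mu> = 0" for \<mu> using wl wr by (cases \<mu>) simp_all
  then show "w = 0" by (simp add: vec_eq_iff)
qed

end

section \<open>The general form of the operator\<close>

lemma span_range_coeffs:
  fixes f :: "'a::finite \<Rightarrow> 'b::real_vector"
  assumes "v \<in> span (range f)"
  shows "\<exists>c. v = (\<Sum>i\<in>UNIV. c i *\<^sub>R f i)"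
  using assms
proof (induction rule: span_induct_alt)
  case base
  show ?case by (intro exI[of _ "\<lambda>_. 0"]) simp
next
  case (step k x y)
  then obtain c j where c: "y = (\<Sum>i\<in>UNIV. c i *\<^sub>R f i)" and j: "x = f j" by blast
  have "k *\<^sub>R f j = (\<Sum>i\<in>UNIV. (if i = j then k else 0) *\<^sub>R f i)"
    by (simp add: if_distrib[of "\<lambda>z. z *\<^sub>R _"] cong: if_cong)
  then have "k *\<^sub>R x + y = (\<Sum>i\<in>UNIV. ((if i = j then k else 0) + c i) *\<^sub>R f i)"
    unfolding c j scaleR_left_distrib sum.distrib by simp
  then show ?case by (rule exI[where x="\<lambda>i. (if i = j then k else 0) + c i"])
qed

text \<open>Lets tangential derivatives at q = 0 be computed on S, for the position vector and for
  the lift alike.\<close>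

lemma partial_zero_section:
  fixes h :: "real^('k::finite + 'm::finite) \<Rightarrow> 'b::real_normed_vector"
  assumes "h differentiable at (zero_section s)"
  shows "partial \<alpha> (\<lambda>s. h (zero_section s)) s = partial (Inl \<alpha>) h (zero_section s)"
proof -
  have lin: "bounded_linear (zero_section :: real^'k \<Rightarrow> real^('k + 'm))"
    unfolding linear_conv_bounded_linear[symmetric]
    by (rule linearI) (simp_all add: zero_section_def vec_eq_iff split: sum.splits)
  have ax: "zero_section (axis \<alpha> 1) = (axis (Inl \<alpha>) 1 :: real^('k + 'm))"
    by (simp add: zero_section_def axis_def vec_eq_iff split: sum.splits)
  have "partial \<alpha> (\<lambda>s. h (zero_section s)) s
      = (\<Sum>\<mu>\<in>UNIV. zero_section (axis \<alpha> 1) $ \<mu> *\<^sub>R partial \<mu> h (zero_section s))"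
    by (rule partial_eqI[OF has_derivative_compose[OF bounded_linear_imp_has_derivative[OF lin]
            has_derivative_partial[OF assms]]])
  then show ?thesis
    unfolding ax by (simp add: axis_def if_distrib[of "\<lambda>z. z *\<^sub>R _"] cong: if_cong)
qed

lemma tang_part_line [simp]: "tang_part (zero_section s + t *\<^sub>R axis (Inr i) 1) = s"
  by (simp add: tang_part_def zero_section_def axis_def vec_eq_iff)

lemma norm_part_line: "norm_part (zero_section s + t *\<^sub>R axis (Inr i) 1) = t *\<^sub>R axis i 1"
  by (simp add: norm_part_def zero_section_def axis_def vec_eq_iff)

text \<open>Along a normal line the density quotient is \<open>(P\<^sup>2)\<^sup>-\<^sup>1\<^sup>/\<^sup>4\<close> for a quadratic polynomial \<open>P\<close>;
  its second derivative at the foot point is what produces the curvature potential.\<close>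

lemma second_derivative_density:
  fixes \<phi> \<phi>' :: "real \<Rightarrow> complex" and \<tau> \<kappa> :: real
  assumes \<epsilon>: "\<epsilon> > 0"
    and \<phi>: "\<And>t. \<bar>t\<bar> < \<epsilon> \<Longrightarrow> \<phi> t = (((1 - \<tau> * t + \<kappa> * t\<^sup>2)\<^sup>2) powr (-1/4)) *\<^sub>R z"
    and d1: "\<And>t. \<bar>t\<bar> < \<epsilon> \<Longrightarrow> (\<phi> has_vector_derivative \<phi>' t) (at t)"
    and d2: "(\<phi>' has_vector_derivative \<phi>'') (at 0)"
  shows "\<phi>' 0 = (\<tau> / 2) *\<^sub>R z" "\<phi>'' = (3 / 4 * \<tau>\<^sup>2 - \<kappa>) *\<^sub>R z"
proof -
  define P where "P t = 1 - \<tau> * t + \<kappa> * t\<^sup>2" for t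
  have P': "(P has_real_derivative (- \<tau> + 2 * \<kappa> * t)) (at t)" for t
    unfolding P_def by (auto intro!: derivative_eq_intros)
  have "continuous_on UNIV P" unfolding P_def by (intro continuous_intros)
  then have "open {t. P t > 0}" by (intro open_Collect_less continuous_on_const)
  \<comment> \<open>Only where P is positive does (P^2)^(-1/4) equal P^(-1/2). Since P 0 = 1 this
    holds near 0, which is all that two derivatives at 0 require.\<close>
  define W where "W = {t. P t > 0} \<inter> {-\<epsilon><..<\<epsilon>}"
  have W: "open W" "0 \<in> W"
    using \<open>open {t. P t > 0}\<close> \<epsilon> by (auto simp: W_def P_def)
  have WD: "P t > 0" "\<bar>t\<bar> < \<epsilon>" if "t \<in> W" for t using that by (auto simp: W_def)
  have \<phi>P: "\<phi> t = (P t powr (-1/2)) *\<^sub>R z" if "t \<in> W" for t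
  proof -
    have "(P t)\<^sup>2 = P t powr 2" using WD(1)[OF that] by simp
    then have "((P t)\<^sup>2) powr (-1/4) = P t powr (-1/2)" by (simp add: powr_powr)
    then show ?thesis using \<phi>[OF WD(2)[OF that]] by (simp add: P_def)
  qed
  define h where "h t = (-1/2 * P t powr (-3/2) * (- \<tau> + 2 * \<kappa> * t)) *\<^sub>R z" for t
  have h: "\<phi>' t = h t" if t: "t \<in> W" for t
  proof (rule vector_derivative_unique_at[OF d1[OF WD(2)[OF t]]])
    have "((\<lambda>t. P t powr (-1/2)) has_real_derivative (-1/2 * P t powr (-3/2) * (- \<tau> + 2 * \<kappa> * t))) (at t)"
      using DERIV_fun_powr[OF P'[of t] WD(1)[OF t], of "-1/2"]
      by simp
    from has_vector_derivative_scaleR[OF this has_vector_derivative_const[of z]]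
    have "((\<lambda>t. (P t powr (-1/2)) *\<^sub>R z) has_vector_derivative h t) (at t)"
      unfolding h_def by simp
    then show "(\<phi> has_vector_derivative h t) (at t)"
      by (rule has_vector_derivative_transform_within_open[OF _ W(1) t]) (simp add: \<phi>P)
  qed
  show "\<phi>' 0 = (\<tau> / 2) *\<^sub>R z"
    using h[OF W(2)] by (simp add: h_def P_def)
  have "((\<lambda>t. P t powr (-3/2)) has_real_derivative (-3/2 * P 0 powr (-5/2) * (- \<tau>))) (at 0)"
    using DERIV_fun_powr[OF P'[of 0] WD(1)[OF W(2)], of "-3/2"] by simp
  \<comment> \<open>With P = 1, P' = -\<tau> and P'' = 2\<kappa> at 0, the derivative of -1/2
    P^(-3/2) P' is 3/4 P'^2 - 1/2 P''.\<close>
  from DERIV_mult[OF DERIV_cmult[OF this, of "-1/2"], of "\<lambda>t. - \<tau> + 2 * \<kappa> * t" "2 * \<kappa>"]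
  have "((\<lambda>t. -1/2 * P t powr (-3/2) * (- \<tau> + 2 * \<kappa> * t)) has_real_derivative (3 / 4 * \<tau>\<^sup>2 - \<kappa>)) (at 0)"
    by (auto intro!: derivative_eq_intros simp: P_def power2_eq_square diff_divide_distrib)
  from has_vector_derivative_scaleR[OF this has_vector_derivative_const[of z]]
  have "(h has_vector_derivative (3 / 4 * \<tau>\<^sup>2 - \<kappa>) *\<^sub>R z) (at 0)"
    unfolding h_def[abs_def] by simp
  moreover have "(h has_vector_derivative \<phi>'') (at 0)"
    by (rule has_vector_derivative_transform_within_open[OF d2 W(1) W(2) h])
  ultimately show "\<phi>'' = (3 / 4 * \<tau>\<^sup>2 - \<kappa>) *\<^sub>R z"
    using vector_derivative_unique_at by blast
qed

text \<open>True for all finite types, but needed, and proved, only when the sum has three elements.\<close>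

definition det_block_expansion :: "('k::finite + 'm::finite) itself \<Rightarrow> bool"
  where "det_block_expansion _ \<longleftrightarrow> (\<forall>M :: real^('k + 'm)^('k + 'm).
    (\<forall>\<alpha> j. M $ Inl \<alpha> $ Inr j = 0) \<longrightarrow> (\<forall>\<alpha> j. M $ Inr j $ Inl \<alpha> = 0) \<longrightarrow>
    (\<forall>j k. M $ Inr j $ Inr k = (if j = k then 1 else 0)) \<longrightarrow> det M = det (\<chi> \<alpha> \<beta>. M $ Inl \<alpha> $ Inl \<beta>))"

section \<open>Weingarten matrices and the metric along normal lines\<close>

context framed_patch
begin

text \<open>The relation has the sign and index convention of \<open>shape_operator\<close>, so for
  a surface the matrix A is that of the shape operator.\<close>

definition weingarten :: "'m \<Rightarrow> real^'k \<Rightarrow> real^'k^'k \<Rightarrow> bool"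
  where "weingarten i s A \<longleftrightarrow> (\<forall>\<beta>. - partial \<beta> (e i) s = (\<Sum>\<alpha>\<in>UNIV. (A $ \<alpha> $ \<beta>) *\<^sub>R partial \<alpha> X s))"

lemma weingarten_exists:
  assumes "s \<in> U" shows "\<exists>A. weingarten i s A"
proof -
  have "\<exists>c. - partial \<beta> (e i) s = (\<Sum>\<alpha>\<in>UNIV. c \<alpha> *\<^sub>R partial \<alpha> X s)" for \<beta>
    by (rule span_range_coeffs[OF span_neg[OF tangent_deriv[OF assms]]])
  then obtain c where "\<And>\<beta>. - partial \<beta> (e i) s = (\<Sum>\<alpha>\<in>UNIV. c \<beta> \<alpha> *\<^sub>R partial \<alpha> X s)" by metis
  then have "weingarten i s (\<chi> \<alpha> \<beta>. c \<beta> \<alpha>)" by (simp add: weingarten_def)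
  then show ?thesis by blast
qed

text \<open>Along the line in direction \<open>e i\<close> the tangential partial derivatives are
  those of X transformed by 1 - t A, and the normal ones are the frame vectors. Because the
  derivatives of an adapted frame are tangent, the mixed blocks vanish.\<close>

lemma induced_metric_line:
  fixes t :: real and s :: "real^'k" and i :: 'm
  defines "u \<equiv> zero_section s + t *\<^sub>R axis (Inr i) 1 :: real^('k + 'm)"
  assumes s: "s \<in> U" and A: "weingarten i s A"
  shows "induced_metric (tube_map X e) (u) $ Inl \<alpha> $ Inl \<beta> =
      (transpose (mat 1 - t *\<^sub>R A) ** induced_metric X s ** (mat 1 - t *\<^sub>R A)) $ \<alpha> $ \<beta>" (is ?LL)
    and "induced_metric (tube_map X e) (u) $ Inl \<alpha> $ Inr j = 0" (is ?LR)
    and "induced_metric (tube_map X e) (u) $ Inr j $ Inl \<alpha> = 0" (is ?RL)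
    and "induced_metric (tube_map X e) (u) $ Inr j $ Inr k = (if j = k then 1 else 0)" (is ?RR)
proof -
  let ?B = "mat 1 - t *\<^sub>R A" and ?p = "\<lambda>\<alpha>. partial \<alpha> X s"
  have tu: "tang_part (u) = s" by (simp add: u_def)
  have L: "partial (Inl \<alpha>) (tube_map X e) (u) = (\<Sum>\<gamma>\<in>UNIV. ?B $ \<gamma> $ \<alpha> *\<^sub>R ?p \<gamma>)" for \<alpha>
  proof -
    have "partial (Inl \<alpha>) (tube_map X e) (u) = ?p \<alpha> + t *\<^sub>R partial \<alpha> (e i) s"
      using partial_tube_map(1)[of "u" \<alpha>] s
      unfolding tu unfolding u_def norm_part_line
      by (simp add: axis_def if_distrib[of "\<lambda>z. z *\<^sub>R _"] if_distrib[of "\<lambda>z. t * z"] cong: if_cong)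
    also have "partial \<alpha> (e i) s = - (\<Sum>\<gamma>\<in>UNIV. A $ \<gamma> $ \<alpha> *\<^sub>R ?p \<gamma>)"
      using A unfolding weingarten_def by (metis minus_minus)
    also have "?p \<alpha> + t *\<^sub>R - (\<Sum>\<gamma>\<in>UNIV. A $ \<gamma> $ \<alpha> *\<^sub>R ?p \<gamma>)
        = (\<Sum>\<gamma>\<in>UNIV. (if \<gamma> = \<alpha> then 1 else 0) *\<^sub>R ?p \<gamma> - (t * A $ \<gamma> $ \<alpha>) *\<^sub>R ?p \<gamma>)"
      by (simp add: sum_subtractf scaleR_sum_right if_distrib[of "\<lambda>z. z *\<^sub>R _"] cong: if_cong)
    also have "\<dots> = (\<Sum>\<gamma>\<in>UNIV. ?B $ \<gamma> $ \<alpha> *\<^sub>R ?p \<gamma>)"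
      by (simp add: mat_def scaleR_diff_left)
    finally show ?thesis .
  qed
  have R: "partial (Inr j) (tube_map X e) (u) = e j s" for j
    using partial_tube_map(2)[of "u" j] s unfolding tu by simp
  show ?LL
    by (simp add: induced_metric_def L transpose_def matrix_matrix_mult_def inner_sum_left inner_sum_right
        sum_distrib_left sum_distrib_right del: vector_minus_component, subst sum.swap)
      (simp add: mult_ac del: vector_minus_component)
  show ?LR ?RL ?RR
    by (simp_all add: induced_metric_def L R inner_sum_left inner_sum_right normal[OF s] orthonormal[OF s]
        normal[OF s, unfolded inner_commute[of "e _ s"]])
qed


lemma metric_det_line:
  assumes bd: "det_block_expansion TYPE('k + 'm)" and s: "s \<in> U" and A: "weingarten i s A"
  shows "metric_det (tube_map X e) (zero_section s + t *\<^sub>R axis (Inr i) 1 :: real^('k + 'm))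
    = metric_det X s * (det (mat 1 - t *\<^sub>R A))\<^sup>2"
proof -
  let ?M = "induced_metric (tube_map X e) (zero_section s + t *\<^sub>R axis (Inr i) 1 :: real^('k + 'm))"
  note M = induced_metric_line[OF s A, of t]
  have "det ?M = det (\<chi> \<alpha> \<beta>. ?M $ Inl \<alpha> $ Inl \<beta>)"
    using bd M(2-4) unfolding det_block_expansion_def by blast
  also have "(\<chi> \<alpha> \<beta>. ?M $ Inl \<alpha> $ Inl \<beta>)
      = transpose (mat 1 - t *\<^sub>R A) ** induced_metric X s ** (mat 1 - t *\<^sub>R A)"
    by (simp only: vec_eq_iff vec_lambda_beta M(1)) simp
  also have "det \<dots> = det (induced_metric X s) * (det (mat 1 - t *\<^sub>R A))\<^sup>2"
    by (simp add: det_mul power2_eq_square)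
  finally show ?thesis by (simp add: metric_det_def)
qed

lemma tube_coordinates_tube:
  assumes bd: "det_block_expansion TYPE('k + 'm)"
    and tub: "tubular_neighbourhood TYPE('k) S \<epsilon> T" and chart: "analytic_chart S U X"
  shows "tube_coordinates U \<epsilon> X e"
proof -
  interpret coordinate_map "tube_domain U \<epsilon>" "tube_map X e" by (rule coordinate_map_tube[OF tub chart])
  show ?thesis
  proof
    show "\<epsilon> > 0" using tub by (simp add: tubular_neighbourhood_def)
    fix s assume s: "s \<in> U"
    fix i :: 'm
    obtain A where "weingarten i s A" using weingarten_exists[OF s] by blast
    \<comment> \<open>At t = 0 the factor det(1 - t A) is 1, whichever normal direction is
      taken.\<close>
    from metric_det_line[OF bd s this, of 0]
    show "metric_det (tube_map X e) (zero_section s :: real^('k + 'm)) = metric_det X s" by simp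
  qed (rule open_U smooth_X)+
qed

text \<open>The Laplacian of S in non-divergence form. The vector \<open>V\<close> is the contracted
  second derivative of the position; its inner products with the tangent vectors, raised by the
  inverse metric, are the contracted Christoffel symbols.\<close>

definition tangential_part :: "(real^'k \<Rightarrow> complex) \<Rightarrow> real^'k \<Rightarrow> complex"
  where "tangential_part f s = (let G = matrix_inv (induced_metric X s);
      V = (\<Sum>\<alpha>\<in>UNIV. \<Sum>\<beta>\<in>UNIV. G $ \<alpha> $ \<beta> *\<^sub>R partial \<beta> (partial \<alpha> X) s) in
    (\<Sum>\<alpha>\<in>UNIV. \<Sum>\<beta>\<in>UNIV. G $ \<alpha> $ \<beta> *\<^sub>R partial \<beta> (partial \<alpha> f) s)
    - (\<Sum>\<alpha>\<in>UNIV. (\<Sum>\<beta>\<in>UNIV. G $ \<alpha> $ \<beta> * (partial \<beta> X s \<bullet> V)) *\<^sub>R partial \<alpha> f s))"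

text \<open>Differentiating the orthogonality of \<open>e i\<close> and the tangent vectors moves
  the derivative from X to the frame: the second fundamental form in terms of the Weingarten
  matrix.\<close>

lemma normal_second_partial:
  assumes s: "s \<in> U" and A: "weingarten i s A"
  shows "e i s \<bullet> partial \<beta> (partial \<alpha> X) s = (\<Sum>\<gamma>\<in>UNIV. A $ \<gamma> $ \<beta> * (partial \<gamma> X s \<bullet> partial \<alpha> X s))"
proof -
  have "partial \<beta> (\<lambda>s. e i s \<bullet> partial \<alpha> X s) s = partial \<beta> (\<lambda>_. 0) s"
    by (rule partial_cong[OF open_U s normal])
  also have "\<dots> = (0::real)" by (rule partial_eqI) auto
  finally have "e i s \<bullet> partial \<beta> (partial \<alpha> X) s + partial \<beta> (e i) s \<bullet> partial \<alpha> X s = 0"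
    unfolding partial_bounded_bilinear[OF bounded_bilinear_inner smooth_on_at[OF smooth_e open_U s]
        smooth_on_at[OF smooth_on_partial[OF smooth_X] open_U s]] .
  then have "e i s \<bullet> partial \<beta> (partial \<alpha> X) s = - partial \<beta> (e i) s \<bullet> partial \<alpha> X s" by simp
  also have "\<dots> = (\<Sum>\<gamma>\<in>UNIV. A $ \<gamma> $ \<beta> * (partial \<gamma> X s \<bullet> partial \<alpha> X s))"
    using A unfolding weingarten_def by (simp only:) (simp add: inner_sum_left)
  finally show ?thesis .
qed

text \<open>The quadratic form required of det(1 - t A) is what curves and surfaces provide:
  \<kappa> is 0 for a curve and det A for a surface. At q = 0 the inverse metric is block diagonal,
  so only pure tangential and pure normal second derivatives contribute.\<close>

lemma submanifold_schroedinger_formula: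
  assumes bd: "det_block_expansion TYPE('k + 'm)" and tube: "tube_coordinates U \<epsilon> X e"
    and s: "s \<in> U" and f: "smooth_on U f"
    and A: "\<And>i. weingarten i s (A i)"
    and P: "\<And>i t. det (mat 1 - t *\<^sub>R A i) = 1 - trace (A i) * t + \<kappa> i * t\<^sup>2"
  shows "submanifold_schroedinger U \<epsilon> X e f s =
    tangential_part f s + (\<Sum>i\<in>UNIV. (trace (A i))\<^sup>2 / 4 - \<kappa> i) *\<^sub>R f s"
proof -
  interpret T: tube_coordinates U \<epsilon> X e by (rule tube)
  let ?Y = "tube_map X e" and ?\<Omega> = "tube_domain U \<epsilon> :: (real^('k + 'm)) set"
  define u :: "real^('k + 'm)" where "u = zero_section s"
  have u: "u \<in> ?\<Omega>" unfolding u_def by (rule T.zero_section_mem[OF s])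
  define G where "G = matrix_inv (induced_metric X s)"
  have "invertible (induced_metric X s)"
    using T.gS_pos[OF s] invertible_det_nz[of "induced_metric X s"] unfolding metric_det_def by auto
  from someI_ex[OF this[unfolded invertible_def]]
  have G: "G ** induced_metric X s = mat 1" "induced_metric X s ** G = mat 1"
    unfolding G_def matrix_inv_def by auto
  define V where "V = (\<Sum>\<alpha>\<in>UNIV. \<Sum>\<beta>\<in>UNIV. G $ \<alpha> $ \<beta> *\<^sub>R partial \<beta> (partial \<alpha> X) s)"
  define C :: "real^('k + 'm)^('k + 'm)" where "C = (\<chi> \<mu> \<nu>. case \<mu> of
      Inl \<alpha> \<Rightarrow> (case \<nu> of Inl \<beta> \<Rightarrow> G $ \<alpha> $ \<beta> | Inr j \<Rightarrow> 0)
    | Inr i \<Rightarrow> (case \<nu> of Inl \<beta> \<Rightarrow> 0 | Inr j \<Rightarrow> if i = j then 1 else 0))"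
  have C: "C $ Inl \<alpha> $ Inl \<beta> = G $ \<alpha> $ \<beta>" "C $ Inl \<alpha> $ Inr j = 0" "C $ Inr i $ Inl \<beta> = 0"
    "C $ Inr i $ Inr j = (if i = j then 1 else 0)" for \<alpha> \<beta> i j
    by (simp_all add: C_def)
  have YL: "partial (Inl \<alpha>) ?Y u = partial \<alpha> X s" and YR: "partial (Inr i) ?Y u = e i s" for \<alpha> i
    using partial_tube_map[of u] s by (simp_all add: u_def)
  have dY: "?Y differentiable at v" "partial \<mu> ?Y differentiable at v" if "v \<in> ?\<Omega>" for v \<mu>
    using smooth_on_at[OF T.smooth T.open_dom that] smooth_on_at[OF smooth_on_partial[OF T.smooth] T.open_dom that] .
  have YLL: "partial (Inl \<beta>) (partial (Inl \<alpha>) ?Y) u = partial \<beta> (partial \<alpha> X) s" for \<alpha> \<beta>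
  proof -
    have "partial \<beta> (\<lambda>s. partial (Inl \<alpha>) ?Y (zero_section s)) s = partial \<beta> (partial \<alpha> X) s"
      by (rule partial_cong[OF open_U s]) (simp add: partial_tube_map(1))
    then show ?thesis
      using partial_zero_section[OF dY(2)[OF u[unfolded u_def]], of \<beta>] by (simp add: u_def)
  qed
  \<comment> \<open>The tube map is affine in q. Hence the contracted second derivative of the tube
    map at q = 0 is the vector \<open>V\<close> of S.\<close>
  have YRR: "partial (Inr j) (partial (Inr i) ?Y) u = 0" for i j
  proof -
    have "partial (Inr j) (partial (Inr i) ?Y) u = partial (Inr j) (\<lambda>v. e i (tang_part v)) u"
      by (rule partial_cong[OF T.open_dom u]) (simp add: partial_tube_map(2) T.tang_part_mem)
    also have "\<dots> = 0"
      by (rule partial_tang_part(2)[OF smooth_on_at[OF smooth_e open_U]]) (simp add: u_def s)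
    finally show ?thesis .
  qed
  have M: "induced_metric ?Y u $ Inl \<alpha> $ Inl \<beta> = induced_metric X s $ \<alpha> $ \<beta>" "induced_metric ?Y u $ Inl \<alpha> $ Inr j = 0"
     "induced_metric ?Y u $ Inr j $ Inl \<alpha> = 0" "induced_metric ?Y u $ Inr i $ Inr j = (if i = j then 1 else 0)" for \<alpha> \<beta> i j
    by (simp_all add: induced_metric_def YL YR normal[OF s] orthonormal[OF s] normal[OF s, unfolded inner_commute[of "e _ s"]])
  have CM: "C ** induced_metric ?Y u = mat 1"
  proof -
    have GM: "(\<Sum>\<gamma>\<in>UNIV. G $ \<alpha> $ \<gamma> * induced_metric X s $ \<gamma> $ \<beta>) = (if \<alpha> = \<beta> then 1 else 0)" for \<alpha> \<beta>
      using arg_cong[OF G(1), of "\<lambda>M. M $ \<alpha> $ \<beta>"] by (simp add: matrix_matrix_mult_def mat_def)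
    have "(C ** induced_metric ?Y u) $ \<mu> $ \<nu> = mat 1 $ \<mu> $ \<nu>" for \<mu> \<nu>
      by (cases \<mu>; cases \<nu>)
        (simp_all add: matrix_matrix_mult_def mat_def sum_UNIV_Plus C M GM if_distrib[of "\<lambda>z. z * _"] cong: if_cong)
    then show ?thesis by (simp add: vec_eq_iff)
  qed
  have VV: "(\<Sum>\<mu>\<in>UNIV. \<Sum>\<nu>\<in>UNIV. C $ \<mu> $ \<nu> *\<^sub>R partial \<nu> (partial \<mu> ?Y) u) = V"
    by (simp add: sum_UNIV_Plus C YLL YRR V_def)
  define b where "b = (\<chi> \<mu>. \<Sum>\<nu>\<in>UNIV. C $ \<mu> $ \<nu> * (partial \<nu> ?Y u \<bullet> V))"
  have "V = (\<Sum>\<mu>\<in>UNIV. b $ \<mu> *\<^sub>R partial \<mu> ?Y u)"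
    using frame_expansion[OF CM[unfolded induced_metric_def] T.partials_span[OF u], of V]
    by (simp add: b_def scaleR_sum_left)
  with VV have Vb: "(\<Sum>\<mu>\<in>UNIV. \<Sum>\<nu>\<in>UNIV. C $ \<mu> $ \<nu> *\<^sub>R partial \<nu> (partial \<mu> ?Y) u) = (\<Sum>\<mu>\<in>UNIV. b $ \<mu> *\<^sub>R partial \<mu> ?Y u)"
    by simp
  have bL: "b $ Inl \<alpha> = (\<Sum>\<beta>\<in>UNIV. G $ \<alpha> $ \<beta> * (partial \<beta> X s \<bullet> V))" for \<alpha>
    by (simp add: b_def sum_UNIV_Plus C YL)
  \<comment> \<open>The normal component of \<open>V\<close> pairs the second fundamental form with
    the inverse metric; metric and inverse cancel and the trace remains.\<close>
  have bR: "b $ Inr i = trace (A i)" for i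
  proof -
    have "b $ Inr i = e i s \<bullet> V"
      by (simp add: b_def sum_UNIV_Plus C YR if_distrib[of "\<lambda>z. z * _"] cong: if_cong)
    also have "\<dots> = (\<Sum>\<alpha>\<in>UNIV. \<Sum>\<beta>\<in>UNIV. \<Sum>\<gamma>\<in>UNIV. A i $ \<gamma> $ \<beta> * (induced_metric X s $ \<gamma> $ \<alpha> * G $ \<alpha> $ \<beta>))"
      unfolding V_def
      by (simp add: inner_sum_right normal_second_partial[OF s A] sum_distrib_left induced_metric_def mult_ac)
    also have "\<dots> = (\<Sum>\<beta>\<in>UNIV. \<Sum>\<gamma>\<in>UNIV. A i $ \<gamma> $ \<beta> * (induced_metric X s ** G) $ \<gamma> $ \<beta>)"
      by (rule trans[OF sum_swap3]) (simp add: matrix_matrix_mult_def sum_distrib_left)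
    also have "\<dots> = trace (A i)"
      by (simp add: G(2) mat_def trace_def if_distrib cong: if_cong)
    finally show ?thesis .
  qed
  note sl = T.smooth_lift[OF f]
  have dl: "T.lift f differentiable at v" "partial \<mu> (T.lift f) differentiable at v" if "v \<in> ?\<Omega>" for v \<mu>
    using smooth_on_at[OF sl T.open_dom that] smooth_on_at[OF smooth_on_partial[OF sl] T.open_dom that] .
  \<comment> \<open>Stated at all points of U, since it is differentiated once more in
    \<open>fLL\<close>.\<close>
  have fL: "partial (Inl \<alpha>) (T.lift f) (zero_section s') = partial \<alpha> f s'" if "s' \<in> U" for \<alpha> s'
  proof -
    have "partial \<alpha> (\<lambda>s. T.lift f (zero_section s)) s' = partial \<alpha> f s'"
      by (rule partial_cong[OF open_U that]) (rule T.lift_zero_section)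
    then show ?thesis
      using partial_zero_section[OF dl(1)[OF T.zero_section_mem[OF that]], of \<alpha>] by simp
  qed
  have fLL: "partial (Inl \<beta>) (partial (Inl \<alpha>) (T.lift f)) u = partial \<beta> (partial \<alpha> f) s" for \<alpha> \<beta>
  proof -
    have "partial \<beta> (\<lambda>s. partial (Inl \<alpha>) (T.lift f) (zero_section s)) s = partial \<beta> (partial \<alpha> f) s"
      by (rule partial_cong[OF open_U s]) (rule fL)
    then show ?thesis
      using partial_zero_section[OF dl(2)[OF T.zero_section_mem[OF s]], of \<beta>] by (simp add: u_def)
  qed
  have fR: "partial (Inr i) (T.lift f) u = (trace (A i) / 2) *\<^sub>R f s"
    and fRR: "partial (Inr i) (partial (Inr i) (T.lift f)) u = (3 / 4 * (trace (A i))\<^sup>2 - \<kappa> i) *\<^sub>R f s" for i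
  proof -
    let ?l = "\<lambda>t. u + t *\<^sub>R axis (Inr i) 1"
    have l: "?l t \<in> ?\<Omega>" if "\<bar>t\<bar> < \<epsilon>" for t
      using that s by (simp add: tube_domain_def u_def norm_part_line norm_axis_1)
    have "T.lift f (?l t) = (((1 - trace (A i) * t + \<kappa> i * t\<^sup>2)\<^sup>2) powr (-1/4)) *\<^sub>R f s" for t
    proof -
      have "metric_det ?Y (?l t) = metric_det X s * (1 - trace (A i) * t + \<kappa> i * t\<^sup>2)\<^sup>2"
        unfolding u_def metric_det_line[OF bd s A] P ..
      moreover have "metric_det X s powr (-1/4) * metric_det X s powr (1/4) = 1"
        using T.gS_pos[OF s] powr_add[of "metric_det X s" "-1/4" "1/4"] by simp
      ultimately show ?thesis
        using T.gS_pos[OF s] by (simp add: T.lift_def u_def powr_mult)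
    qed
    moreover have "((\<lambda>t. T.lift f (?l t)) has_vector_derivative partial (Inr i) (T.lift f) (?l t)) (at t)"
      if "\<bar>t\<bar> < \<epsilon>" for t by (rule has_vector_derivative_line[OF dl(1)[OF l[OF that]]])
    moreover have "((\<lambda>t. partial (Inr i) (T.lift f) (?l t)) has_vector_derivative
        partial (Inr i) (partial (Inr i) (T.lift f)) (?l 0)) (at 0)"
      by (rule has_vector_derivative_line[OF dl(2)[OF l]]) (use T.\<epsilon>_pos in simp)
    ultimately show "partial (Inr i) (T.lift f) u = (trace (A i) / 2) *\<^sub>R f s"
      and "partial (Inr i) (partial (Inr i) (T.lift f)) u = (3 / 4 * (trace (A i))\<^sup>2 - \<kappa> i) *\<^sub>R f s"
      using second_derivative_density[OF T.\<epsilon>_pos, of "\<lambda>t. T.lift f (?l t)" "trace (A i)" "\<kappa> i" "f s"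
          "\<lambda>t. partial (Inr i) (T.lift f) (?l t)" "partial (Inr i) (partial (Inr i) (T.lift f)) (?l 0)"] by simp_all
  qed
  have "submanifold_schroedinger U \<epsilon> X e f s =
    (\<Sum>\<mu>\<in>UNIV. \<Sum>\<nu>\<in>UNIV. C $ \<mu> $ \<nu> *\<^sub>R partial \<nu> (partial \<mu> (T.lift f)) u)
    - (\<Sum>\<mu>\<in>UNIV. b $ \<mu> *\<^sub>R partial \<mu> (T.lift f) u)"
    using T.submanifold_schroedinger_coordinates[OF f s CM[unfolded u_def] Vb[unfolded u_def]] by (simp only: u_def)
  also have "\<dots> = tangential_part f s
      + (\<Sum>i\<in>UNIV. (3 / 4 * (trace (A i))\<^sup>2 - \<kappa> i) *\<^sub>R f s - trace (A i) *\<^sub>R (trace (A i) / 2) *\<^sub>R f s)"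
    unfolding tangential_part_def Let_def G_def[symmetric] V_def[symmetric] bL[symmetric]
    by (simp add: sum_UNIV_Plus C fLL fL[OF s, folded u_def] fR fRR bR if_distrib[of "\<lambda>z. z *\<^sub>R _"] sum_subtractf cong: if_cong)
  \<comment> \<open>The first-order normal term subtracts half the squared trace from three quarters
    of it.\<close>
  also have "(\<Sum>i\<in>UNIV. (3 / 4 * (trace (A i))\<^sup>2 - \<kappa> i) *\<^sub>R f s - trace (A i) *\<^sub>R (trace (A i) / 2) *\<^sub>R f s)
      = (\<Sum>i\<in>UNIV. (trace (A i))\<^sup>2 / 4 - \<kappa> i) *\<^sub>R f s"
    unfolding scaleR_sum_left
    by (intro sum.cong refl) (simp add: scaleR_diff_left[symmetric] power2_eq_square)
  finally show ?thesis .
qed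

end

section \<open>Curves\<close>

lemma framed_patch_chart:
  assumes "analytic_chart S U X" "adapted_frame U X e"
  shows "framed_patch U X e"
proof
  obtain X' where X': "homeomorphism U (X ` U) X X'" using assms(1) unfolding analytic_chart_def by blast
  show "inj_on X U" by (rule inj_on_inverseI[where g=X']) (rule homeomorphism_apply1[OF X'])
qed (use assms in \<open>auto simp: analytic_chart_def real_analytic_on_def\<close>)

text \<open>Permutations of three indices are built by inserting one index at a time. The index type
  is left general so that both \<open>1 + 2\<close> and \<open>2 + 1\<close> are covered.\<close>

lemma det_three_elements:
  fixes A :: "real^'n^'n"
  assumes U: "(UNIV :: 'n set) = {a, b, c}" and ne: "a \<noteq> b" "a \<noteq> c" "b \<noteq> c"
  shows "det A =
    A$a$a * A$b$b * A$c$c + A$a$b * A$b$c * A$c$a + A$a$c * A$b$a * A$c$b -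
    A$a$a * A$b$c * A$c$b - A$a$b * A$b$a * A$c$c - A$a$c * A$b$b * A$c$a"
proof -
  have f1: "finite {b, c}" "a \<notin> {b, c}" and f2: "finite {c}" "b \<notin> {c}" using ne by auto
  show ?thesis
    unfolding det_def U
    unfolding sum_over_permutations_insert[OF f1]
    unfolding sum_over_permutations_insert[OF f2]
    unfolding permutes_sing
    using ne by (simp add: sign_swap_id permutation_swap_id sign_compose sign_id swap_id_eq)
qed

lemma det_block_expansion_1_2: "det_block_expansion TYPE(1 + 2)"
proof -
  have U: "(UNIV :: (1 + 2) set) = {Inl 1, Inr 1, Inr 2}"
    unfolding UNIV_Plus_UNIV[symmetric] Plus_def UNIV_1 UNIV_2 by auto
  show ?thesis
    unfolding det_block_expansion_def by (auto simp: det_three_elements[OF U] det_1)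
qed

lemma det_block_expansion_2_1: "det_block_expansion TYPE(2 + 1)"
proof -
  have U: "(UNIV :: (2 + 1) set) = {Inl 1, Inl 2, Inr 1}"
    unfolding UNIV_Plus_UNIV[symmetric] Plus_def UNIV_1 UNIV_2 by auto
  show ?thesis
    unfolding det_block_expansion_def by (auto simp: det_three_elements[OF U] det_2)
qed

lemma matrix_inv_induced_metric:
  assumes "metric_det X s > 0"
  shows "matrix_inv (induced_metric X s) ** induced_metric X s = mat 1"
proof -
  have "invertible (induced_metric X s)"
    using assms invertible_det_nz[of "induced_metric X s"] unfolding metric_det_def by auto
  from someI_ex[OF this[unfolded invertible_def]]
  show ?thesis unfolding matrix_inv_def by auto
qed

section \<open>Arclength derivatives on a chart of a curve\<close>

context
  fixes U :: "(real^1) set" and X :: "real^1 \<Rightarrow> real^3"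
  assumes open_U: "open U" and smooth_X: "smooth_on U X"
    and pos: "\<And>t. t \<in> U \<Longrightarrow> metric_det X t > 0"
begin

lemma metric_det_curve: "metric_det X t = partial 1 X t \<bullet> partial 1 X t"
  by (simp add: metric_det_def det_1 induced_metric_def)

lemma arclength_deriv_eq:
  assumes "t \<in> U"
  shows "arclength_deriv X h t = (metric_det X t powr (-1/2)) *\<^sub>R partial 1 h t"
proof -
  have "norm (partial 1 X t) = metric_det X t powr (1/2)"
    using pos[OF assms] by (simp add: metric_det_curve norm_eq_sqrt_inner powr_half_sqrt)
  then show ?thesis by (simp add: arclength_deriv_def powr_minus)
qed

text \<open>The arclength derivative is g^(-1/2) times the coordinate derivative, and g' = 2 (X' .
  X''). Applied to f this is the tangential part of the operator; applied to X it is the curvature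
  vector.\<close>

lemma arclength_deriv_twice:
  fixes h :: "real^1 \<Rightarrow> 'b::real_normed_vector"
  assumes t: "t \<in> U" and h: "smooth_on U h"
  shows "arclength_deriv X (arclength_deriv X h) t =
    (1 / metric_det X t) *\<^sub>R partial 1 (partial 1 h) t
    - ((partial 1 X t \<bullet> partial 1 (partial 1 X) t) / (metric_det X t)\<^sup>2) *\<^sub>R partial 1 h t"
proof -
  let ?g = "metric_det X" and ?p = "partial 1 X"
  have sg: "smooth_on U ?g" by (rule smooth_on_metric_det[OF open_U smooth_X])
  note dg = smooth_on_at[OF sg open_U t]
  note dp = smooth_on_at[OF smooth_on_partial[OF smooth_X] open_U t]
  have "partial 1 ?g t = partial 1 (\<lambda>t. ?p t \<bullet> ?p t) t"
    by (rule partial_cong[OF open_U t]) (rule metric_det_curve)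
  also have "\<dots> = 2 * (?p t \<bullet> partial 1 ?p t)"
    unfolding partial_bounded_bilinear[OF bounded_bilinear_inner dp dp]
    by (simp add: inner_commute)
  finally have g': "partial 1 ?g t = 2 * (?p t \<bullet> partial 1 ?p t)" .
  have "partial 1 (arclength_deriv X h) t = partial 1 (\<lambda>t. (?g t powr (-1/2)) *\<^sub>R partial 1 h t) t"
    by (rule partial_cong[OF open_U t]) (rule arclength_deriv_eq)
  also have "\<dots> = (?g t powr (-1/2)) *\<^sub>R partial 1 (partial 1 h) t
      + (-1/2 * ?g t powr (-1/2 - 1) * partial 1 ?g t) *\<^sub>R partial 1 h t"
    using partial_scaleR[OF smooth_on_at[OF smooth_on_powr[OF open_U pos sg] open_U t]
        smooth_on_at[OF smooth_on_partial[OF h] open_U t]]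
    unfolding partial_powr[OF dg pos[OF t]] .
  finally have "arclength_deriv X (arclength_deriv X h) t =
      (?g t powr (-1/2) * ?g t powr (-1/2)) *\<^sub>R partial 1 (partial 1 h) t
      + (-1/2 * (?g t powr (-1/2) * ?g t powr (-1/2 - 1)) * partial 1 ?g t) *\<^sub>R partial 1 h t"
    unfolding arclength_deriv_eq[OF t] by (simp add: scaleR_add_right scaleR_diff_right mult_ac)
  also have "?g t powr (-1/2) * ?g t powr (-1/2) = 1 / ?g t"
    using pos[OF t] powr_add[of "?g t" "-1/2" "-1/2"] powr_minus_divide[of "?g t" 1] by simp
  also have "?g t powr (-1/2) * ?g t powr (-1/2 - 1) = 1 / (?g t)\<^sup>2"
    using pos[OF t] powr_add[of "?g t" "-1/2" "-1/2 - 1"] powr_minus_divide[of "?g t" 2] by simp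
  finally show ?thesis unfolding g' by simp
qed

end

text \<open>The potential is a quarter of the sum of the squared traces. Each trace is the component
  of the curvature vector along a frame normal, and that vector has no tangential component, so the
  sum is its squared length.\<close>

lemma curve_schroedinger:
  fixes X :: "real^1 \<Rightarrow> real^3" and e :: "2 \<Rightarrow> real^1 \<Rightarrow> real^3"
  assumes tub: "tubular_neighbourhood TYPE(1) S \<epsilon> T" and chart: "analytic_chart S U X"
    and frame: "adapted_frame U X e" and f: "smooth_on U f" and t: "t \<in> U"
  shows "submanifold_schroedinger U \<epsilon> X e f t =
    arclength_deriv X (arclength_deriv X f) t + (1/4 * (frenet_curvature X t)\<^sup>2) *\<^sub>R f t"
proof -
  interpret framed_patch U X e by (rule framed_patch_chart[OF chart frame])
  have tube: "tube_coordinates U \<epsilon> X e"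
    by (rule tube_coordinates_tube[OF det_block_expansion_1_2 tub chart])
  interpret T: tube_coordinates U \<epsilon> X e by (rule tube)
  let ?g = "metric_det X t" and ?p = "partial 1 X t" and ?q = "partial 1 (partial 1 X) t"
  have g: "?g > 0" by (rule T.gS_pos[OF t])
  have gp: "?g = ?p \<bullet> ?p" by (rule metric_det_curve[OF open_U smooth_X T.gS_pos])
  obtain A where A: "\<And>i. weingarten i t (A i)" using weingarten_exists[OF t] by metis
  \<comment> \<open>A component of the curvature vector along \<open>e i\<close>; not the
    torsion.\<close>
  define \<tau> where "\<tau> i = trace (A i)" for i
  have \<tau>: "\<tau> i = A i $ 1 $ 1" for i by (simp add: \<tau>_def trace_def)
  have "det (mat 1 - r *\<^sub>R A i) = 1 - trace (A i) * r + 0 * r\<^sup>2" for i r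
    by (simp add: det_1 mat_def trace_def)
  from submanifold_schroedinger_formula[OF det_block_expansion_1_2 tube t f A this]
  have sub: "submanifold_schroedinger U \<epsilon> X e f t = tangential_part f t + (\<Sum>i\<in>UNIV. (\<tau> i)\<^sup>2 / 4) *\<^sub>R f t"
    by (simp add: \<tau>_def)
  have "(matrix_inv (induced_metric X t) ** induced_metric X t) $ 1 $ 1 = 1"
    by (simp add: matrix_inv_induced_metric[OF g] mat_def)
  then have Gi: "matrix_inv (induced_metric X t) $ 1 $ 1 = 1 / ?g"
    using g by (simp add: matrix_matrix_mult_def metric_det_def det_1 field_simps)
  have tan: "tangential_part f t = arclength_deriv X (arclength_deriv X f) t"
  proof -
    have "tangential_part f t = (1 / ?g) *\<^sub>R partial 1 (partial 1 f) t - ((?p \<bullet> ?q) / ?g\<^sup>2) *\<^sub>R partial 1 f t"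
      unfolding tangential_part_def Let_def by (simp add: Gi power2_eq_square)
    also have "\<dots> = arclength_deriv X (arclength_deriv X f) t"
      by (rule arclength_deriv_twice[OF open_U smooth_X T.gS_pos t f, symmetric])
    finally show ?thesis .
  qed
  define N where "N = arclength_deriv X (frenet_tangent X) t"
  have N: "N = (1 / ?g) *\<^sub>R ?q - ((?p \<bullet> ?q) / ?g\<^sup>2) *\<^sub>R ?p"
    unfolding N_def frenet_tangent_def
    by (rule arclength_deriv_twice[OF open_U smooth_X T.gS_pos t smooth_X])
  have Np: "?p \<bullet> N = 0"
    using g unfolding N by (simp add: inner_diff_right gp[symmetric] power2_eq_square)
  have Ne: "e i t \<bullet> N = \<tau> i" for i
    using g unfolding N
    by (simp add: inner_diff_right normal[OF t] normal_second_partial[OF t A] \<tau> gp[symmetric])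
  \<comment> \<open>Parseval in the frame formed by the velocity and the two normals, which spans
    space because the tube map is a coordinate map.\<close>
  have "N \<bullet> N = (\<Sum>i\<in>UNIV. (\<tau> i)\<^sup>2)"
  proof -
    define v :: "1 + 2 \<Rightarrow> real^3" where "v = (\<lambda>\<mu>. partial \<mu> (tube_map X e) (zero_section t))"
    have vL: "v (Inl 1) = ?p" and vR: "v (Inr i) = e i t" for i
      using partial_tube_map[of "zero_section t"] t by (simp_all add: v_def)
    have "N \<in> span (range v)"
      unfolding v_def by (rule T.partials_span[OF T.zero_section_mem[OF t]])
    then obtain c where c: "N = (\<Sum>\<mu>\<in>UNIV. c \<mu> *\<^sub>R v \<mu>)" using span_range_coeffs by blast
    then have cN: "N = c (Inl 1) *\<^sub>R ?p + (\<Sum>i\<in>UNIV. c (Inr i) *\<^sub>R e i t)"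
      by (simp add: sum_UNIV_Plus vL vR)
    have ci: "c (Inr i) = \<tau> i" for i
    proof -
      have "e i t \<bullet> N = c (Inr i)"
        by (subst cN) (simp add: inner_add_right inner_sum_right normal[OF t] orthonormal[OF t] if_distrib cong: if_cong)
      then show ?thesis by (simp add: Ne)
    qed
    have "N \<bullet> N = (c (Inl 1) *\<^sub>R ?p + (\<Sum>i\<in>UNIV. c (Inr i) *\<^sub>R e i t)) \<bullet> N"
      using cN by simp
    also have "\<dots> = (\<Sum>i\<in>UNIV. (\<tau> i)\<^sup>2)"
      by (simp add: inner_add_left inner_sum_left Np Ne ci power2_eq_square)
    finally show ?thesis .
  qed
  then have "(frenet_curvature X t)\<^sup>2 = (\<Sum>i\<in>UNIV. (\<tau> i)\<^sup>2)"
    unfolding frenet_curvature_def N_def[symmetric] by (simp add: dot_square_norm[symmetric])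
  then show ?thesis
    unfolding sub tan by (simp add: sum_divide_distrib)
qed

text \<open>The torsion integral is real and enters only as a phase of modulus one, so the base
  point \<open>t0\<close> does not affect the modulus.\<close>

lemma norm_complex_curvature: "(cmod (complex_curvature X t0 t))\<^sup>2 = (frenet_curvature X t)\<^sup>2"
  unfolding complex_curvature_def norm_mult norm_exp_i_times by simp

section \<open>Surfaces\<close>

lemma matrix_left_inverse_2:
  fixes M N :: "real^2^2"
  assumes "N ** M = mat 1" "det M \<noteq> 0"
  shows "N $ 1 $ 1 = M $ 2 $ 2 / det M" "N $ 1 $ 2 = - M $ 1 $ 2 / det M"
    "N $ 2 $ 1 = - M $ 2 $ 1 / det M" "N $ 2 $ 2 = M $ 1 $ 1 / det M"
proof -
  have N: "N $ i $ 1 * M $ 1 $ j + N $ i $ 2 * M $ 2 $ j = (if i = j then 1 else 0)" for i j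
    using arg_cong[OF assms(1), of "\<lambda>M. M $ i $ j"] by (simp add: matrix_matrix_mult_def mat_def sum_2)
  have e: "N $ i $ 1 * det M = (if i = 1 then 1 else 0) * M $ 2 $ 2 - (if i = 2 then 1 else 0) * M $ 2 $ 1"
    "N $ i $ 2 * det M = (if i = 2 then 1 else 0) * M $ 1 $ 1 - (if i = 1 then 1 else 0) * M $ 1 $ 2" for i
    unfolding N[symmetric] det_2 by (simp_all add: algebra_simps)
  show "N $ 1 $ 1 = M $ 2 $ 2 / det M" "N $ 1 $ 2 = - M $ 1 $ 2 / det M"
    "N $ 2 $ 1 = - M $ 2 $ 1 / det M" "N $ 2 $ 2 = M $ 1 $ 1 / det M"
    using e[of 1] e[of 2] assms(2) by (simp_all add: eq_divide_eq del: divide_minus_left)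
qed

lemma partial_mult:
  fixes f h :: "real^'d \<Rightarrow> real"
  assumes "f differentiable at x" "h differentiable at x"
  shows "partial i (\<lambda>x. f x * h x) x = f x * partial i h x + partial i f x * h x"
  using partial_bounded_bilinear[OF bounded_bilinear_mult assms] .

lemma partial_diff:
  assumes "f differentiable at x" "h differentiable at x"
  shows "partial i (\<lambda>x. f x - h x) x = partial i f x - partial i h x"
proof -
  obtain D where D: "(f has_derivative D) (at x)" "\<forall>i. D (axis i 1) = partial i f x"
    using has_derivative_with_partials[OF assms(1)] by blast
  obtain E where E: "(h has_derivative E) (at x)" "\<forall>i. E (axis i 1) = partial i h x"
    using has_derivative_with_partials[OF assms(2)] by blast
  show ?thesis using partial_eqI[OF has_derivative_diff[OF D(1) E(1)]] D(2) E(2) by simp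
qed

text \<open>Here \<open>pabc\<close> stands for \<open>X\<^sub>a\<^sub>b \<bullet> X\<^sub>c\<close> and \<open>D1\<close>, \<open>D2\<close> for the derivatives of the discriminant \<open>D\<close> of the
  first fundamental form. Both sides are the coefficient of \<open>\<partial>\<^sub>1 f\<close>, on the left in \<open>\<Delta>\<^sub>S f\<close>, on the right
  in \<open>\<Delta>\<^bsub>S\<hookrightarrow>E\<^esub> f\<close>; exchanging the coordinates gives that of \<open>\<partial>\<^sub>2 f\<close>.\<close>

lemma contracted_christoffel:
  fixes E F G D :: real
  assumes D: "D = E * G - F * F" "D \<noteq> 0"
    and d1: "D1 = E * (2 * p122) + 2 * p111 * G - 2 * F * (p112 + p121)"
    and d2: "D2 = E * (2 * p222) + 2 * p121 * G - 2 * F * (p122 + p221)"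
  shows "1 / D * (2 * p122) - D1 / (2 * D\<^sup>2) * G - (1 / D * (p122 + p221) - D2 / (2 * D\<^sup>2) * F)
    = - (G / D * ((G * p111 - 2 * F * p121 + E * p221) / D) - F / D * ((G * p112 - 2 * F * p122 + E * p222) / D))"
proof -
  \<comment> \<open>Over the common denominator 2 D^2 the difference of the two sides has a
    polynomial numerator, which cancels once D, D1 and D2 are expanded.\<close>
  have "1 / D * (2 * p122) - D1 / (2 * D\<^sup>2) * G - (1 / D * (p122 + p221) - D2 / (2 * D\<^sup>2) * F)
    + (G / D * ((G * p111 - 2 * F * p121 + E * p221) / D) - F / D * ((G * p112 - 2 * F * p122 + E * p222) / D))
    = (2 * D * (p122 - p221) - D1 * G + D2 * F
      + 2 * G * (G * p111 - 2 * F * p121 + E * p221) - 2 * F * (G * p112 - 2 * F * p122 + E * p222)) / (2 * D\<^sup>2)"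
    using D(2) by (simp add: field_simps power2_eq_square)
  also have "\<dots> = 0" unfolding d1 d2 D(1) by (simp add: algebra_simps)
  finally show ?thesis by simp
qed

text \<open>Expanding the divergence form gives the same second-order terms as
  \<open>tangential_part\<close>; the first-order coefficients agree because derivatives of the
  metric are sums of inner products of second with first derivatives of X.\<close>

lemma beltrami_laplace_surface:
  fixes X :: "real^2 \<Rightarrow> real^3" and e :: "1 \<Rightarrow> real^2 \<Rightarrow> real^3"
  assumes patch: "framed_patch U X e" and pos: "\<And>s. s \<in> U \<Longrightarrow> metric_det X s > 0"
    and s: "s \<in> U" and f: "smooth_on U f"
  shows "framed_patch.tangential_part X f s = beltrami_laplace (induced_metric X) f s"
proof -
  interpret framed_patch U X e by (rule patch)
  define D where "D = metric_det X"
  define m where "m i j t = partial i X t \<bullet> partial j X t" for i j t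
  define w where "w t = D t powr (-1/2)" for t
  have Dm: "D = (\<lambda>t. m 1 1 t * m 2 2 t - m 1 2 t * m 1 2 t)"
    by (simp add: fun_eq_iff D_def m_def metric_det_def det_2 induced_metric_def inner_commute[of "partial 2 X _" "partial 1 X _"])
  have Dpos: "D t > 0" if "t \<in> U" for t using pos[OF that] by (simp add: D_def)
  have sX: "smooth_on U (partial i X)" "smooth_on U (partial j (partial i X))" for i j
    using smooth_on_partial[OF smooth_X] smooth_on_partial[OF smooth_on_partial[OF smooth_X]] .
  have sf: "smooth_on U (partial i f)" for i by (rule smooth_on_partial[OF f])
  have sm: "smooth_on U (m i j)" for i j
    unfolding m_def[abs_def] by (intro smooth_on_inner open_U sX)
  have sD: "smooth_on U D" unfolding D_def by (rule smooth_on_metric_det[OF open_U smooth_X])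
  have sw: "smooth_on U w" unfolding w_def[abs_def] by (intro smooth_on_powr open_U Dpos sD)
  have dif: "h differentiable at s" if "smooth_on U h" for h :: "real^2 \<Rightarrow> 'z::real_normed_vector"
    by (rule smooth_on_at[OF that open_U s])
  have inv: "matrix_inv (induced_metric X t) $ 1 $ 1 = m 2 2 t / D t"
    "matrix_inv (induced_metric X t) $ 1 $ 2 = - m 1 2 t / D t"
    "matrix_inv (induced_metric X t) $ 2 $ 1 = - m 1 2 t / D t"
    "matrix_inv (induced_metric X t) $ 2 $ 2 = m 1 1 t / D t" if "t \<in> U" for t
    using matrix_left_inverse_2[OF matrix_inv_induced_metric[OF pos[OF that]]] pos[OF that]
    by (simp_all add: D_def metric_det_def m_def induced_metric_def inner_commute[of "partial 2 X _" "partial 1 X _"])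
  have half: "D t powr (1/2) * (c / D t) = w t * c" if "t \<in> U" for t c
  proof -
    have "w t = D t powr (1/2) / D t"
      using Dpos[OF that] powr_diff[of "D t" "1/2" 1] by (simp add: w_def)
    then show ?thesis by simp
  qed
  \<comment> \<open>The inverse metric is the adjugate over D, so D^(1/2) times it is w times metric
    entries: only products have to be differentiated.\<close>
  have flux1: "det (induced_metric X t) powr (1/2) *\<^sub>R (\<Sum>j\<in>UNIV. matrix_inv (induced_metric X t) $ 1 $ j *\<^sub>R partial j f t)
      = (w t * m 2 2 t) *\<^sub>R partial 1 f t - (w t * m 1 2 t) *\<^sub>R partial 2 f t"
    and flux2: "det (induced_metric X t) powr (1/2) *\<^sub>R (\<Sum>j\<in>UNIV. matrix_inv (induced_metric X t) $ 2 $ j *\<^sub>R partial j f t)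
      = (w t * m 1 1 t) *\<^sub>R partial 2 f t - (w t * m 1 2 t) *\<^sub>R partial 1 f t" if "t \<in> U" for t
    using half[OF that, of "m 2 2 t"] half[OF that, of "m 1 2 t"] half[OF that, of "m 1 1 t"]
    by (simp_all add: sum_2 inv[OF that] D_def metric_det_def scaleR_add_right scaleR_diff_right)
  have flux: "partial k (\<lambda>t. (w t * m a b t) *\<^sub>R partial i f t - (w t * m c d t) *\<^sub>R partial j f t) s
    = ((w s * m a b s) *\<^sub>R partial k (partial i f) s + (w s * partial k (m a b) s + partial k w s * m a b s) *\<^sub>R partial i f s)
    - ((w s * m c d s) *\<^sub>R partial k (partial j f) s + (w s * partial k (m c d) s + partial k w s * m c d s) *\<^sub>R partial j f s)"
    for a b c d i j k
    unfolding partial_diff[OF dif[OF smooth_on_scaleR[OF open_U smooth_on_mult[OF open_U sw sm] sf]]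
        dif[OF smooth_on_scaleR[OF open_U smooth_on_mult[OF open_U sw sm] sf]]]
      partial_scaleR[OF dif[OF smooth_on_mult[OF open_U sw sm]] dif[OF sf]] partial_mult[OF dif[OF sw] dif[OF sm]] ..
  \<comment> \<open>The outer factor D^(-1/2) is again w, and its products with w and with the
    derivatives of w contain no fractional power of D.\<close>
  have w2: "w s * w s = 1 / D s"
    using Dpos[OF s] powr_add[of "D s" "-1/2" "-1/2"] powr_minus_divide[of "D s" 1] by (simp add: w_def)
  have w': "w s * partial k w s = - (partial k D s / (2 * (D s)\<^sup>2))" for k
  proof -
    have "partial k w s = -1/2 * D s powr (-1/2 - 1) * partial k D s"
      unfolding w_def[abs_def] by (rule partial_powr[OF dif[OF sD] Dpos[OF s]])
    moreover have "w s * D s powr (-1/2 - 1) = 1 / (D s)\<^sup>2"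
      using Dpos[OF s] powr_add[of "D s" "-1/2" "-1/2 - 1"] powr_minus_divide[of "D s" 2] by (simp add: w_def)
    moreover have "w s * (-1/2 * q * c) = -1/2 * (w s * q) * c" for q c by simp
    ultimately have "w s * partial k w s = -1/2 * (1 / (D s)\<^sup>2) * partial k D s" by (simp only:)
    then show ?thesis by simp
  qed
  have beltrami: "beltrami_laplace (induced_metric X) f s =
      (m 2 2 s / D s) *\<^sub>R partial 1 (partial 1 f) s - (m 1 2 s / D s) *\<^sub>R partial 1 (partial 2 f) s
      + ((m 1 1 s / D s) *\<^sub>R partial 2 (partial 2 f) s - (m 1 2 s / D s) *\<^sub>R partial 2 (partial 1 f) s)
      + (1 / D s * partial 1 (m 2 2) s - partial 1 D s / (2 * (D s)\<^sup>2) * m 2 2 s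
          - (1 / D s * partial 2 (m 1 2) s - partial 2 D s / (2 * (D s)\<^sup>2) * m 1 2 s)) *\<^sub>R partial 1 f s
      + (1 / D s * partial 2 (m 1 1) s - partial 2 D s / (2 * (D s)\<^sup>2) * m 1 1 s
          - (1 / D s * partial 1 (m 1 2) s - partial 1 D s / (2 * (D s)\<^sup>2) * m 1 2 s)) *\<^sub>R partial 2 f s"
  proof -
    have "beltrami_laplace (induced_metric X) f s = w s *\<^sub>R
        (partial 1 (\<lambda>t. (w t * m 2 2 t) *\<^sub>R partial 1 f t - (w t * m 1 2 t) *\<^sub>R partial 2 f t) s
        + partial 2 (\<lambda>t. (w t * m 1 1 t) *\<^sub>R partial 2 f t - (w t * m 1 2 t) *\<^sub>R partial 1 f t) s)"
    proof -
      define Q where "Q i y = det (induced_metric X y) powr (1/2) *\<^sub>R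
        (\<Sum>j\<in>UNIV. matrix_inv (induced_metric X y) $ i $ j *\<^sub>R partial j f y)" for i y
      have "beltrami_laplace (induced_metric X) f s = w s *\<^sub>R (\<Sum>i\<in>UNIV. partial i (Q i) s)"
        by (simp add: beltrami_laplace_def w_def D_def metric_det_def Q_def[abs_def])
      also have "(\<Sum>i\<in>UNIV. partial i (Q i) s) = partial 1 (Q 1) s + partial 2 (Q 2) s"
        by (rule sum_2)
      also have "partial 1 (Q 1) s = partial 1 (\<lambda>t. (w t * m 2 2 t) *\<^sub>R partial 1 f t - (w t * m 1 2 t) *\<^sub>R partial 2 f t) s"
        by (rule partial_cong[OF open_U s]) (simp only: Q_def flux1)
      also have "partial 2 (Q 2) s = partial 2 (\<lambda>t. (w t * m 1 1 t) *\<^sub>R partial 2 f t - (w t * m 1 2 t) *\<^sub>R partial 1 f t) s"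
        by (rule partial_cong[OF open_U s]) (simp only: Q_def flux2)
      finally show ?thesis .
    qed
    also have "\<dots> = (w s * w s * m 2 2 s) *\<^sub>R partial 1 (partial 1 f) s - (w s * w s * m 1 2 s) *\<^sub>R partial 1 (partial 2 f) s
      + ((w s * w s * m 1 1 s) *\<^sub>R partial 2 (partial 2 f) s - (w s * w s * m 1 2 s) *\<^sub>R partial 2 (partial 1 f) s)
      + (w s * w s * partial 1 (m 2 2) s + w s * partial 1 w s * m 2 2 s
          - (w s * w s * partial 2 (m 1 2) s + w s * partial 2 w s * m 1 2 s)) *\<^sub>R partial 1 f s
      + (w s * w s * partial 2 (m 1 1) s + w s * partial 2 w s * m 1 1 s
          - (w s * w s * partial 1 (m 1 2) s + w s * partial 1 w s * m 1 2 s)) *\<^sub>R partial 2 f s"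
      unfolding flux by (simp add: algebra_simps)
    finally show ?thesis unfolding w2 w' by simp
  qed
  define p where "p a b c = partial a (partial b X) s \<bullet> partial c X s" for a b c
  have dm: "partial k (m i j) s = p k i j + p k j i" for k i j
    unfolding m_def[abs_def] partial_bounded_bilinear[OF bounded_bilinear_inner dif[OF sX(1)] dif[OF sX(1)]]
    by (simp add: p_def inner_commute)
  have sym: "p 2 1 c = p 1 2 c" for c
    unfolding p_def using partial_symmetric[OF open_U s smooth_X, of 2 1] by simp
  have dD: "partial k D s = m 1 1 s * partial k (m 2 2) s + partial k (m 1 1) s * m 2 2 s
      - (m 1 2 s * partial k (m 1 2) s + partial k (m 1 2) s * m 1 2 s)" for k
    unfolding Dm partial_diff[OF dif[OF smooth_on_mult[OF open_U sm sm]] dif[OF smooth_on_mult[OF open_U sm sm]]]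
      partial_mult[OF dif[OF sm] dif[OF sm]] ..
  let ?E = "m 1 1 s" and ?F = "m 1 2 s" and ?G = "m 2 2 s" and ?D = "D s"
  have D0: "?D = ?E * ?G - ?F * ?F" "?D \<noteq> 0" using Dpos[OF s] by (simp_all add: Dm)
  have D0': "?D = ?G * ?E - ?F * ?F" using D0(1) by simp
  have c1: "1 / ?D * partial 1 (m 2 2) s - partial 1 D s / (2 * ?D\<^sup>2) * ?G
          - (1 / ?D * partial 2 (m 1 2) s - partial 2 D s / (2 * ?D\<^sup>2) * ?F)
    = - (?G / ?D * ((?G * p 1 1 1 - 2 * ?F * p 1 2 1 + ?E * p 2 2 1) / ?D)
        - ?F / ?D * ((?G * p 1 1 2 - 2 * ?F * p 1 2 2 + ?E * p 2 2 2) / ?D))"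
    using contracted_christoffel[OF D0, of "partial 1 D s" "p 1 2 2" "p 1 1 1" "p 1 1 2" "p 1 2 1" "partial 2 D s" "p 2 2 2" "p 2 2 1"]
    by (simp add: dD dm sym algebra_simps)
  have c2: "1 / ?D * partial 2 (m 1 1) s - partial 2 D s / (2 * ?D\<^sup>2) * ?E
          - (1 / ?D * partial 1 (m 1 2) s - partial 1 D s / (2 * ?D\<^sup>2) * ?F)
    = - (?E / ?D * ((?E * p 2 2 2 - 2 * ?F * p 1 2 2 + ?G * p 1 1 2) / ?D)
        - ?F / ?D * ((?E * p 2 2 1 - 2 * ?F * p 1 2 1 + ?G * p 1 1 1) / ?D))"
    using contracted_christoffel[OF D0' D0(2), of "partial 2 D s" "p 1 2 1" "p 2 2 2" "p 2 2 1" "p 1 2 2" "partial 1 D s" "p 1 1 1" "p 1 1 2"]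
    by (simp add: dD dm sym algebra_simps)
  define V where "V = (\<Sum>\<alpha>\<in>UNIV. \<Sum>\<beta>\<in>UNIV. matrix_inv (induced_metric X s) $ \<alpha> $ \<beta> *\<^sub>R partial \<beta> (partial \<alpha> X) s)"
  have V: "partial c X s \<bullet> V = (?G * p 1 1 c - 2 * ?F * p 1 2 c + ?E * p 2 2 c) / ?D" for c
    unfolding V_def
    by (simp add: sum_2 inv[OF s] inner_add_right inner_add_left inner_diff_left inner_commute[of "partial c X s"] p_def[symmetric] sym
        add_divide_distrib diff_divide_distrib)
  have "tangential_part f s =
      (m 2 2 s / D s) *\<^sub>R partial 1 (partial 1 f) s - (m 1 2 s / D s) *\<^sub>R partial 1 (partial 2 f) s
      + ((m 1 1 s / D s) *\<^sub>R partial 2 (partial 2 f) s - (m 1 2 s / D s) *\<^sub>R partial 2 (partial 1 f) s)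
      + (- (?G / ?D * (partial 1 X s \<bullet> V) - ?F / ?D * (partial 2 X s \<bullet> V))) *\<^sub>R partial 1 f s
      + (- (?E / ?D * (partial 2 X s \<bullet> V) - ?F / ?D * (partial 1 X s \<bullet> V))) *\<^sub>R partial 2 f s"
    unfolding tangential_part_def Let_def V_def[symmetric]
    by (simp add: sum_2 inv[OF s] algebra_simps)
  then show ?thesis
    unfolding beltrami c1 c2 V by (simp add: algebra_simps)
qed

text \<open>For a 2 by 2 matrix the quadratic coefficient of det(1 - t A) is det A, so the potential
  is (tr A)^2/4 - det A, and \<open>mean_curvature\<close> is half the trace.\<close>

lemma surface_schroedinger:
  fixes X :: "real^2 \<Rightarrow> real^3" and e :: "1 \<Rightarrow> real^2 \<Rightarrow> real^3"
  assumes tub: "tubular_neighbourhood TYPE(2) S \<epsilon> T" and chart: "analytic_chart S U X"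
    and frame: "adapted_frame U X e" and f: "smooth_on U f" and s: "s \<in> U"
  shows "submanifold_schroedinger U \<epsilon> X e f s = beltrami_laplace (induced_metric X) f s
    + ((mean_curvature X (e 1) s)\<^sup>2 - gauss_curvature X (e 1) s) *\<^sub>R f s"
proof -
  have patch: "framed_patch U X e" by (rule framed_patch_chart[OF chart frame])
  interpret framed_patch U X e by (rule patch)
  have tube: "tube_coordinates U \<epsilon> X e"
    by (rule tube_coordinates_tube[OF det_block_expansion_2_1 tub chart])
  interpret T: tube_coordinates U \<epsilon> X e by (rule tube)
  obtain A where A: "weingarten 1 s A" using weingarten_exists[OF s] by blast
  have shape: "shape_operator X (e 1) s = A"
    unfolding shape_operator_def weingarten_def[symmetric]
  \<comment> \<open>Linear independence of the tangent vectors makes the matrix in the definite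
    description unique, column by column.\<close>
  proof (rule the_equality[where P="weingarten 1 s", OF A])
    fix B assume B: "weingarten 1 s B"
    have "(\<chi> \<alpha>. B $ \<alpha> $ \<beta> - A $ \<alpha> $ \<beta>) = 0" for \<beta>
    proof (rule partials_independent[OF s])
      have "(\<Sum>\<alpha>\<in>UNIV. (B $ \<alpha> $ \<beta>) *\<^sub>R partial \<alpha> X s) = (\<Sum>\<alpha>\<in>UNIV. (A $ \<alpha> $ \<beta>) *\<^sub>R partial \<alpha> X s)"
        using A B unfolding weingarten_def by simp
      then show "(\<Sum>\<alpha>\<in>UNIV. (\<chi> \<alpha>. B $ \<alpha> $ \<beta> - A $ \<alpha> $ \<beta>) $ \<alpha> *\<^sub>R partial \<alpha> X s) = 0"
        by (simp add: scaleR_diff_left sum_subtractf)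
    qed
    then show "B = A" by (simp add: vec_eq_iff)
  qed
  have P: "det (mat 1 - t *\<^sub>R A) = 1 - trace A * t + det A * t\<^sup>2" for t
    by (simp add: det_2 mat_def trace_def sum_2 algebra_simps power2_eq_square)
  have W: "weingarten i s A" for i :: 1 using A num1_eq1[of i] by (simp only:)
  have "submanifold_schroedinger U \<epsilon> X e f s = tangential_part f s + (\<Sum>i\<in>(UNIV::1 set). (trace A)\<^sup>2 / 4 - det A) *\<^sub>R f s"
    by (rule submanifold_schroedinger_formula[OF det_block_expansion_2_1 tube s f W P])
  moreover have "tangential_part f s = beltrami_laplace (induced_metric X) f s"
    by (rule beltrami_laplace_surface[OF patch T.gS_pos s f])
  ultimately show ?thesis
    by (simp add: mean_curvature_def gauss_curvature_def shape power_divide)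
qed

theorem theorem4p4:
  shows
    "(\<forall>(C :: (real^3) set) T \<epsilon> (U :: (real^1) set) X (e :: 2 \<Rightarrow> real^1 \<Rightarrow> real^3).
        compact C \<and> analytic_submanifold TYPE(1) C \<and> tubular_neighbourhood TYPE(1) C \<epsilon> T \<and>
        analytic_chart C U X \<and> adapted_frame U X e \<longrightarrow>
        (\<forall>f. smooth_on U f \<longrightarrow>
          (\<forall>t\<in>U. \<forall>t0. closed_segment t0 t \<subseteq> U \<longrightarrow>
            - submanifold_schroedinger U \<epsilon> X e f t =
            - arclength_deriv X (arclength_deriv X f) t
            - (1/4 * (cmod (complex_curvature X t0 t))\<^sup>2) *\<^sub>R f t)))
     \<and>
     (\<forall>(S :: (real^3) set) T \<epsilon> (U :: (real^2) set) X (e :: 1 \<Rightarrow> real^2 \<Rightarrow> real^3).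
        compact S \<and> analytic_submanifold TYPE(2) S \<and> tubular_neighbourhood TYPE(2) S \<epsilon> T \<and>
        analytic_chart S U X \<and> adapted_frame U X e \<longrightarrow>
        (\<forall>f. smooth_on U f \<longrightarrow>
          (\<forall>s\<in>U.
            - submanifold_schroedinger U \<epsilon> X e f s =
            - beltrami_laplace (induced_metric X) f s
            - ((mean_curvature X (e 1) s)\<^sup>2 - gauss_curvature X (e 1) s) *\<^sub>R f s)))"
proof (intro conjI allI impI ballI; elim conjE)
  fix C :: "(real^3) set" and T \<epsilon> and U :: "(real^1) set" and X and e :: "2 \<Rightarrow> real^1 \<Rightarrow> real^3" and f :: "real^1 \<Rightarrow> complex" and t t0
  assume "tubular_neighbourhood TYPE(1) C \<epsilon> T" "analytic_chart C U X" "adapted_frame U X e"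
    "smooth_on U f" "t \<in> U"
  from curve_schroedinger[OF this]
  show "- submanifold_schroedinger U \<epsilon> X e f t = - arclength_deriv X (arclength_deriv X f) t
      - (1/4 * (cmod (complex_curvature X t0 t))\<^sup>2) *\<^sub>R f t"
    by (simp add: norm_complex_curvature)
next
  fix S :: "(real^3) set" and T \<epsilon> and U :: "(real^2) set" and X and e :: "1 \<Rightarrow> real^2 \<Rightarrow> real^3" and f :: "real^2 \<Rightarrow> complex" and s
  assume "tubular_neighbourhood TYPE(2) S \<epsilon> T" "analytic_chart S U X" "adapted_frame U X e"
    "smooth_on U f" "s \<in> U"
  from surface_schroedinger[OF this]
  show "- submanifold_schroedinger U \<epsilon> X e f s = - beltrami_laplace (induced_metric X) f s
      - ((mean_curvature X (e 1) s)\<^sup>2 - gauss_curvature X (e 1) s) *\<^sub>R f s"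
    by simp
qed

end
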